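(* Let $t_0$ be the largest (real) zero of $\mathcal I_{\rm Ai}(t)=\int_{-\infty}^t\mathrm{Ai}(u)\,du$. Then the radial negativity scale $\Delta_n^*$ of the Fock state $|n\rangle$ satisfies, as $n\to\infty$, $$\Delta_n^*=(2n+1)+2^{-1/3}t_0(4n+2)^{1/3}+O(n^{-1/3}).$$
   Context: Units $\hbar=1$. The Wigner function of the $n$-th harmonic-oscillator Fock state is $W_n(\boldsymbol r)=\pi^{-1}(-1)^nL_n(2|\boldsymbol r|^2)e^{-|\boldsymbol r|^2}$, $\boldsymbol r\in\mathbb R^2$, with $L_n$ the Laguerre polynomial. For $\Delta>0$ and $k\ge1$ the equal-area shell weights are $$P_{n,k}(\Delta)=\int_{(k-1)\Delta\le|\boldsymbol r|^2<k\Delta}W_n(\boldsymbol r)\,d\boldsymbol r=\int_{(k-1)\Delta}^{k\Delta}(-1)^nL_n(2\xi)e^{-\xi}\,d\xi.$$ The radial negativity scale is $\Delta_n^*=\sup\{\Delta>0:\exists\,k\ge1,\ P_{n,k}(\Delta)<0\}$, with $\Delta_n^*=0$ if the set is empty. $\mathrm{Ai}$ is the Airy function and the integral defining $\mathcal I_{\rm Ai}$ is taken as a convergent improper integral. (Numerically $t_0\simeq-1.38418$.) *)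

theory Defs
  imports "HOL-Analysis.Analysis" "HOL-Library.Landau_Symbols"
begin

definition laguerre :: "nat \<Rightarrow> real \<Rightarrow> real" where
  "laguerre n x = (\<Sum>k\<le>n. (-1) ^ k * real (n choose k) / fact k * x ^ k)"

definition fock_wigner :: "nat \<Rightarrow> real ^ 2 \<Rightarrow> real" where
  "fock_wigner n r = 1 / pi * (-1) ^ n * laguerre n (2 * (norm r)\<^sup>2) * exp (- (norm r)\<^sup>2)"

text \<open>The shell weights, for \<open>k \<ge> 1\<close>; the subtraction is in the reals.\<close>

definition shell_weight :: "nat \<Rightarrow> nat \<Rightarrow> real \<Rightarrow> real" where
  "shell_weight n k \<Delta> =
     (LINT r : {r. (real k - 1) * \<Delta> \<le> (norm r)\<^sup>2 \<and> (norm r)\<^sup>2 < real k * \<Delta>} | lborel.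
        fock_wigner n r)"

definition negative_scales :: "nat \<Rightarrow> real set" where
  "negative_scales n = {\<Delta>. \<Delta> > 0 \<and> (\<exists>k\<ge>1. shell_weight n k \<Delta> < 0)}"

text \<open>A real supremum: the set is bounded above, because \<open>fock_wigner n\<close> is positive outside a
  bounded set and has total integral 1.\<close>

definition radial_negativity_scale :: "nat \<Rightarrow> real" where
  "radial_negativity_scale n =
     (if negative_scales n = {} then 0 else Sup (negative_scales n))"

text \<open>The integral over \<open>[0, \<infinity>)\<close> converges only conditionally, hence a limit of integrals over
  compact intervals; likewise for the integral of \<open>Ai\<close> over \<open>(-\<infinity>, t]\<close>.\<close>

definition airy_Ai :: "real \<Rightarrow> real" where
  "airy_Ai x = 1 / pi * Lim at_top (\<lambda>R. integral {0..R} (\<lambda>s. cos (s ^ 3 / 3 + x * s)))"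

definition airy_Ai_integral :: "real \<Rightarrow> real" where
  "airy_Ai_integral t = Lim at_bot (\<lambda>a. integral {a..t} airy_Ai)"

definition is_largest_zero :: "(real \<Rightarrow> real) \<Rightarrow> real \<Rightarrow> bool" where
  "is_largest_zero f z \<longleftrightarrow> f z = 0 \<and> (\<forall>t. f t = 0 \<longrightarrow> t \<le> z)"

end

(*
  Write phi_n(x) = (-1)^n L_n(2x) exp(-x) and N = 2n+1. The shell weights are differences of the
  tail integral Y_n(x) of phi_n over [x, oo), whose generating function is
  sum_n Y_n(x) s^n = exp(-x (1-s)/(1+s)) / (1-s). Cauchy's formula on the circle s = exp(-2z),
  Re z = N^(-1/3), gives Y_n(x) as the integral of exp(N z - x tanh z) / sinh z over a vertical
  segment. With z = N^(-1/3) zeta and x = N + N^(1/3) t the integrand becomes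
  exp(zeta^3/3 - t zeta) / zeta up to a relative error of order N^(-2/3), hence
  Y_n(x) = Y(t) + O(N^(-2/3)) with Y the tail integral of Ai.

  Let f = 1 - Y be the integral of Ai from -oo. The functional f'' f - (f')^2/2 - t f^2/2 has
  derivative -f^2/2 and a limit <= 0 at -oo, so it is negative. Hence f has a zero (otherwise
  sqrt f would be positive and concave on a left half-line with limit 0), f' > 0 at the largest
  zero t0, and Ai >= 0 on [t0, oo). So 1 - Y_n changes sign within O(N^(-2/3)) of t0 in the
  variable t, and beyond that point no shell weight is negative, because phi_n > 0 on [N, oo).
*)
theory Submission
  imports Defs "HOL-Complex_Analysis.Complex_Analysis" "HOL-Probability.Sinc_Integral"
begin

subsection \<open>Laguerre polynomials and the radial cumulative weight\<close>

text \<open>At x = N the two saddle points of \<open>N z - x tanh z\<close> merge at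
  \<open>z = 0\<close>, which is also the pole of \<open>1 / sinh z\<close>: the cubic term sets the
  scale N^(-1/3), and the pole turns Ai into its integral. As sinh and tanh are odd, phase and
  amplitude are both corrected only at relative order N^(-2/3). Dividing by the slope Ai(t0) and
  multiplying by N^(1/3) turns this into the error n^(-1/3), so t0 has to be a simple zero.

  The integrals stay on Re zeta = 1, where the kernel decays like a Gaussian and the pole is
  avoided.

  The sign of Ai has two sources. On [0, oo) it is inherited from the Laguerre functions in the
  limit. Between t0 and 0 the negative functional makes every zero of Ai a downward crossing, which
  contradicts Ai(0) > 0.

  The first shell has weight 1 - Y_n(Delta) and locates the threshold. As Delta may lie below N
  there, the second shell needs a separate comparison: Y_n(Delta) stays bounded below while Y_n(2
  Delta) is small. All further shells start beyond N.\<close>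

definition fock_radial :: "nat \<Rightarrow> real \<Rightarrow> real" where
  "fock_radial n x = (-1) ^ n * laguerre n (2 * x) * exp (- x)"

text \<open>This closed form of the integral of \<open>fock_radial n\<close> over \<open>{x..}\<close> comes from the factor
  \<open>(1 + s) / (1 - s) = 1 + 2s + 2s\<^sup>2 + \<dots>\<close> between the two generating functions.\<close>

definition fock_tail :: "nat \<Rightarrow> real \<Rightarrow> real" where
  "fock_tail n x = fock_radial n x + 2 * (\<Sum>j<n. fock_radial j x)"

lemma laguerre_0 [simp]: "laguerre 0 x = 1" and laguerre_1: "laguerre (Suc 0) x = 1 - x"
  by (simp_all add: laguerre_def)

lemma laguerre_at_0: "laguerre n 0 = 1"
proof -
  have "laguerre n 0 = (\<Sum>k\<in>{0::nat}. (-1) ^ k * real (n choose k) / fact k * 0 ^ k)"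
    unfolding laguerre_def by (rule sum.mono_neutral_right) auto
  thus ?thesis by simp
qed

lemma laguerre_eq_sum: "n \<le> m \<Longrightarrow> laguerre n x = (\<Sum>k\<le>m. (-1) ^ k * real (n choose k) / fact k * x ^ k)"
  unfolding laguerre_def by (rule sum.mono_neutral_left) (auto simp: not_le)

text \<open>Pascal's rule leaves \<open>n choose j\<close> with \<open>k = j + 1\<close>, so each
  term is, up to sign, an antiderivative of a term of \<open>laguerre n\<close>.\<close>

lemma laguerre_Suc_diff:
  "laguerre (Suc n) x = laguerre n x - (\<Sum>j\<le>n. (-1) ^ j * real (n choose j) / fact (Suc j) * x ^ Suc j)"
proof -
  have "laguerre (Suc n) x - laguerre n x =
     (\<Sum>k\<le>Suc n. (-1) ^ k * (real (Suc n choose k) - real (n choose k)) / fact k * x ^ k)"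
    unfolding laguerre_eq_sum[OF order_refl, of "Suc n" x] laguerre_eq_sum[OF le_SucI[OF order_refl], of n x]
      sum_subtractf [symmetric]
    by (intro sum.cong refl) (simp add: algebra_simps diff_divide_distrib del: binomial_Suc_Suc)
  also have "\<dots> = (\<Sum>j\<le>n. (-1) ^ Suc j * real (n choose j) / fact (Suc j) * x ^ Suc j)"
    by (subst sum.atMost_Suc_shift) (simp del: fact_Suc power_Suc)
  also have "\<dots> = - (\<Sum>j\<le>n. (-1) ^ j * real (n choose j) / fact (Suc j) * x ^ Suc j)"
    by (simp add: sum_negf del: fact_Suc)
  finally show ?thesis by simp
qed

lemma DERIV_laguerre_Suc_diff:
  "((\<lambda>x. laguerre (Suc n) x - laguerre n x) has_real_derivative - laguerre n x) (at x)"
proof -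
  have "((\<lambda>x. - (\<Sum>j\<le>n. (-1) ^ j * real (n choose j) / fact (Suc j) * x ^ Suc j)) has_real_derivative
     - (\<Sum>j\<le>n. (-1) ^ j * real (n choose j) / fact (Suc j) * (real (Suc j) * x ^ j))) (at x)"
    by (intro DERIV_minus DERIV_sum DERIV_cmult) (rule DERIV_pow[THEN DERIV_cong], simp)
  moreover have "(\<Sum>j\<le>n. (-1) ^ j * real (n choose j) / fact (Suc j) * (real (Suc j) * x ^ j)) = laguerre n x"
    unfolding laguerre_def by (intro sum.cong) (simp_all add: field_simps del: of_nat_Suc)
  ultimately show ?thesis by (simp add: laguerre_Suc_diff)
qed

lemma laguerre_differentiable: "\<exists>D. (laguerre n has_real_derivative D) (at x)"
proof -
  have "(\<lambda>x. laguerre n x) differentiable (at x)"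
    unfolding laguerre_def by (intro derivative_intros) auto
  thus ?thesis by (simp add: real_differentiable_def)
qed

lemma fock_radial_differentiable: "\<exists>D. (fock_radial n has_real_derivative D) (at x)"
proof -
  obtain D where "(laguerre n has_real_derivative D) (at (2 * x))"
    using laguerre_differentiable by blast
  hence "((\<lambda>x. laguerre n (2 * x)) has_real_derivative D * 2) (at x)"
    by (rule DERIV_chain2[where g = "\<lambda>x. 2 * x"]) (auto intro!: derivative_eq_intros)
  hence "((\<lambda>x. (-1) ^ n * laguerre n (2 * x) * exp (- x)) has_real_derivative
     (-1) ^ n * (D * 2) * exp (- x) + (-1)^n * laguerre n (2*x) * (- exp (- x))) (at x)"
    by (auto intro!: derivative_eq_intros)
  thus ?thesis unfolding fock_radial_def by blast
qed

text \<open>The sign \<open>(-1) ^ n\<close> turns differences of Laguerre polynomials into sums.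
  These derivatives telescope along \<open>fock_tail_Suc\<close>, which is why the closed form of
  the tail works.\<close>

lemma fock_radial_Suc_deriv:
  "((\<lambda>x. fock_radial (Suc n) x + fock_radial n x) has_real_derivative
     fock_radial n x - fock_radial (Suc n) x) (at x)"
proof -
  have eq: "fock_radial (Suc n) x + fock_radial n x =
       (-1) ^ Suc n * ((laguerre (Suc n) (2 * x) - laguerre n (2 * x)) * exp (- x))" for x
    by (simp add: fock_radial_def algebra_simps)
  have "((\<lambda>x. laguerre (Suc n) (2 * x) - laguerre n (2 * x)) has_real_derivative - laguerre n (2 * x) * 2) (at x)"
    by (rule DERIV_chain2[OF DERIV_laguerre_Suc_diff, where g = "\<lambda>x. 2 * x"]) (auto intro!: derivative_eq_intros)
  hence "((\<lambda>x. (-1) ^ Suc n * ((laguerre (Suc n) (2 * x) - laguerre n (2 * x)) * exp (- x))) has_real_derivative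
     (-1) ^ Suc n * ((- laguerre n (2 * x) * 2) * exp (-x) + (- exp (- x)) * (laguerre (Suc n) (2 * x) - laguerre n (2 * x)))) (at x)"
    by (intro DERIV_cmult DERIV_mult) (auto intro!: derivative_eq_intros)
  thus ?thesis unfolding eq by (simp add: fock_radial_def algebra_simps)
qed

lemma fock_tail_Suc: "fock_tail (Suc n) x = fock_tail n x + (fock_radial (Suc n) x + fock_radial n x)"
  by (simp add: fock_tail_def)

lemma DERIV_fock_tail: "(fock_tail n has_real_derivative - fock_radial n x) (at x)"
proof (induction n)
  case 0
  show ?case unfolding fock_tail_def fock_radial_def by (auto intro!: derivative_eq_intros)
next
  case (Suc n)
  from DERIV_add[OF Suc fock_radial_Suc_deriv[of n x]] show ?case
    unfolding fock_tail_Suc[abs_def] by simp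
qed

text \<open>At 0 the radial functions are alternating signs, so consecutive ones cancel. The total
  weight is therefore 1, and the first shell weight is
  \<open>1 - fock_tail n \<Delta>\<close>.\<close>

lemma fock_tail_0: "fock_tail n 0 = 1"
  by (induction n) (simp_all add: fock_tail_Suc fock_tail_def[of 0] fock_radial_def laguerre_at_0)

section \<open>Three-term recurrence and positivity beyond the turning point\<close>

lemma binomial_three_term:
  "(real m + 2) * real (Suc (Suc m) choose k) =
   (2 * real m + 3) * real (Suc m choose k) + real k * real (Suc m choose (k - 1)) - (real m + 1) * real (m choose k)"
proof (cases k)
  case (Suc j)
  show ?thesis
  proof (cases j)
    case 0
    with Suc show ?thesis by (simp add: algebra_simps)
  next
    case (Suc i)
    have "Suc i * (m choose Suc i) = (m - i) * (m choose i)"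
      by (simp only: binomial_absorb_comp binomial_absorption)
    hence "real (Suc i * (m choose Suc i)) = real ((m - i) * (m choose i))" by (rule arg_cong)
    hence "(real i + 1) * real (m choose Suc i) = (real m - real i) * real (m choose i)"
      by (cases "i \<le> m") (auto simp: of_nat_diff algebra_simps)
    thus ?thesis using \<open>k = Suc j\<close> Suc by (simp add: algebra_simps)
  qed
qed (simp add: algebra_simps)

text \<open>Comparison of the coefficients of \<open>x ^ k\<close>. The binomial with
  \<open>k - 1\<close> is the contribution of \<open>x * laguerre (Suc m) x\<close>; at
  \<open>k = 0\<close> its factor \<open>k\<close> makes the truncated subtraction harmless.\<close>

lemma laguerre_three_term:
  "(real m + 2) * laguerre (Suc (Suc m)) x = (2 * real m + 3 - x) * laguerre (Suc m) x - (real m + 1) * laguerre m x"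
proof -
  let ?M = "Suc (Suc m)"
  have X: "x * laguerre (Suc m) x = - (\<Sum>k\<le>?M. (-1) ^ k * (real k * real (Suc m choose (k - 1))) / fact k * x ^ k)"
  proof -
    have "(\<Sum>k\<le>?M. (-1) ^ k * (real k * real (Suc m choose (k - 1))) / fact k * x ^ k) =
        (\<Sum>j\<le>Suc m. (-1) ^ Suc j * (real (Suc j) * real (Suc m choose j)) / fact (Suc j) * x ^ Suc j)"
      by (subst sum.atMost_Suc_shift) (simp del: fact_Suc power_Suc sum.atMost_Suc)
    also have "\<dots> = (\<Sum>j\<le>Suc m. - x * ((-1) ^ j * real (Suc m choose j) / fact j * x ^ j))"
      by (intro sum.cong refl) (simp add: field_simps del: of_nat_Suc)
    also have "\<dots> = - x * laguerre (Suc m) x"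
      unfolding laguerre_def sum_distrib_left ..
    finally show ?thesis by simp
  qed
  have "(real m + 2) * laguerre ?M x = (\<Sum>k\<le>?M. (-1) ^ k * ((real m + 2) * real (?M choose k)) / fact k * x ^ k)"
    unfolding laguerre_def sum_distrib_left by (intro sum.cong refl) simp
  also have "\<dots> = (\<Sum>k\<le>?M. (2 * real m + 3) * ((-1) ^ k * real (Suc m choose k) / fact k * x ^ k)
       + (-1) ^ k * (real k * real (Suc m choose (k - 1))) / fact k * x ^ k
       - (real m + 1) * ((-1) ^ k * real (m choose k) / fact k * x ^ k))"
    unfolding binomial_three_term by (intro sum.cong refl) (simp add: field_simps del: binomial_Suc_Suc)
  also have "\<dots> = (2 * real m + 3) * laguerre (Suc m) x - x * laguerre (Suc m) x - (real m + 1) * laguerre m x"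
    using laguerre_eq_sum[of "Suc m" ?M x] laguerre_eq_sum[of m ?M x]
    unfolding X sum.distrib sum_subtractf sum_distrib_left[symmetric]
    by (simp del: sum.atMost_Suc binomial_Suc_Suc)
  finally show ?thesis by (simp add: algebra_simps)
qed

text \<open>With \<open>y = 2 * x\<close> the threshold is the turning point
  \<open>x = 2n + 1\<close>. In the induction step \<open>y \<ge> 4n + 6\<close>, so the recurrence
  gives \<open>(n + 2) c \<ge> (2n + 3) b - (n + 1) a \<ge> (n + 2) b\<close> for three consecutive
  signed values; monotonicity in \<open>n\<close> has to be carried along with positivity.\<close>

lemma laguerre_alternating_mono:
  assumes "y \<ge> 4 * real n + 2"
  shows "0 < (-1) ^ n * laguerre n y \<and> (-1) ^ n * laguerre n y \<le> (-1) ^ Suc n * laguerre (Suc n) y"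
  using assms
proof (induction n)
  case 0
  thus ?case by (simp add: laguerre_1)
next
  case (Suc n)
  define a where "a = (-1) ^ n * laguerre n y"
  define b where "b = (-1) ^ Suc n * laguerre (Suc n) y"
  define c where "c = (-1) ^ Suc (Suc n) * laguerre (Suc (Suc n)) y"
  have ab: "0 < a" "a \<le> b" using Suc by (auto simp: a_def b_def)
  have "(real n + 2) * c = (y - 2 * real n - 3) * b - (real n + 1) * a"
    using arg_cong[OF laguerre_three_term[of n y], of "\<lambda>z. (-1) ^ n * z"]
    by (simp add: a_def b_def c_def algebra_simps)
  moreover have "(real n + 1) * a \<le> (real n + 1) * b" using ab by simp
  moreover have "(y - 2 * real n - 3) * b \<ge> (2 * real n + 3) * b" using ab Suc.prems by simp
  ultimately have "(real n + 2) * c \<ge> (real n + 2) * b" by (simp add: algebra_simps)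
  hence "c \<ge> b" by (simp add: mult_le_cancel_left)
  thus ?case using ab by (simp add: a_def b_def c_def del: power_Suc)
qed

lemma fock_radial_pos: "x \<ge> 2 * real n + 1 \<Longrightarrow> fock_radial n x > 0"
  using laguerre_alternating_mono[of n "2 * x"] by (simp add: fock_radial_def)

lemma fock_tail_antimono:
  assumes "2 * real n + 1 \<le> x" "x \<le> y"
  shows "fock_tail n y \<le> fock_tail n x"
  by (rule DERIV_nonpos_imp_nonincreasing[OF assms(2)])
     (use DERIV_fock_tail fock_radial_pos assms in \<open>force intro: less_imp_le\<close>)

lemma fock_radial_continuous: "continuous_on A (fock_radial n)"
  using fock_radial_differentiable
  by (intro continuous_at_imp_continuous_on) (blast intro: DERIV_isCont)

lemma has_integral_fock_radial:
  "a \<le> b \<Longrightarrow> (fock_radial n has_integral (fock_tail n a - fock_tail n b)) {a..b}"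
  using fundamental_theorem_of_calculus[of a b "\<lambda>x. - fock_tail n x" "fock_radial n"]
    DERIV_minus[OF DERIV_fock_tail]
  by (force simp: has_real_derivative_iff_has_vector_derivative[symmetric] intro: has_field_derivative_at_within)

subsection \<open>The generating function\<close>

text \<open>The series is \<open>X^k / (1 + X)^(k+1)\<close>, the part of the generating function
  that multiplies \<open>(2x)^k / k!\<close>. Multiplication by \<open>1 + X\<close> relates
  \<open>k + 1\<close> to \<open>k\<close> and gives Pascal's rule with alternating signs.\<close>

lemma fps_nth_Mobius_power:
  "fps_nth ((fps_X * inverse (1 + fps_X)) ^ k * inverse (1 + fps_X :: complex fps)) n =
     (if k \<le> n then (-1) ^ (n - k) * of_nat (n choose k) else 0)"
proof (induction k arbitrary: n)
  case 0
  have "(1 + fps_X) * Abs_fps (\<lambda>n. (-1 :: complex) ^ n) = 1"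
  proof (rule fps_ext)
    fix n show "fps_nth ((1 + fps_X) * Abs_fps (\<lambda>n. (-1 :: complex) ^ n)) n = fps_nth 1 n"
      by (cases n) (simp_all add: distrib_right fps_X_mult_nth)
  qed
  hence "inverse (1 + fps_X) = Abs_fps (\<lambda>n. (-1 :: complex) ^ n)"
    by (rule fps_inverse_unique)
  thus ?case by simp
next
  case (Suc k)
  define B where "B k = (fps_X * inverse (1 + fps_X)) ^ k * inverse (1 + fps_X :: complex fps)" for k
  have inv: "(1 + fps_X) * inverse (1 + fps_X :: complex fps) = 1"
    by (subst mult.commute, rule inverse_mult_eq_1) simp
  have "(1 + fps_X) * B (Suc k) = fps_X * B k * ((1 + fps_X) * inverse (1 + fps_X))"
    by (simp add: B_def mult_ac)
  hence rec: "(1 + fps_X) * B (Suc k) = fps_X * B k" by (simp add: inv)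
  have IH: "fps_nth (B k) n = (if k \<le> n then (-1) ^ (n - k) * of_nat (n choose k) else 0)" for n
    using Suc.IH by (simp add: B_def)
  have "fps_nth (B (Suc k)) n = (if Suc k \<le> n then (-1) ^ (n - Suc k) * of_nat (n choose Suc k) else 0)"
  proof (induction n)
    case 0
    from arg_cong[OF rec, of "\<lambda>f. fps_nth f 0"] show ?case by (simp add: distrib_right)
  next
    case (Suc n)
    have "fps_nth (B (Suc k)) (Suc n) + fps_nth (B (Suc k)) n = fps_nth (B k) n"
      using arg_cong[OF rec, of "\<lambda>f. fps_nth f (Suc n)"] by (simp add: distrib_right fps_X_mult_nth)
    hence *: "fps_nth (B (Suc k)) (Suc n) = fps_nth (B k) n - fps_nth (B (Suc k)) n"
      by (simp add: algebra_simps)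
    consider "n < k" | "n = k" | "k < n" by linarith
    thus ?case
    proof cases
      case 3
      then obtain d where "n = Suc k + d" using less_iff_Suc_add by auto
      thus ?thesis unfolding * Suc.IH IH by (simp add: Suc_diff_le algebra_simps)
    next
      case 2
      thus ?thesis using * Suc.IH IH by simp
    qed (simp_all add: * Suc.IH IH)
  qed
  thus ?case by (simp add: B_def)
qed

text \<open>The exponent equals \<open>- x + 2 * x * s / (1 + s)\<close>, so the exponential is
  expanded in powers of \<open>s / (1 + s)\<close>.\<close>

lemma fock_radial_generating:
  "(\<lambda>s. exp (- of_real x * (1 - s) / (1 + s)) / (1 + s)) has_fps_expansion
     Abs_fps (\<lambda>n. complex_of_real (fock_radial n x))"
proof -
  define c where "c = complex_of_real (2 * x)"
  define U where "U = inverse (1 + fps_X :: complex fps)"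
  have 1: "(\<lambda>s. s * inverse (1 + s)) has_fps_expansion fps_X * U"
    unfolding U_def by (intro fps_expansion_intros) auto
  have "((\<lambda>s. exp (c * s)) \<circ> (\<lambda>s. s * inverse (1 + s))) has_fps_expansion (fps_exp c oo (fps_X * U))"
    by (intro has_fps_expansion_compose 1 has_fps_expansion_exp) simp
  hence "(\<lambda>s. of_real (exp (- x)) * (((\<lambda>s. exp (c * s)) \<circ> (\<lambda>s. s * inverse (1 + s))) s * inverse (1 + s)))
      has_fps_expansion fps_const (of_real (exp (- x))) * ((fps_exp c oo (fps_X * U)) * U)"
    unfolding U_def by (intro fps_expansion_intros) auto
  also have "fps_const (of_real (exp (- x))) * ((fps_exp c oo (fps_X * U)) * U) =
     Abs_fps (\<lambda>n. complex_of_real (fock_radial n x))"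
  proof (rule fps_ext)
    fix n
    \<comment> \<open>The power \<open>(fps_X * U) ^ i\<close> starts at degree \<open>i\<close>, so
      the sums over \<open>i \<le> j\<close> may be extended to the common range
      \<open>i \<le> n\<close> and interchanged.\<close>
    have z: "fps_nth ((fps_X * U) ^ i) j = 0" if "j < i" for i j
      using that by (simp add: power_mult_distrib fps_X_power_mult_nth)
    have "fps_nth ((fps_exp c oo (fps_X * U)) * U) n =
        (\<Sum>j=0..n. (\<Sum>i=0..j. c ^ i / fact i * fps_nth ((fps_X * U) ^ i) j) * fps_nth U (n - j))"
      by (simp add: fps_mult_nth fps_compose_nth)
    also have "\<dots> = (\<Sum>j=0..n. (\<Sum>i=0..n. c ^ i / fact i * fps_nth ((fps_X * U) ^ i) j) * fps_nth U (n - j))"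
      by (intro sum.cong refl arg_cong2[where f="(*)"] sum.mono_neutral_left) (auto simp: z)
    also have "\<dots> = (\<Sum>i=0..n. c ^ i / fact i * (\<Sum>j=0..n. fps_nth ((fps_X * U) ^ i) j * fps_nth U (n - j)))"
      unfolding sum_distrib_left sum_distrib_right by (subst sum.swap) (simp add: mult_ac)
    also have "\<dots> = (\<Sum>i=0..n. c ^ i / fact i * fps_nth ((fps_X * U) ^ i * U) n)"
      by (simp add: fps_mult_nth)
    also have "\<dots> = (\<Sum>i=0..n. c ^ i / fact i * ((-1) ^ (n - i) * of_nat (n choose i)))"
      unfolding U_def fps_nth_Mobius_power by (intro sum.cong) auto
    also have "\<dots> = (\<Sum>i\<le>n. of_real ((-1) ^ n * ((-1) ^ i * real (n choose i) / fact i * (2 * x) ^ i)))"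
    proof (intro sum.cong)
      fix i assume "i \<in> {..n}"
      then obtain d where "n = i + d" by (auto simp: le_iff_add)
      thus "c ^ i / fact i * ((-1) ^ (n - i) * of_nat (n choose i)) =
        of_real ((-1) ^ n * ((-1) ^ i * real (n choose i) / fact i * (2 * x) ^ i))"
        by (simp add: c_def power_add power_mult_distrib mult_ac flip: power_mult_distrib[of "-1::complex" "-1"])
    qed auto
    also have "\<dots> = of_real ((-1) ^ n * laguerre n (2 * x))"
      by (simp add: laguerre_def sum_distrib_left)
    finally have L: "fps_nth ((fps_exp c oo (fps_X * U)) * U) n = of_real ((-1) ^ n * laguerre n (2 * x))" .
    show "fps_nth (fps_const (of_real (exp (- x))) * ((fps_exp c oo (fps_X * U)) * U)) n =
        fps_nth (Abs_fps (\<lambda>n. complex_of_real (fock_radial n x))) n"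
      unfolding fps_mult_left_const_nth L by (simp add: fock_radial_def)
  qed
  finally have *: "(\<lambda>s. of_real (exp (- x)) * (((\<lambda>s. exp (c * s)) \<circ> (\<lambda>s. s * inverse (1 + s))) s * inverse (1 + s)))
      has_fps_expansion Abs_fps (\<lambda>n. complex_of_real (fock_radial n x))" .
  \<comment> \<open>An expansion only concerns a neighbourhood of 0; the unit ball keeps away from
    the singularity at -1.\<close>
  have "eventually (\<lambda>s::complex. s \<in> ball 0 1) (nhds 0)"
    by (intro eventually_nhds_in_open) auto
  hence ev: "eventually (\<lambda>s. of_real (exp (- x)) * (((\<lambda>s. exp (c * s)) \<circ> (\<lambda>s. s * inverse (1 + s))) s * inverse (1 + s))
       = exp (- of_real x * (1 - s) / (1 + s)) / (1 + s)) (nhds 0)"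
  proof (rule eventually_mono)
    fix s :: complex assume "s \<in> ball 0 1"
    hence "1 + s \<noteq> 0" by (auto simp: add_eq_0_iff)
    hence eq: "- of_real x * (1 - s) / (1 + s) = - of_real x + c * (s * inverse (1 + s))"
      by (simp add: c_def field_simps)
    thus "of_real (exp (- x)) * (((\<lambda>s. exp (c * s)) \<circ> (\<lambda>s. s * inverse (1 + s))) s * inverse (1 + s))
       = exp (- of_real x * (1 - s) / (1 + s)) / (1 + s)"
      unfolding eq exp_add by (simp add: divide_inverse flip: exp_of_real)
  qed
  show ?thesis using * has_fps_expansion_cong[OF ev refl] by blast
qed

text \<open>\<open>fock_tail_Suc\<close> says \<open>(1 - X) T = F (1 + X)\<close> for the two
  coefficient series.\<close>

lemma fock_tail_generating:
  "(\<lambda>s. exp (- of_real x * (1 - s) / (1 + s)) / (1 - s)) has_fps_expansion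
     Abs_fps (\<lambda>n. complex_of_real (fock_tail n x))"
proof -
  let ?F = "Abs_fps (\<lambda>n. complex_of_real (fock_radial n x))"
  let ?T = "Abs_fps (\<lambda>n. complex_of_real (fock_tail n x))"
  have "(\<lambda>s. (exp (- of_real x * (1 - s) / (1 + s)) / (1 + s)) * ((1 + s) * inverse (1 - s)))
     has_fps_expansion ?F * ((1 + fps_X) * inverse (1 - fps_X))"
    by (intro fps_expansion_intros fock_radial_generating) auto
  also have "?F * ((1 + fps_X) * inverse (1 - fps_X)) = ?T"
  proof -
    have "(1 - fps_X) * ?T = ?F * (1 + fps_X)"
    proof (rule fps_ext)
      fix n
      show "fps_nth ((1 - fps_X) * ?T) n = fps_nth (?F * (1 + fps_X)) n"
        by (cases n) (simp_all add: left_diff_distrib distrib_left fps_X_mult_nth fock_tail_Suc fock_tail_def[of 0])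
    qed
    hence "?F * (1 + fps_X) * inverse (1 - fps_X) = ?T * ((1 - fps_X) * inverse (1 - fps_X))"
      by (simp add: mult_ac)
    moreover have "(1 - fps_X) * inverse (1 - fps_X :: complex fps) = 1"
      by (subst mult.commute, rule inverse_mult_eq_1) simp
    ultimately show ?thesis by (simp add: mult_ac)
  qed
  finally have *: "(\<lambda>s. (exp (- of_real x * (1 - s) / (1 + s)) / (1 + s)) * ((1 + s) * inverse (1 - s)))
     has_fps_expansion ?T" .
  have "eventually (\<lambda>s::complex. s \<in> ball 0 1) (nhds 0)"
    by (intro eventually_nhds_in_open) auto
  hence ev: "eventually (\<lambda>s :: complex. (exp (- of_real x * (1 - s) / (1 + s)) / (1 + s)) * ((1 + s) * inverse (1 - s))
       = exp (- of_real x * (1 - s) / (1 + s)) / (1 - s)) (nhds 0)"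
  proof (rule eventually_mono)
    fix s :: complex assume "s \<in> ball 0 1"
    hence "1 + s \<noteq> 0" by (auto simp: add_eq_0_iff)
    thus "(exp (- of_real x * (1 - s) / (1 + s)) / (1 + s)) * ((1 + s) * inverse (1 - s))
       = exp (- of_real x * (1 - s) / (1 + s)) / (1 - s)"
      by (simp add: divide_inverse)
  qed
  show ?thesis using * has_fps_expansion_cong[OF ev refl] by blast
qed

subsection \<open>A contour integral for the radial tail\<close>

text \<open>In the right half-plane the moduli of \<open>exp z\<close> and \<open>exp (- z)\<close>
  differ, so the two can neither agree nor cancel.\<close>

lemma sinh_cosh_nonzero:
  fixes z :: complex
  assumes "Re z > 0"
  shows "sinh z \<noteq> 0" "cosh z \<noteq> 0"
proof -
  have "norm (exp (- z)) < norm (exp z)" using assms by (simp add: norm_exp_eq_Re)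
  hence "exp z \<noteq> exp (- z)" "exp z \<noteq> - exp (- z)" by (metis less_irrefl, metis less_irrefl norm_minus_cancel)
  thus "sinh z \<noteq> 0" "cosh z \<noteq> 0"
    by (auto simp: sinh_field_def cosh_field_def eq_neg_iff_add_eq_0)
qed

text \<open>Cauchy's coefficient integrand under \<open>s = exp (-2 * z)\<close>: the quotient
  \<open>(1 - s) / (1 + s)\<close> becomes \<open>tanh z\<close>, and
  \<open>1 - s = 2 * sinh z * exp (- z)\<close> contributes the extra \<open>z\<close> that makes
  \<open>2 * n\<close> into \<open>2 * n + 1\<close>.\<close>

definition fock_kernel :: "nat \<Rightarrow> real \<Rightarrow> complex \<Rightarrow> complex" where
  "fock_kernel n x z = exp (of_nat (2 * n + 1) * z - of_real x * tanh z) / sinh z"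

lemma fock_kernel_eq:
  assumes "Re z > 0"
  shows "exp (- of_real x * (1 - exp (-2 * z)) / (1 + exp (-2 * z))) / (1 - exp (-2 * z)) / exp (-2 * z) ^ n
     = fock_kernel n x z / 2"
proof -
  note nz = sinh_cosh_nonzero[OF assms]
  have 1: "1 - exp (-2 * z) = 2 * sinh z * exp (- z)" "1 + exp (-2 * z) = 2 * cosh z * exp (- z)"
    by (simp_all add: sinh_field_def cosh_field_def algebra_simps flip: exp_add)
  have 2: "- of_real x * (1 - exp (-2 * z)) / (1 + exp (-2 * z)) = - (of_real x * tanh z)"
    unfolding 1 tanh_def using nz by (simp add: field_simps)
  have 3: "exp (-2 * z) ^ n = exp (- (2 * of_nat n * z))"
    by (simp add: mult_ac flip: exp_of_nat_mult)
  have "exp (of_nat (2 * n + 1) * z - of_real x * tanh z) =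
     exp (- (of_real x * tanh z)) * exp z * exp (2 * of_nat n * z)"
    by (simp add: algebra_simps flip: exp_add)
  thus ?thesis unfolding fock_kernel_def 2 3 unfolding 1 using nz
    by (simp add: field_simps exp_minus)
qed

text \<open>The circle of radius \<open>exp (-2 * d)\<close> becomes the segment
  \<open>Re z = d\<close> of height pi, parametrised by \<open>\<sigma> = Im z / d\<close>.\<close>

lemma fock_tail_contour:
  assumes d: "d > 0"
  shows "((\<lambda>\<sigma>. of_real d * fock_kernel n x (of_real d * Complex 1 \<sigma>)) has_integral
           2 * of_real pi * of_real (fock_tail n x)) {- (pi / (2 * d))..pi / (2 * d)}"
proof -
  define f where "f = (\<lambda>s. exp (- complex_of_real x * (1 - s) / (1 + s)) / (1 - s))"
  define r where "r = exp (- 2 * d)"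
  have r: "0 < r" "r < 1" using d by (auto simp: r_def)
  have nz: "1 + s \<noteq> 0" "1 - s \<noteq> 0" if "norm s \<le> r" for s :: complex
    using that r by (auto simp: add_eq_0_iff)
  \<comment> \<open>The reflection lets \<open>s\<close> start at \<open>- r\<close> while the
    circle starts at \<open>r\<close>. Then \<open>Im z\<close> runs from \<open>pi / 2\<close> to
    \<open>- pi / 2\<close>, and the point \<open>z = d\<close> nearest to the saddle sits in the
    middle of the segment.\<close>
  have "(f \<circ> (\<lambda>s. - s)) has_fps_expansion (Abs_fps (\<lambda>n. complex_of_real (fock_tail n x)) oo (- fps_X))"
    unfolding f_def by (intro has_fps_expansion_compose fock_tail_generating fps_expansion_intros) auto
  from fps_nth_fps_expansion[OF this, of n]
  have coeff: "(deriv ^^ n) (\<lambda>s. f (- s)) 0 / fact n = (-1) ^ n * of_real (fock_tail n x)"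
    by (simp add: fps_compose_uminus' o_def)
  have hol: "(\<lambda>s. f (- s)) holomorphic_on cball 0 r"
    unfolding f_def using nz nz[of "- _"]
    by (intro holomorphic_intros) (auto simp: norm_minus_commute)
  have "((\<lambda>u. f (- u) / (u - 0) ^ Suc n) has_contour_integral
      of_real (2 * pi) * \<i> / fact n * (deriv ^^ n) (\<lambda>s. f (- s)) 0) (circlepath 0 r)"
    using r hol by (intro Cauchy_has_contour_integral_higher_derivative_circlepath
       holomorphic_on_imp_continuous_on holomorphic_on_subset[OF hol]) auto
  also have "of_real (2 * pi) * \<i> / fact n * (deriv ^^ n) (\<lambda>s. f (- s)) 0 = 
     2 * of_real pi * \<i> * ((-1) ^ n * of_real (fock_tail n x))"
    unfolding coeff[symmetric] by simp
  finally have "((\<lambda>u. f (- circlepath 0 r u) / circlepath 0 r u ^ Suc n * 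
      vector_derivative (circlepath 0 r) (at u within {0..1})) has_integral
     2 * of_real pi * \<i> * ((-1) ^ n * of_real (fock_tail n x))) {0..1}"
    by (simp add: has_contour_integral_def)
  from has_integral_mult_right[OF this, of "(-1) ^ n / (2 * of_real pi * \<i>)"]
  have A: "((\<lambda>u. (-1) ^ n / (2 * of_real pi * \<i>) * (f (- circlepath 0 r u) / circlepath 0 r u ^ Suc n * 
      vector_derivative (circlepath 0 r) (at u within {0..1}))) has_integral of_real (fock_tail n x)) {0..1}"
    by (simp add: mult_ac flip: power_mult_distrib)
  have B: "(-1) ^ n / (2 * of_real pi * \<i>) * (f (- circlepath 0 r u) / circlepath 0 r u ^ Suc n * 
      vector_derivative (circlepath 0 r) (at u within {0..1})) =
      fock_kernel n x (Complex d (pi / 2 - pi * u)) / 2" if "u \<in> {0..1}" for u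
  proof -
    define z where "z = Complex d (pi / 2 - pi * u)"
    have "exp (- 2 * z) = exp (of_real (- 2 * d) + (2 * of_real pi * \<i> * of_real u - \<i> * of_real pi))"
      by (rule arg_cong[of _ _ exp]) (simp add: z_def complex_eq_iff algebra_simps)
    also have "\<dots> = of_real r * - exp (2 * of_real pi * \<i> * of_real u)"
      by (simp add: exp_add exp_diff exp_minus divide_inverse r_def flip: exp_of_real)
    finally have c: "circlepath 0 r u = - exp (- 2 * z)"
      by (simp add: circlepath)
    have v: "vector_derivative (circlepath 0 r) (at u within {0..1}) = 2 * of_real pi * \<i> * circlepath 0 r u"
      using that by (subst vector_derivative_circlepath01) (auto simp: circlepath mult_ac)
    have "(-1) ^ n / (2 * of_real pi * \<i>) * (f (- circlepath 0 r u) / circlepath 0 r u ^ Suc n * 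
      vector_derivative (circlepath 0 r) (at u within {0..1})) = 
        (-1) ^ n * f (exp (- 2 * z)) / (- exp (- 2 * z)) ^ n"
    proof -
      have "a / p * (F / w ^ Suc n * (p * w)) = a * F / w ^ n" if "p \<noteq> 0" "w \<noteq> 0" for a p F w :: complex
        using that by simp
      from this[of "2 * of_real pi * \<i>" "circlepath 0 r u"] show ?thesis
        unfolding v by (simp add: c)
    qed
    also have "(- exp (- 2 * z)) ^ n = (-1) ^ n * exp (- 2 * z) ^ n" by (rule power_minus)
    also have "(-1) ^ n * f (exp (- 2 * z)) / ((-1) ^ n * exp (- 2 * z) ^ n) = f (exp (- 2 * z)) / exp (- 2 * z) ^ n"
      by simp
    also have "\<dots> = fock_kernel n x z / 2"
      unfolding f_def by (rule fock_kernel_eq) (use d in \<open>simp add: z_def\<close>)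
    finally show ?thesis unfolding z_def .
  qed
  have "((\<lambda>u. fock_kernel n x (Complex d (pi / 2 - pi * u)) / 2) has_integral of_real (fock_tail n x)) (cbox 0 (1::real))"
    using A by (subst (asm) has_integral_cong[OF B]) auto
  \<comment> \<open>Substitution \<open>u = 1 / 2 - d * \<sigma> / pi\<close>, with Jacobian
    \<open>pi / d\<close>.\<close>
  note aff = has_integral_affinity[OF this, of "- d / pi" "1 / 2"]
  have img: "(\<lambda>\<sigma>. (1 / (- d / pi)) *\<^sub>R \<sigma> + - ((1 / (- d / pi)) *\<^sub>R (1 / 2))) ` cbox 0 (1::real)
      = {- (pi / (2 * d))..pi / (2 * d)}"
  proof -
    have "(\<lambda>\<sigma>. (1 / (- d / pi)) *\<^sub>R \<sigma> + - ((1 / (- d / pi)) *\<^sub>R (1 / 2))) = (\<lambda>\<sigma>. - (pi / d) * \<sigma> + pi / (2 * d))"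
      by (rule ext) simp
    moreover have "(\<lambda>\<sigma>. - (pi / d) * \<sigma> + pi / (2 * d)) ` {0..1} = {- (pi / d) * 1 + pi / (2 * d)..- (pi / d) * 0 + pi / (2 * d)}"
      using d pi_gt_zero by (subst image_affinity_atLeastAtMost) (auto simp: divide_le_0_iff simp del: pi_gt_zero)
    ultimately show ?thesis using d by (simp add: field_simps)
  qed
  have fn: "Complex d (pi / 2 - pi * ((- d / pi) *\<^sub>R \<sigma> + 1 / 2)) = of_real d * Complex 1 \<sigma>" for \<sigma>
    by (simp add: complex_eq_iff field_simps)
  have sc: "1 / \<bar>- d / pi\<bar> ^ DIM(real) = pi / d" using d by simp
  have "((\<lambda>\<sigma>. fock_kernel n x (of_real d * Complex 1 \<sigma>) / 2) has_integral
      (pi / d) *\<^sub>R of_real (fock_tail n x)) {- (pi / (2 * d))..pi / (2 * d)}"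
    using aff d unfolding img fn sc by simp
  from has_integral_mult_right[OF this, of "2 * of_real d"] show ?thesis
    using d by (simp add: scaleR_conv_of_real mult_ac)
qed

subsection \<open>Comparison of the Fock and Airy kernels\<close>

lemma sinh_real_ge: "(x::real) \<ge> 0 \<Longrightarrow> x \<le> sinh x"
proof -
  assume x: "x \<ge> 0"
  have "(\<lambda>x. sinh x - x) 0 \<le> (\<lambda>x. sinh x - x) x"
    by (rule DERIV_nonneg_imp_nondecreasing[OF x])
       (auto intro!: exI derivative_eq_intros simp: cosh_real_ge_1)
  thus ?thesis by simp
qed

text \<open>\<open>tanh x - x + x ^ 3 / 3\<close> has derivative
  \<open>x\<^sup>2 - (tanh x)\<^sup>2\<close>, which is nonnegative by the first bound.\<close>

lemma tanh_real_bounds_cubic: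
  fixes x :: real
  assumes "x \<ge> 0"
  shows "tanh x \<le> x" "x - x ^ 3 / 3 \<le> tanh x"
proof -
  have D: "(tanh has_real_derivative 1 - tanh y ^ 2) (at y)" for y :: real
    by (auto intro!: derivative_eq_intros)
  have le: "tanh y \<le> y" if "y \<ge> 0" for y :: real
  proof -
    have "(\<lambda>x. x - tanh x) 0 \<le> (\<lambda>x. x - tanh x) y"
      by (rule DERIV_nonneg_imp_nondecreasing[OF that])
         (use D in \<open>auto intro!: exI derivative_eq_intros\<close>)
    thus ?thesis by simp
  qed
  show "tanh x \<le> x" using le assms .
  have "(\<lambda>x. tanh x - x + x ^ 3 / 3) 0 \<le> (\<lambda>x. tanh x - x + x ^ 3 / 3) x"
  proof (rule DERIV_nonneg_imp_nondecreasing[OF assms])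
    fix y :: real assume y: "0 \<le> y" "y \<le> x"
    have "((\<lambda>x. tanh x - x + x ^ 3 / 3) has_real_derivative (y ^ 2 - tanh y ^ 2)) (at y)"
      by (auto intro!: derivative_eq_intros)
    moreover have "tanh y ^ 2 \<le> y ^ 2" using le[OF y(1)] y by (intro power_mono) auto
    ultimately show "\<exists>D. ((\<lambda>x. tanh x - x + x ^ 3 / 3) has_real_derivative D) (at y) \<and> 0 \<le> D" by auto
  qed
  thus "x - x ^ 3 / 3 \<le> tanh x" by simp
qed

text \<open>Provides quadratic growth of \<open>Re (tanh z)\<close> along the whole segment up to
  \<open>Im z = pi / 2\<close>. For \<open>0 \<le> y \<le> 1.6\<close> one has
  \<open>y\<^sup>2 \<le> 3\<close>, and then \<open>y - y ^ 3 / 6\<close> is at least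
  \<open>y / 2\<close>.\<close>

lemma sin_squared_ge:
  fixes x :: real
  assumes "\<bar>x\<bar> \<le> pi / 2"
  shows "x\<^sup>2 / 4 \<le> (sin x)\<^sup>2"
proof -
  have *: "y / 2 \<le> sin y" if "0 \<le> y" "y \<le> pi / 2" for y :: real
  proof (rule ccontr)
    assume n: "\<not> y / 2 \<le> sin y"
    have "y \<le> 2" using that pi_less_4 by linarith
    have "(\<lambda>x. sin x - x + x ^ 3 / 6) 0 \<le> (\<lambda>x. sin x - x + x ^ 3 / 6) y"
    proof (rule DERIV_nonneg_imp_nondecreasing[OF that(1)])
      fix u :: real
      have "((\<lambda>x. sin x - x + x ^ 3 / 6) has_real_derivative (cos u - 1 + u\<^sup>2 / 2)) (at u)"
        by (auto intro!: derivative_eq_intros)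
      moreover have "cos u \<ge> 1 - u\<^sup>2 / 2"
      proof -
        have "\<bar>sin (u / 2)\<bar> \<le> \<bar>u / 2\<bar>" by (rule abs_sin_x_le_abs_x)
        hence "(sin (u / 2))\<^sup>2 \<le> (u / 2)\<^sup>2" by (rule abs_le_square_iff[THEN iffD1])
        moreover have "cos u = 1 - 2 * (sin (u / 2))\<^sup>2" using cos_double_sin[of "u / 2"] by simp
        ultimately show ?thesis by (simp add: power_divide)
      qed
      ultimately show "\<exists>D. ((\<lambda>x. sin x - x + x ^ 3 / 6) has_real_derivative D) (at u) \<and> 0 \<le> D" by auto
    qed
    hence "y - y ^ 3 / 6 \<le> sin y" by simp
    moreover have "y ^ 3 / 6 \<le> y / 2"
    proof -
      have "pi \<le> 32 / 10" using pi_approx by simp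
      hence "y \<le> 16 / 10" using that by simp
      hence "y\<^sup>2 \<le> (16 / 10)\<^sup>2" using that by (intro power_mono) auto
      hence "y\<^sup>2 \<le> 3" by (simp add: power2_eq_square)
      hence "y * y\<^sup>2 \<le> y * 3" using that by (intro mult_left_mono) auto
      thus ?thesis by (simp add: power3_eq_cube power2_eq_square)
    qed
    ultimately show False using n by simp
  qed
  have "\<bar>x\<bar> / 2 \<le> sin \<bar>x\<bar>" using * assms by simp
  hence "(\<bar>x\<bar> / 2)\<^sup>2 \<le> (sin \<bar>x\<bar>)\<^sup>2" by (intro power_mono) auto
  also have "(sin \<bar>x\<bar>)\<^sup>2 = (sin x)\<^sup>2" by (simp add: abs_if)
  finally show ?thesis by (simp add: power_divide)
qed

lemma sinh_cosh_Complex: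
  "sinh (Complex a b) = Complex (sinh a * cos b) (cosh a * sin b)"
  "cosh (Complex a b) = Complex (cosh a * cos b) (sinh a * sin b)"
  by (simp_all add: complex_eq_iff sinh_field_def cosh_field_def Re_exp Im_exp algebra_simps diff_divide_distrib add_divide_distrib)

text \<open>Since \<open>cosh a\<close> dominates \<open>sinh a\<close>, the modulus is at least
  \<open>sinh a\<close> whatever the imaginary part. This keeps \<open>d / norm (sinh z)\<close> at
  most 1 on the line \<open>Re z = d\<close>.\<close>

lemma norm_sinh_ge:
  assumes "Re z > 0"
  shows "Re z \<le> norm (sinh z)"
proof -
  obtain a b where z: "z = Complex a b" by (cases z)
  have a: "a > 0" using assms z by simp
  have "a\<^sup>2 \<le> (sinh a)\<^sup>2" using a sinh_real_ge[of a] by (intro power_mono) auto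
  also have "\<dots> = (sinh a)\<^sup>2 * ((cos b)\<^sup>2 + (sin b)\<^sup>2)" by simp
  also have "\<dots> \<le> (sinh a * cos b)\<^sup>2 + (cosh a * sin b)\<^sup>2"
  proof -
    have "(sinh a)\<^sup>2 * (sin b)\<^sup>2 \<le> (cosh a)\<^sup>2 * (sin b)\<^sup>2"
      by (intro mult_right_mono) (simp_all add: cosh_square_eq)
    thus ?thesis unfolding power_mult_distrib distrib_left by linarith
  qed
  also have "\<dots> = (norm (sinh z))\<^sup>2"
    by (simp add: z sinh_cosh_Complex cmod_power2)
  finally have "a \<le> norm (sinh z)" by (rule power2_le_imp_le) simp
  thus ?thesis by (simp add: z)
qed

text \<open>The real part is \<open>sinh a * cosh a / ((cosh a)\<^sup>2 - (sin b)\<^sup>2)\<close>,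
  and \<open>1 / (1 - q) \<ge> 1 + q\<close> for
  \<open>q = (sin b)\<^sup>2 / (cosh a)\<^sup>2\<close>. The excess \<open>q\<close> produces the
  Gaussian decay of the Fock kernel.\<close>

lemma Re_tanh_ge:
  assumes "a > 0"
  shows "tanh a * (1 + (sin b)\<^sup>2 / (cosh a)\<^sup>2) \<le> Re (tanh (Complex a b))"
proof -
  define D where "D = (cosh a)\<^sup>2 - (sin b)\<^sup>2"
  have sb: "(sin b)\<^sup>2 \<le> 1" by (simp add: abs_square_le_1)
  have "sinh a > 0" using assms by simp
  hence "(cosh a)\<^sup>2 > 1" by (simp add: cosh_square_eq)
  hence D: "D > 0" using sb by (simp add: D_def)
  have D_eq: "(cosh a * cos b)\<^sup>2 + (sinh a * sin b)\<^sup>2 = D"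
    by (simp add: D_def power_mult_distrib sinh_square_eq cos_squared_eq algebra_simps)
  have "Re (tanh (Complex a b)) = (sinh a * cos b * (cosh a * cos b) + cosh a * sin b * (sinh a * sin b)) / D"
    unfolding tanh_def sinh_cosh_Complex Re_divide by (simp add: D_eq)
  also have "sinh a * cos b * (cosh a * cos b) + cosh a * sin b * (sinh a * sin b) =
      sinh a * cosh a * ((cos b)\<^sup>2 + (sin b)\<^sup>2)"
    by (simp add: power2_eq_square algebra_simps del: sin_cos_squared_add sin_cos_squared_add2 sin_cos_squared_add3)
  finally have eq: "Re (tanh (Complex a b)) = sinh a * cosh a / D" by simp
  have "(cosh a)\<^sup>2 * (cosh a)\<^sup>2 \<ge> ((cosh a)\<^sup>2 + (sin b)\<^sup>2) * D"
    by (simp add: D_def algebra_simps)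
  hence "((cosh a)\<^sup>2 + (sin b)\<^sup>2) / (cosh a)\<^sup>2 \<le> (cosh a)\<^sup>2 / D"
    using D by (simp add: divide_simps)
  hence "tanh a * (((cosh a)\<^sup>2 + (sin b)\<^sup>2) / (cosh a)\<^sup>2) \<le> tanh a * ((cosh a)\<^sup>2 / D)"
    using assms by (intro mult_left_mono) auto
  moreover have "tanh a * ((cosh a)\<^sup>2 / D) = sinh a * cosh a / D"
    using cosh_real_pos[of a] by (simp add: tanh_def power2_eq_square)
  moreover have "((cosh a)\<^sup>2 + (sin b)\<^sup>2) / (cosh a)\<^sup>2 = 1 + (sin b)\<^sup>2 / (cosh a)\<^sup>2"
    by (simp add: add_divide_distrib)
  ultimately show ?thesis unfolding eq by metis
qed

text \<open>The remainders are half the difference or sum of the exponential remainders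
  \<open>R n z\<close> and \<open>R n (- z)\<close>, in which the terms of the wrong parity cancel;
  the numerical factors come from \<open>exp 1 \<le> 3\<close>.\<close>

lemma sinh_cosh_Taylor:
  fixes z :: complex
  assumes "norm z \<le> 1"
  shows "norm (sinh z - z) \<le> 2 * norm z ^ 3"
    and "norm (sinh z - z - z ^ 3 / 6) \<le> norm z ^ 5 / 8"
    and "norm (cosh z - 1 - z ^ 2 / 2) \<le> norm z ^ 4 / 2"
    and "norm (cosh z - 1 - z ^ 2 / 2) \<le> 3 / 2 * norm z ^ 3"
proof -
  define R where "R n z = exp z - (\<Sum>i\<le>n. z ^ i / fact i)" for n and z :: complex
  have R: "norm (R n w) \<le> 3 * norm z ^ Suc n / fact n" if "norm w = norm z" for n w
  proof -
    have "exp (norm w) \<le> exp 1" using assms that by simp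
    also have "\<dots> \<le> (3::real)" by (rule exp_le)
    finally have "exp (norm w) * norm w ^ Suc n / fact n \<le> 3 * norm w ^ Suc n / fact n"
      by (intro divide_right_mono mult_right_mono) auto
    thus ?thesis using Taylor_exp_field[of w n] that by (simp add: R_def)
  qed
  have dm: "norm ((R n z - R n (- z)) / 2) \<le> 3 * norm z ^ Suc n / fact n"
    and pm: "norm ((R n z + R n (- z)) / 2) \<le> 3 * norm z ^ Suc n / fact n" for n
    using norm_triangle_ineq4[of "R n z" "R n (- z)"] norm_triangle_ineq[of "R n z" "R n (- z)"]
      R[of z n] R[of "- z" n] by (simp_all add: norm_divide)
  have e1: "sinh z - z = (R 2 z - R 2 (- z)) / 2"
    and e2: "sinh z - z - z ^ 3 / 6 = (R 4 z - R 4 (- z)) / 2"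
    and e3: "cosh z - 1 - z ^ 2 / 2 = (R 3 z + R 3 (- z)) / 2"
    and e4: "cosh z - 1 - z ^ 2 / 2 = (R 2 z + R 2 (- z)) / 2"
    by (simp_all add: R_def sinh_field_def cosh_field_def atMost_nat_numeral fact_numeral diff_divide_distrib add_divide_distrib)
  have p: "Suc 2 = 3" "Suc 3 = 4" "Suc 4 = 5" by simp_all
  have f: "fact 2 = (2::real)" "fact 3 = (6::real)" "fact 4 = (24::real)" by (simp_all add: fact_numeral)
  show "norm (sinh z - z) \<le> 2 * norm z ^ 3"
    using dm[of 2] zero_le_power[OF norm_ge_zero[of z], of 3] unfolding e1 p f by linarith
  show "norm (sinh z - z - z ^ 3 / 6) \<le> norm z ^ 5 / 8"
    using dm[of 4] unfolding e2 p f by simp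
  show "norm (cosh z - 1 - z ^ 2 / 2) \<le> norm z ^ 4 / 2"
    using pm[of 3] unfolding e3 p f by simp
  show "norm (cosh z - 1 - z ^ 2 / 2) \<le> 3 / 2 * norm z ^ 3"
    using pm[of 2] unfolding e4 p f by simp
qed

text \<open>Multiplication by \<open>cosh z\<close>, which has modulus at least \<open>1 / 2\<close>
  on this disc, reduces the claim to the remainders of \<open>sinh\<close> and
  \<open>cosh\<close>.\<close>

lemma tanh_Taylor:
  fixes z :: complex
  assumes "norm z \<le> 1 / 2"
  shows "norm (tanh z - z + z ^ 3 / 3) \<le> 2 * norm z ^ 5" "norm (tanh z - z) \<le> norm z ^ 3"
proof -
  define r where "r = norm z"
  have r: "0 \<le> r" "r \<le> 1 / 2" using assms by (auto simp: r_def)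
  have z1: "norm z \<le> 1" using r by (simp add: r_def)
  note T = sinh_cosh_Taylor[OF z1, folded r_def]
  define C4 where "C4 = cosh z - 1 - z ^ 2 / 2"
  define S5 where "S5 = sinh z - z - z ^ 3 / 6"
  have r3: "r ^ 3 \<le> (1 / 2) ^ 3" and r2: "r ^ 2 \<le> (1 / 2) ^ 2" using r by (auto intro!: power_mono)
  have "norm (z ^ 2 / 2) + norm C4 \<le> 1 / 2"
    using T(4) r2 r3 by (simp add: C4_def norm_divide norm_power r_def[symmetric] power_divide)
  moreover have "norm (cosh z) \<ge> 1 - (norm (z ^ 2 / 2) + norm C4)"
  proof -
    have "cosh z = 1 - (- (z ^ 2 / 2) - C4)" by (simp add: C4_def)
    hence "norm (cosh z) \<ge> norm (1::complex) - norm (- (z ^ 2 / 2) - C4)" by (metis norm_triangle_ineq2)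
    thus ?thesis using norm_triangle_ineq4[of "- (z ^ 2 / 2)" C4] by simp
  qed
  ultimately have c: "norm (cosh z) \<ge> 1 / 2" by linarith
  hence c0: "cosh z \<noteq> 0" by auto
  \<comment> \<open>The terms of degree up to 3 cancel; \<open>z ^ 5 / 6\<close> is left over from
    \<open>(z ^ 3 / 3) * (z ^ 2 / 2)\<close>.\<close>
  have num: "S + (- z + z ^ 3 / 3) * K =
     (S - z - z ^ 3 / 6) - z * (K - 1 - z ^ 2 / 2) + z ^ 5 / 6 + z ^ 3 * (K - 1 - z ^ 2 / 2) / 3" for S K :: complex
  proof -
    have "S + (- z + (z * w) / 3) * K = (S - z - (z * w) / 6) - z * (K - 1 - w / 2) + (z * w) * w / 6
       + (z * w) * (K - 1 - w / 2) / 3" for w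
      by (simp add: field_simps)
    from this[of "z ^ 2"] show ?thesis
      by (simp add: power2_eq_square power3_eq_cube eval_nat_numeral mult.assoc)
  qed
  have "tanh z - z + z ^ 3 / 3 = (sinh z + (- z + z ^ 3 / 3) * cosh z) / cosh z"
    unfolding tanh_def using c0 by (simp add: field_simps)
  also have "\<dots> = (S5 - z * C4 + z ^ 5 / 6 + z ^ 3 * C4 / 3) / cosh z"
    unfolding num S5_def C4_def ..
  finally have quot: "norm (tanh z - z + z ^ 3 / 3) = norm (S5 - z * C4 + z ^ 5 / 6 + z ^ 3 * C4 / 3) / norm (cosh z)"
    by (simp add: norm_divide)
  have "norm (S5 - z * C4 + z ^ 5 / 6 + z ^ 3 * C4 / 3) \<le>
      norm S5 + norm (z * C4) + norm (z ^ 5 / 6) + norm (z ^ 3 * C4 / 3)"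
    by (intro norm_triangle_le norm_triangle_le_diff add_mono order_refl)
  also have "\<dots> = norm S5 + r * norm C4 + r ^ 5 / 6 + r ^ 3 * norm C4 / 3"
    by (simp add: norm_mult norm_divide norm_power r_def)
  also have "\<dots> \<le> r ^ 5 / 8 + r * (r ^ 4 / 2) + r ^ 5 / 6 + 1 * (r * (r ^ 4 / 2)) / 3"
  proof (intro add_mono mult_left_mono divide_right_mono order_refl)
    have "r ^ 3 * norm C4 = r ^ 2 * (r * norm C4)" by (simp add: numeral_eq_Suc)
    also have "\<dots> \<le> 1 * (r * (r ^ 4 / 2))"
      using r T(3) power_le_one[of r 2] by (intro mult_mono) (auto simp: C4_def)
    finally show "r ^ 3 * norm C4 \<le> 1 * (r * (r ^ 4 / 2))" .
  qed (use T r in \<open>auto simp: S5_def C4_def\<close>)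
  also have "\<dots> = 23 / 24 * r ^ 5" by (simp add: numeral_eq_Suc)
  finally have "norm (S5 - z * C4 + z ^ 5 / 6 + z ^ 3 * C4 / 3) / norm (cosh z) \<le> (23 / 24 * r ^ 5) / (1 / 2)"
    using c r by (intro frac_le) auto
  also have "\<dots> = 23 / 12 * r ^ 5" by simp
  finally have "norm (S5 - z * C4 + z ^ 5 / 6 + z ^ 3 * C4 / 3) / norm (cosh z) \<le> 23 / 12 * r ^ 5" .
  hence main: "norm (tanh z - z + z ^ 3 / 3) \<le> 2 * r ^ 5"
    unfolding quot using zero_le_power[OF r(1), of 5] by linarith
  thus "norm (tanh z - z + z ^ 3 / 3) \<le> 2 * norm z ^ 5" by (simp add: r_def)
  have "norm (tanh z - z) \<le> norm (tanh z - z + z ^ 3 / 3) + norm (z ^ 3 / 3)"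
    using norm_triangle_ineq4[of "tanh z - z + z ^ 3 / 3" "z ^ 3 / 3"] by simp
  also have "\<dots> \<le> 2 * (r ^ 2 * r ^ 3) + r ^ 3 / 3"
    using main by (simp add: norm_divide norm_power r_def flip: power_add)
  also have "r ^ 2 * r ^ 3 \<le> (1 / 2)\<^sup>2 * r ^ 3" using r2 r by (intro mult_right_mono) auto
  also have "2 * ((1 / 2)\<^sup>2 * r ^ 3) + r ^ 3 / 3 \<le> r ^ 3" using r by (simp add: power2_eq_square)
  finally show "norm (tanh z - z) \<le> norm z ^ 3" by (simp add: r_def)
qed

text \<open>Mean value bound on a convex half-plane, where the derivative of \<open>exp\<close> is
  bounded by \<open>exp c\<close>.\<close>

lemma norm_exp_diff_le:
  fixes w z :: complex
  assumes "Re w \<le> c" "Re z \<le> c"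
  shows "norm (exp w - exp z) \<le> exp c * norm (w - z)"
  by (rule field_differentiable_bound[OF convex_halfspace_Re_le[of c], of exp exp])
     (use assms in \<open>auto intro: has_field_derivative_at_within[OF DERIV_exp]\<close>)

section \<open>Pointwise comparison of the rescaled kernels\<close>

definition airy_kernel :: "real \<Rightarrow> real \<Rightarrow> complex" where
  "airy_kernel t \<sigma> = exp (Complex 1 \<sigma> ^ 3 / 3 - of_real t * Complex 1 \<sigma>)"

lemma norm_airy_kernel: "norm (airy_kernel t \<sigma>) = exp (1 / 3 - \<sigma>\<^sup>2 - t)"
proof -
  have "Complex 1 \<sigma> ^ 3 = Complex (1 - 3 * \<sigma>\<^sup>2) (3 * \<sigma> - \<sigma> ^ 3)"
    by (simp add: complex_eq_iff power3_eq_cube power2_eq_square algebra_simps)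
  thus ?thesis by (simp add: airy_kernel_def norm_exp_eq_Re diff_divide_distrib)
qed

lemma norm_Complex_1: "(norm (Complex 1 \<sigma>))\<^sup>2 = 1 + \<sigma>\<^sup>2" "1 \<le> norm (Complex 1 \<sigma>)"
proof -
  show "(norm (Complex 1 \<sigma>))\<^sup>2 = 1 + \<sigma>\<^sup>2" by (simp add: cmod_power2)
  hence "1\<^sup>2 \<le> (norm (Complex 1 \<sigma>))\<^sup>2" by simp
  thus "1 \<le> norm (Complex 1 \<sigma>)" by (rule power2_le_imp_le) simp
qed

lemma Complex_1_nonzero [simp]: "Complex 1 \<sigma> \<noteq> 0"
  by (simp add: complex_eq_iff)

lemma exp_ge_fourth_power: "0 \<le> y \<Longrightarrow> (y / 4) ^ 4 \<le> exp (y::real)"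
proof -
  assume y: "0 \<le> y"
  have "y / 4 \<le> exp (y / 4)" using exp_ge_add_one_self[of "y / 4"] by linarith
  hence "(y / 4) ^ 4 \<le> exp (y / 4) ^ 4" using y by (intro power_mono) auto
  also have "\<dots> = exp y" by (simp flip: exp_of_nat_mult)
  finally show ?thesis .
qed

text \<open>Supplies the integrable majorant of all later estimates. With
  \<open>w = 1 + \<sigma>\<^sup>2\<close> and \<open>192 = 4 * 48\<close>,
  \<open>exp (w / 48)\<close> dominates \<open>(w / 192) ^ 4\<close>; the 3 absorbs
  \<open>exp (1 / 48)\<close>.\<close>

lemma gaussian_moment_bound:
  "(1 + \<sigma>\<^sup>2) ^ 3 * exp (- \<sigma>\<^sup>2 / 48) \<le> 3 * 192 ^ 4 / (1 + (\<sigma>::real)\<^sup>2)"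
proof -
  define w where "w = 1 + \<sigma>\<^sup>2"
  have w: "w \<ge> 1" by (simp add: w_def)
  have "(w / 192) ^ 4 \<le> exp (w / 48)" using exp_ge_fourth_power[of "w / 48"] w by simp
  hence "w ^ 4 * exp (- w / 48) \<le> 192 ^ 4"
    by (simp add: exp_minus power_divide divide_simps)
  hence "w ^ 4 * exp (- w / 48) * exp (1 / 48) \<le> 192 ^ 4 * 3"
  proof (rule mult_mono)
    have "exp (1 / 48) \<le> exp (1::real)" by simp
    thus "exp (1 / 48) \<le> (3::real)" using exp_le by linarith
  qed auto
  also have "w ^ 4 * exp (- w / 48) * exp (1 / 48) = w * (w ^ 3 * exp (- \<sigma>\<^sup>2 / 48))"
  proof -
    have "exp (- w / 48) * exp (1 / 48) = exp (- \<sigma>\<^sup>2 / 48)"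
      by (simp add: w_def field_simps flip: exp_add)
    thus ?thesis by (simp add: eval_nat_numeral mult.assoc)
  qed
  finally show ?thesis using w unfolding w_def[symmetric] by (simp add: field_simps)
qed

context
  fixes n :: nat and d t M x :: real
  assumes d: "0 < d" "d \<le> 1" and Nd: "real (2 * n + 1) * d ^ 3 = 1"
    and t: "\<bar>t\<bar> \<le> M" and Md: "2 * M * d\<^sup>2 \<le> 1"
    and x: "x = real (2 * n + 1) + t / d"
begin

text \<open>The condition \<open>2 * M * d\<^sup>2 \<le> 1\<close> ensures
  \<open>x \<ge> N / 2\<close>. The term \<open>1 / 3\<close> bounds \<open>N (d - tanh d)\<close>,
  and \<open>M\<close> bounds the shift by \<open>t\<close>. The decay is \<open>(N / 2) * (2 d / 3)
  * (d \<sigma>)\<^sup>2 / 16 = \<sigma>\<^sup>2 / 48\<close>, where 16 combines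
  \<open>sin_squared_ge\<close> with \<open>cosh d \<le> 2\<close>.\<close>

lemma fock_exponent_bound:
  assumes "d * \<bar>\<sigma>\<bar> \<le> pi / 2"
  shows "Re (of_nat (2 * n + 1) * (of_real d * Complex 1 \<sigma>) - of_real x * tanh (of_real d * Complex 1 \<sigma>))
     \<le> 1 / 3 + M - \<sigma>\<^sup>2 / 48"
proof -
  define N where "N = real (2 * n + 1)"
  have N: "N > 0" by (simp add: N_def)
  define S where "S = (sin (d * \<sigma>))\<^sup>2 / (cosh d)\<^sup>2"
  have z: "of_real d * Complex 1 \<sigma> = Complex d (d * \<sigma>)" by (simp add: complex_eq_iff)
  have Re_eq: "Re (of_nat (2 * n + 1) * (of_real d * Complex 1 \<sigma>) - of_real x * tanh (of_real d * Complex 1 \<sigma>))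
     = N * d - x * Re (tanh (Complex d (d * \<sigma>)))"
    unfolding z by (simp add: N_def)
  have M0: "M \<ge> 0" using t by linarith
  have "\<bar>t / d\<bar> \<le> M / d" using t d by (simp add: divide_right_mono)
  also have "M / d = M * d\<^sup>2 * N" using Nd d unfolding N_def[symmetric]
    by (simp add: field_simps power2_eq_square power3_eq_cube)
  also have "\<dots> \<le> N / 2" using mult_right_mono[OF Md, of N] N by simp
  finally have xN: "x \<ge> N / 2" unfolding x N_def[symmetric] by linarith
  have T: "tanh d \<le> d" "d - d ^ 3 / 3 \<le> tanh d" using tanh_real_bounds_cubic[of d] d by auto
  have T0: "tanh d > 0" using d by simp
  have "d ^ 3 \<le> d" using d power_decreasing[of 1 3 d] by simp
  hence T23: "2 / 3 * d \<le> tanh d" using T by linarith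
  have "exp d \<le> exp 1" "exp (- d) \<le> 1" using d by auto
  hence "exp d + exp (- d) \<le> 4" using exp_le by linarith
  hence "cosh d \<le> 2" unfolding cosh_field_def by simp
  hence c: "(cosh d)\<^sup>2 \<le> 4" using power_mono[of "cosh d" 2 2] by simp
  have cp: "(cosh d)\<^sup>2 > 0" using cosh_real_pos[of d] by simp
  have "(d * \<sigma>)\<^sup>2 / 4 \<le> (sin (d * \<sigma>))\<^sup>2"
    using assms d by (intro sin_squared_ge) (simp add: abs_mult)
  hence S: "(d * \<sigma>)\<^sup>2 / 4 / 4 \<le> S"
    unfolding S_def using c cp by (intro frac_le) auto
  have S0: "0 \<le> S" by (simp add: S_def)
  have "x * (tanh d * (1 + S)) \<le> x * Re (tanh (Complex d (d * \<sigma>)))"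
    using Re_tanh_ge[OF d(1), of "d * \<sigma>"] xN N unfolding S_def by (intro mult_left_mono) auto
  moreover have "x * (tanh d * (1 + S)) = N * tanh d + t / d * tanh d + x * tanh d * S"
    unfolding x N_def[symmetric] by (simp add: algebra_simps)
  moreover have "N * tanh d \<ge> N * d - 1 / 3"
  proof -
    have "N * (d - d ^ 3 / 3) \<le> N * tanh d" using T N by (intro mult_left_mono) auto
    thus ?thesis using Nd unfolding N_def[symmetric] by (simp add: algebra_simps)
  qed
  moreover have "t / d * tanh d \<ge> - M"
  proof -
    have "\<bar>t / d * tanh d\<bar> = \<bar>t\<bar> * (tanh d / d)" using T0 d by (simp add: abs_mult)
    also have "\<dots> \<le> M * 1" using t T d T0 M0 by (intro mult_mono) auto
    finally have "\<bar>t / d * tanh d\<bar> \<le> M" by (simp only: mult_1_right)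
    thus ?thesis by (simp only: abs_le_iff minus_le_iff)
  qed
  moreover have "x * tanh d * S \<ge> N / 2 * (2 / 3 * d) * ((d * \<sigma>)\<^sup>2 / 4 / 4)"
    using xN T23 S N d S0 by (intro mult_mono) auto
  moreover have "N / 2 * (2 / 3 * d) * ((d * \<sigma>)\<^sup>2 / 4 / 4) = (N * d ^ 3) * \<sigma>\<^sup>2 / 48"
    by (simp add: power2_eq_square power3_eq_cube)
  ultimately show ?thesis unfolding Re_eq using Nd unfolding N_def[symmetric] by simp
qed

lemma airy_exponent_le: "1 / 3 - \<sigma>\<^sup>2 - t \<le> 1 / 3 + M - \<sigma>\<^sup>2 / 48"
proof -
  have "0 \<le> \<sigma>\<^sup>2" by simp
  moreover have "- t \<le> M" using t by linarith
  ultimately show ?thesis by linarith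
qed

lemma airy_kernel_quotient_bound: "norm (airy_kernel t \<sigma> / Complex 1 \<sigma>) \<le> exp (1 / 3 + M - \<sigma>\<^sup>2 / 48)"
proof -
  have "norm (airy_kernel t \<sigma> / Complex 1 \<sigma>) \<le> norm (airy_kernel t \<sigma>) / 1"
    unfolding norm_divide using norm_Complex_1(2)[of \<sigma>] by (intro divide_left_mono) auto
  also have "\<dots> \<le> exp (1 / 3 + M - \<sigma>\<^sup>2 / 48)"
    unfolding norm_airy_kernel using airy_exponent_le[of \<sigma>] by simp
  finally show ?thesis .
qed

lemma fock_kernel_norm_bound:
  assumes "d * \<bar>\<sigma>\<bar> \<le> pi / 2"
  shows "norm (of_real d * fock_kernel n x (of_real d * Complex 1 \<sigma>)) \<le> exp (1 / 3 + M - \<sigma>\<^sup>2 / 48)"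
proof -
  let ?z = "of_real d * Complex 1 \<sigma>"
  have s: "d \<le> norm (sinh ?z)" using norm_sinh_ge[of ?z] d by simp
  have "norm (of_real d * fock_kernel n x ?z) =
      d / norm (sinh ?z) * exp (Re (of_nat (2 * n + 1) * ?z - of_real x * tanh ?z))"
    unfolding fock_kernel_def norm_mult norm_divide norm_exp_eq_Re using d by simp
  also have "\<dots> \<le> 1 * exp (1 / 3 + M - \<sigma>\<^sup>2 / 48)"
    using fock_exponent_bound[OF assms] s d by (intro mult_mono) (auto simp: divide_le_eq)
  finally show ?thesis by simp
qed

text \<open>Away from the saddle \<open>d\<^sup>2 * (1 + \<sigma>\<^sup>2)\<close> exceeds
  \<open>1 / 4\<close>, so even the trivial bound \<open>2 * E\<close> is of the size of the error
  term; the constant 8 is there for \<open>8 / 4 = 2\<close>.\<close>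

lemma far_bound:
  assumes "norm (of_real d * Complex 1 \<sigma>) > 1 / 2" and that: "E \<ge> 0"
  shows "2 * E \<le> d\<^sup>2 * (M + 8) * (1 + \<sigma>\<^sup>2) ^ 3 * E"
proof -
  have M0: "M \<ge> 0" using t by linarith
  have "(1 / 2)\<^sup>2 \<le> (norm (of_real d * Complex 1 \<sigma>))\<^sup>2"
    using assms by (intro power_mono) auto
  also have "\<dots> = d\<^sup>2 * (1 + \<sigma>\<^sup>2)"
    using d by (simp add: norm_mult power_mult_distrib norm_Complex_1)
  also have "\<dots> \<le> d\<^sup>2 * (1 + \<sigma>\<^sup>2) ^ 3"
    using power_increasing[of 1 3 "1 + \<sigma>\<^sup>2"] by (intro mult_left_mono) auto
  finally have 1: "1 / 4 \<le> d\<^sup>2 * (1 + \<sigma>\<^sup>2) ^ 3" by (simp add: power2_eq_square)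
  hence "8 * (1 / 4) \<le> (M + 8) * (d\<^sup>2 * (1 + \<sigma>\<^sup>2) ^ 3)" using M0 by (intro mult_mono) auto
  from mult_right_mono[OF this that] show ?thesis by (simp add: mult_ac)
qed

text \<open>Three ranges of \<open>\<sigma>\<close>: beyond the segment only the Airy kernel
  remains; on the segment with \<open>norm z > 1 / 2\<close> the sizes of both kernels suffice; for
  \<open>norm z \<le> 1 / 2\<close> phase and amplitude are expanded.\<close>

lemma kernel_difference_bound:
  "norm (indicator {- (pi / (2 * d))..pi / (2 * d)} \<sigma> *\<^sub>R (of_real d * fock_kernel n x (of_real d * Complex 1 \<sigma>))
      - airy_kernel t \<sigma> / Complex 1 \<sigma>)
    \<le> d\<^sup>2 * (M + 8) * (1 + \<sigma>\<^sup>2) ^ 3 * exp (1 / 3 + M - \<sigma>\<^sup>2 / 48)"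
proof -
  define \<zeta> where "\<zeta> = Complex 1 \<sigma>"
  define z where "z = of_real d * \<zeta>"
  define E where "E = exp (1 / 3 + M - \<sigma>\<^sup>2 / 48)"
  define w where "w = 1 + \<sigma>\<^sup>2"
  define K where "K = of_real d * fock_kernel n x z"
  define B where "B = airy_kernel t \<sigma> / \<zeta>"
  have M0: "M \<ge> 0" using t by linarith
  have E0: "E > 0" by (simp add: E_def)
  have B: "norm B \<le> E" unfolding B_def \<zeta>_def E_def by (rule airy_kernel_quotient_bound)
  have \<zeta>: "(norm \<zeta>)\<^sup>2 = w" "1 \<le> norm \<zeta>" "\<zeta> \<noteq> 0"
    by (auto simp: \<zeta>_def w_def norm_Complex_1)
  have w: "w \<ge> 1" by (simp add: w_def)
  consider "pi / 2 < d * \<bar>\<sigma>\<bar>" | "d * \<bar>\<sigma>\<bar> \<le> pi / 2" "norm z > 1 / 2" | "d * \<bar>\<sigma>\<bar> \<le> pi / 2" "norm z \<le> 1 / 2"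
    by linarith
  hence "norm (indicator {- (pi / (2 * d))..pi / (2 * d)} \<sigma> *\<^sub>R K - B) \<le> d\<^sup>2 * (M + 8) * w ^ 3 * E"
  proof cases
    case 1
    hence "pi / (2 * d) < \<bar>\<sigma>\<bar>" using d by (simp add: field_simps)
    hence "\<sigma> \<notin> {- (pi / (2 * d))..pi / (2 * d)}" by auto
    moreover have "norm z > 1 / 2"
    proof -
      have "1 / 2 < d * \<bar>\<sigma>\<bar>" using 1 pi_gt3 by linarith
      also have "\<dots> = \<bar>Im z\<bar>" using d by (simp add: z_def \<zeta>_def abs_mult)
      also have "\<dots> \<le> norm z" by (rule abs_Im_le_cmod)
      finally show ?thesis .
    qed
    ultimately have "2 * E \<le> d\<^sup>2 * (M + 8) * w ^ 3 * E"
      using far_bound[of \<sigma> E] E0 by (simp add: z_def \<zeta>_def w_def)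
    hence "norm B \<le> d\<^sup>2 * (M + 8) * w ^ 3 * E" using B E0 by linarith
    thus ?thesis using \<open>\<sigma> \<notin> _\<close> by simp
  next
    case 2
    have "norm K \<le> E" unfolding K_def z_def \<zeta>_def E_def by (rule fock_kernel_norm_bound[OF 2(1)])
    hence "norm (indicator {- (pi / (2 * d))..pi / (2 * d)} \<sigma> *\<^sub>R K) \<le> E"
      using E0 by (simp add: indicator_def)
    hence "norm (indicator {- (pi / (2 * d))..pi / (2 * d)} \<sigma> *\<^sub>R K - B) \<le> 2 * E"
      using B norm_triangle_ineq4[of "indicator {- (pi / (2 * d))..pi / (2 * d)} \<sigma> *\<^sub>R K" B] by linarith
    moreover have "2 * E \<le> d\<^sup>2 * (M + 8) * w ^ 3 * E"
      using far_bound[of \<sigma> E] E0 2(2) by (simp add: z_def \<zeta>_def w_def)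
    ultimately show ?thesis by linarith
  next
    case 3
    have "\<bar>\<sigma>\<bar> \<le> pi / (2 * d)" using 3(1) d by (simp add: field_simps)
    hence ind: "\<sigma> \<in> {- (pi / (2 * d))..pi / (2 * d)}" by auto
    define a where "a = of_nat (2 * n + 1) * z - of_real x * tanh z"
    define b where "b = \<zeta> ^ 3 / 3 - of_real t * \<zeta>"
    have Rea: "Re a \<le> 1 / 3 + M - \<sigma>\<^sup>2 / 48"
      unfolding a_def z_def \<zeta>_def by (rule fock_exponent_bound[OF 3(1)])
    have expb: "exp b = airy_kernel t \<sigma>" by (simp add: b_def airy_kernel_def \<zeta>_def)
    have "exp (Re b) = exp (1 / 3 - \<sigma>\<^sup>2 - t)"
      using norm_airy_kernel[of t \<sigma>] unfolding expb[symmetric] norm_exp_eq_Re .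
    hence Reb: "Re b \<le> 1 / 3 + M - \<sigma>\<^sup>2 / 48" using airy_exponent_le[of \<sigma>] by simp
    have nz: "norm z = d * norm \<zeta>" using d by (simp add: z_def norm_mult)
    have Ndc: "(of_nat (2 * n + 1) :: complex) * of_real d ^ 3 = 1"
      using arg_cong[OF Nd, of complex_of_real] by simp
    \<comment> \<open>Since \<open>N z^3 = \<zeta>^3\<close> and
      \<open>(t / d) z = t \<zeta>\<close>, exactly the Taylor remainders of \<open>tanh\<close>
      survive. Up to constants they are of size \<open>N |z|^5 = d^2 |\<zeta>|^5\<close> and
      \<open>d^2 |\<zeta>|^3\<close>.\<close>
    have ab: "a - b = - of_nat (2 * n + 1) * (tanh z - z + z ^ 3 / 3) - of_real (t / d) * (tanh z - z)"
    proof -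
      define c where "c = (of_nat (2 * n + 1) :: complex)"
      define q where "q = complex_of_real (t / d)"
      have A: "c * z ^ 3 = \<zeta> ^ 3"
        using Ndc by (simp add: c_def z_def power_mult_distrib mult.assoc[symmetric] del: of_nat_add of_nat_mult)
      have B: "q * z = of_real t * \<zeta>" using d by (simp add: q_def z_def)
      have X: "of_real x = c + q" by (simp add: x c_def q_def)
      have "a - b = c * z - (c + q) * tanh z - (c * z ^ 3 / 3 - q * z)"
        unfolding a_def b_def A B X c_def[symmetric] ..
      also have "\<dots> = - c * (tanh z - z + z ^ 3 / 3) - q * (tanh z - z)" by (simp add: field_simps)
      finally show ?thesis unfolding c_def q_def .
    qed
    have "norm (a - b) \<le> real (2 * n + 1) * norm (tanh z - z + z ^ 3 / 3) + \<bar>t\<bar> / d * norm (tanh z - z)"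
      unfolding ab by (rule order_trans[OF norm_triangle_ineq4])
        (use d in \<open>simp only: norm_mult norm_minus_cancel norm_of_nat norm_of_real abs_divide abs_of_pos order_refl\<close>)
    also have "\<dots> \<le> real (2 * n + 1) * (2 * norm z ^ 5) + M / d * norm z ^ 3"
      using tanh_Taylor[OF 3(2)] t d M0 by (intro add_mono mult_mono divide_right_mono) auto
    also have "\<dots> = (real (2 * n + 1) * d ^ 3) * (2 * d\<^sup>2 * norm \<zeta> ^ 5) + M * d\<^sup>2 * norm \<zeta> ^ 3"
      unfolding nz power_mult_distrib using d by (simp add: eval_nat_numeral)
    also have "\<dots> = d\<^sup>2 * (2 * norm \<zeta> ^ 5 + M * norm \<zeta> ^ 3)"
      unfolding Nd by (simp add: algebra_simps)
    also have "\<dots> \<le> d\<^sup>2 * (2 * w ^ 3 + M * w ^ 3)"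
    proof -
      have "norm \<zeta> ^ 5 \<le> norm \<zeta> ^ 6" "norm \<zeta> ^ 3 \<le> norm \<zeta> ^ 6"
        using \<zeta>(2) by (auto intro: power_increasing)
      moreover have "norm \<zeta> ^ 6 = w ^ 3" using power_mult[of "norm \<zeta>" 2 3] \<zeta>(1) by simp
      ultimately show ?thesis using M0 by (intro mult_left_mono add_mono) auto
    qed
    finally have ab_le: "norm (a - b) \<le> d\<^sup>2 * (2 + M) * w ^ 3" by (simp add: algebra_simps)
    have exps: "norm (exp a - exp b) \<le> E * (d\<^sup>2 * (2 + M) * w ^ 3)"
      using norm_exp_diff_le[OF Rea Reb] mult_left_mono[OF ab_le, of E] E0 unfolding E_def by linarith
    have s: "d \<le> norm (sinh z)" using norm_sinh_ge[of z] d by (simp add: z_def \<zeta>_def)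
    hence s0: "sinh z \<noteq> 0" using d by auto
    have "of_real d / sinh z - 1 / \<zeta> = - (sinh z - z) / (\<zeta> * sinh z)"
      using s0 \<zeta>(3) by (simp add: field_simps z_def)
    hence "norm (of_real d / sinh z - 1 / \<zeta>) = norm (sinh z - z) / (norm \<zeta> * norm (sinh z))"
      by (simp add: norm_divide norm_mult norm_minus_commute)
    also have "\<dots> \<le> (2 * norm z ^ 3) / (norm \<zeta> * d)"
      using sinh_cosh_Taylor(1)[of z] 3(2) \<zeta> d s by (intro frac_le mult_left_mono) auto
    also have "\<dots> = d\<^sup>2 * (2 * (norm \<zeta>)\<^sup>2)"
      unfolding nz using d \<zeta>(3) by (simp add: field_simps eval_nat_numeral)
    also have "\<dots> \<le> d\<^sup>2 * (2 * w ^ 3)"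
      unfolding \<zeta>(1) using power_increasing[of 1 3 w] w by (intro mult_left_mono) auto
    finally have amp: "norm (of_real d / sinh z - 1 / \<zeta>) \<le> d\<^sup>2 * (2 * w ^ 3)" .
    \<comment> \<open>Amplitude error times the bounded Fock exponential, plus the error of the
      exponentials divided by \<open>\<zeta>\<close>.\<close>
    have "K - B = (of_real d / sinh z - 1 / \<zeta>) * exp a + (exp a - exp b) / \<zeta>"
      unfolding K_def B_def fock_kernel_def a_def[symmetric] expb[symmetric]
      by (simp add: algebra_simps diff_divide_distrib)
    hence "norm (K - B) \<le> norm (of_real d / sinh z - 1 / \<zeta>) * norm (exp a) + norm (exp a - exp b) / norm \<zeta>"
      by (metis norm_triangle_ineq norm_mult norm_divide)
    also have "\<dots> \<le> d\<^sup>2 * (2 * w ^ 3) * E + E * (d\<^sup>2 * (2 + M) * w ^ 3) / 1"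
      using amp Rea exps \<zeta>(2) E0 w d M0 by (intro add_mono mult_mono frac_le) (auto simp: E_def norm_exp_eq_Re)
    also have "\<dots> = d\<^sup>2 * (M + 4) * w ^ 3 * E" by (simp add: algebra_simps)
    also have "\<dots> \<le> d\<^sup>2 * (M + 8) * w ^ 3 * E" using w M0 E0 by (intro mult_right_mono mult_left_mono) auto
    finally show ?thesis using ind by simp
  qed
  thus ?thesis unfolding K_def B_def E_def w_def z_def \<zeta>_def .
qed

end

subsection \<open>Airy integrals\<close>

lemma integrable_inverse_one_plus_square: "integrable lborel (\<lambda>\<sigma>::real. 1 / (1 + \<sigma>\<^sup>2))"
  using integrable_inverse_1_plus_square
  by (simp add: set_integrable_def inverse_eq_divide)

lemma continuous_on_Complex_1 [continuous_intros]: "continuous_on A (Complex 1)"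
  unfolding Complex_eq by (intro continuous_intros)

lemma airy_kernel_continuous: "continuous_on A (airy_kernel t)"
  unfolding airy_kernel_def [abs_def] by (intro continuous_intros) auto

lemma airy_kernel_measurable [measurable]: "airy_kernel t \<in> borel_measurable borel"
  by (intro borel_measurable_continuous_onI airy_kernel_continuous)

lemma inverse_Complex_measurable [measurable]:
  "(\<lambda>\<sigma>. inverse (Complex 1 \<sigma>)) \<in> borel_measurable borel"
  by (intro borel_measurable_continuous_onI continuous_intros) auto

lemma Complex_power_measurable [measurable]:
  "(\<lambda>\<sigma>. Complex 1 \<sigma> ^ k) \<in> borel_measurable borel"
  by (intro borel_measurable_continuous_onI continuous_intros)

text \<open>The weight \<open>g\<close> is a power of the integration variable, possibly the reciprocal;
  differentiation in \<open>t\<close> multiplies it by minus the variable.\<close>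

definition airy_moment :: "(real \<Rightarrow> complex) \<Rightarrow> real \<Rightarrow> complex" where
  "airy_moment g t = (LINT \<sigma>|lborel. g \<sigma> * airy_kernel t \<sigma>) / (2 * of_real pi)"

text \<open>Degree two covers every weight that occurs: \<open>1 / \<zeta>\<close>, 1,
  \<open>\<zeta>\<close> and \<open>\<zeta>^2\<close> with
  \<open>\<zeta> = Complex 1 \<sigma>\<close>.\<close>

lemma airy_weight_bound:
  assumes "norm (g \<sigma>) \<le> norm (Complex 1 \<sigma>) ^ 2"
  shows "norm (g \<sigma> * airy_kernel t \<sigma>) \<le> exp (1 / 3 - t) * (3 * 192 ^ 4) * (1 / (1 + \<sigma>\<^sup>2))"
proof -
  define w where "w = 1 + \<sigma>\<^sup>2"
  have w: "w \<ge> 1" by (simp add: w_def)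
  have "norm (g \<sigma> * airy_kernel t \<sigma>) \<le> w * exp (1 / 3 - \<sigma>\<^sup>2 - t)"
    unfolding norm_mult norm_airy_kernel using assms by (intro mult_right_mono) (auto simp: norm_Complex_1 w_def)
  also have "\<dots> \<le> w ^ 3 * (exp (1 / 3 - t) * exp (- \<sigma>\<^sup>2 / 48))"
    using power_increasing[of 1 3 w] w by (intro mult_mono) (auto simp: exp_add[symmetric])
  also have "\<dots> = exp (1 / 3 - t) * (w ^ 3 * exp (- \<sigma>\<^sup>2 / 48))" by simp
  also have "\<dots> \<le> exp (1 / 3 - t) * (3 * 192 ^ 4 / w)"
    unfolding w_def by (intro mult_left_mono gaussian_moment_bound) auto
  finally show ?thesis by (simp add: w_def)
qed

lemma airy_integrable:
  assumes [measurable]: "g \<in> borel_measurable borel"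
    and "\<And>\<sigma>. norm (g \<sigma>) \<le> norm (Complex 1 \<sigma>) ^ 2"
  shows "integrable lborel (\<lambda>\<sigma>. g \<sigma> * airy_kernel t \<sigma>)"
proof (rule Bochner_Integration.integrable_bound)
  show "integrable lborel (\<lambda>\<sigma>::real. exp (1 / 3 - t) * (3 * 192 ^ 4) * (1 / (1 + \<sigma>\<^sup>2)))"
    by (rule integrable_mult_right[OF integrable_inverse_one_plus_square])
qed (use airy_weight_bound[of g] assms in \<open>auto simp del: power_numeral\<close>)


text \<open>The kernel at \<open>t + h\<close> differs by the factor
  \<open>exp (- h \<zeta>)\<close>, whose Taylor remainder after the linear term is of size
  \<open>h\<^sup>2 * (1 + \<sigma>\<^sup>2)\<close>. Integrating this bound over
  \<open>\<sigma>\<close> gives differentiability of the moments directly.\<close>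

lemma DERIV_airy_moment_aux:
  fixes h :: real
  assumes "\<bar>h\<bar> \<le> 1" and "norm (g \<sigma>) \<le> norm (Complex 1 \<sigma>) ^ 2"
  shows "norm (g \<sigma> * airy_kernel (t + h) \<sigma> - g \<sigma> * airy_kernel t \<sigma> + of_real h * (Complex 1 \<sigma> * g \<sigma> * airy_kernel t \<sigma>))
      \<le> h\<^sup>2 * (exp (3 - t) * (3 * 192 ^ 4)) * (1 / (1 + \<sigma>\<^sup>2))"
proof -
  define \<zeta> where "\<zeta> = Complex 1 \<sigma>"
  define w where "w = 1 + \<sigma>\<^sup>2"
  have w: "w \<ge> 1" by (simp add: w_def)
  have \<zeta>: "(norm \<zeta>)\<^sup>2 = w" by (auto simp: \<zeta>_def w_def norm_Complex_1)
  have "airy_kernel (t + h) \<sigma> = airy_kernel t \<sigma> * exp (- of_real h * \<zeta>)"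
    by (simp add: airy_kernel_def \<zeta>_def algebra_simps flip: exp_add)
  hence "g \<sigma> * airy_kernel (t + h) \<sigma> - g \<sigma> * airy_kernel t \<sigma> + of_real h * (Complex 1 \<sigma> * g \<sigma> * airy_kernel t \<sigma>)
     = g \<sigma> * airy_kernel t \<sigma> * (exp (- of_real h * \<zeta>) - (\<Sum>i\<le>1. (- of_real h * \<zeta>) ^ i / fact i))"
    by (simp add: algebra_simps \<zeta>_def)
  hence "norm (g \<sigma> * airy_kernel (t + h) \<sigma> - g \<sigma> * airy_kernel t \<sigma> + of_real h * (Complex 1 \<sigma> * g \<sigma> * airy_kernel t \<sigma>))
     = norm (g \<sigma> * airy_kernel t \<sigma>) * norm (exp (- of_real h * \<zeta>) - (\<Sum>i\<le>1. (- of_real h * \<zeta>) ^ i / fact i))"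
    by (simp only: norm_mult)
  also have "\<dots> \<le> (w * exp (1 / 3 - \<sigma>\<^sup>2 - t)) * (exp 1 * (h\<^sup>2 * w))"
  proof (intro mult_mono)
    show "norm (g \<sigma> * airy_kernel t \<sigma>) \<le> w * exp (1 / 3 - \<sigma>\<^sup>2 - t)"
      unfolding norm_mult norm_airy_kernel using assms(2) by (intro mult_right_mono) (auto simp: \<zeta>_def[symmetric] \<zeta>)
    have "norm (exp (- of_real h * \<zeta>) - (\<Sum>i\<le>1. (- of_real h * \<zeta>) ^ i / fact i))
       \<le> exp \<bar>Re (- of_real h * \<zeta>)\<bar> * norm (- of_real h * \<zeta>) ^ Suc 1 / fact 1"
      by (rule Taylor_exp)
    also have "\<dots> = exp \<bar>h\<bar> * (h\<^sup>2 * w)"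
      using \<zeta> by (simp add: \<zeta>_def norm_mult power2_eq_square mult_ac)
    also have "\<dots> \<le> exp 1 * (h\<^sup>2 * w)" using assms(1) w by (intro mult_right_mono) auto
    finally show "norm (exp (- of_real h * \<zeta>) - (\<Sum>i\<le>1. (- of_real h * \<zeta>) ^ i / fact i)) \<le> exp 1 * (h\<^sup>2 * w)" .
  qed (use w in auto)
  also have "\<dots> = h\<^sup>2 * (w ^ 2 * exp (4 / 3 - \<sigma>\<^sup>2 - t))"
    by (simp add: power2_eq_square mult_ac flip: exp_add)
  also have "\<dots> \<le> h\<^sup>2 * (w ^ 3 * (exp (3 - t) * exp (- \<sigma>\<^sup>2 / 48)))"
  proof (intro mult_left_mono mult_mono)
    have "0 \<le> \<sigma>\<^sup>2" by simp
    hence "4 / 3 - \<sigma>\<^sup>2 - t \<le> 3 - t + - \<sigma>\<^sup>2 / 48" by linarith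
    thus "exp (4 / 3 - \<sigma>\<^sup>2 - t) \<le> exp (3 - t) * exp (- \<sigma>\<^sup>2 / 48)" unfolding exp_add[symmetric] by simp
  qed (use w in \<open>auto intro: power_increasing\<close>)
  also have "\<dots> = h\<^sup>2 * exp (3 - t) * (w ^ 3 * exp (- \<sigma>\<^sup>2 / 48))" by simp
  also have "\<dots> \<le> h\<^sup>2 * exp (3 - t) * (3 * 192 ^ 4 / w)"
    unfolding w_def by (intro mult_left_mono gaussian_moment_bound) auto
  finally show ?thesis by (simp add: w_def)
qed


lemma has_vector_derivative_quadratic_remainder:
  fixes F :: "real \<Rightarrow> 'a::real_normed_vector"
  assumes "\<And>h. \<bar>h\<bar> \<le> 1 \<Longrightarrow> norm (F (t + h) - F t - h *\<^sub>R D) \<le> C * h\<^sup>2"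
  shows "(F has_vector_derivative D) (at t)"
  unfolding has_vector_derivative_def has_derivative_at
proof (intro conjI bounded_linear_scaleR_left)
  show "(\<lambda>h. norm (F (t + h) - F t - h *\<^sub>R D) / norm h) \<midarrow>0\<rightarrow> 0"
  proof (rule Lim_null_comparison)
    have "eventually (\<lambda>h::real. h \<in> {-1<..<1}) (at 0)"
      by (rule eventually_at_in_open') auto
    thus "eventually (\<lambda>h. norm (norm (F (t + h) - F t - h *\<^sub>R D) / norm h) \<le> \<bar>C\<bar> * \<bar>h\<bar>) (at 0)"
    proof eventually_elim
      case (elim h)
      have "norm (F (t + h) - F t - h *\<^sub>R D) \<le> C * h\<^sup>2" using elim by (intro assms) auto
      also have "\<dots> \<le> \<bar>C\<bar> * \<bar>h\<bar> * \<bar>h\<bar>"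
        by (simp add: power2_eq_square mult_right_mono flip: abs_mult)
      finally show ?case by (cases "h = 0") (auto simp: divide_le_eq)
    qed
    show "(\<lambda>h. \<bar>C\<bar> * \<bar>h\<bar>) \<midarrow>0\<rightarrow> 0"
      by (rule tendsto_eq_intros refl | simp)+
  qed
qed

text \<open>The derivative brings down \<open>- \<zeta>\<close>, so the weight stays one degree
  below the range of \<open>airy_integrable\<close>.\<close>

lemma airy_moment_derivative:
  assumes [measurable]: "g \<in> borel_measurable borel"
    and bound: "\<And>\<sigma>. norm (g \<sigma>) \<le> norm (Complex 1 \<sigma>)"
  shows "(airy_moment g has_vector_derivative - airy_moment (\<lambda>\<sigma>. Complex 1 \<sigma> * g \<sigma>) t) (at t)"
proof (rule has_vector_derivative_quadratic_remainder)
  fix h :: real assume h: "\<bar>h\<bar> \<le> 1"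
  define K where "K = exp (3 - t) * (3 * 192 ^ 4)"
  have b2: "norm (g \<sigma>) \<le> norm (Complex 1 \<sigma>) ^ 2" for \<sigma>
    using bound[of \<sigma>] norm_Complex_1(2)[of \<sigma>] power_increasing[of 1 2 "norm (Complex 1 \<sigma>)"] by (simp del: power_numeral)
  have b2': "norm (Complex 1 \<sigma> * g \<sigma>) \<le> norm (Complex 1 \<sigma>) ^ 2" for \<sigma>
    using mult_left_mono[OF bound[of \<sigma>], of "norm (Complex 1 \<sigma>)"] by (simp add: norm_mult power2_eq_square)
  have [measurable]: "(\<lambda>\<sigma>. Complex 1 \<sigma> * g \<sigma>) \<in> borel_measurable borel"
    using Complex_power_measurable[of 1] by simp
  note int = airy_integrable[of g, OF _ b2] airy_integrable[of "\<lambda>\<sigma>. Complex 1 \<sigma> * g \<sigma>", OF _ b2']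
  have "2 * of_real pi * (airy_moment g (t + h) - airy_moment g t - h *\<^sub>R (- airy_moment (\<lambda>\<sigma>. Complex 1 \<sigma> * g \<sigma>) t))
     = (LINT \<sigma>|lborel. g \<sigma> * airy_kernel (t + h) \<sigma>) - (LINT \<sigma>|lborel. g \<sigma> * airy_kernel t \<sigma>)
       + of_real h * (LINT \<sigma>|lborel. Complex 1 \<sigma> * g \<sigma> * airy_kernel t \<sigma>)"
    by (simp add: airy_moment_def scaleR_conv_of_real field_simps)
  also have "\<dots> = (LINT \<sigma>|lborel. g \<sigma> * airy_kernel (t + h) \<sigma> - g \<sigma> * airy_kernel t \<sigma> + of_real h * (Complex 1 \<sigma> * g \<sigma> * airy_kernel t \<sigma>))"
    using int by simp
  also have "norm \<dots> \<le> (LINT \<sigma>|lborel. h\<^sup>2 * K * (1 / (1 + (\<sigma>::real)\<^sup>2)))"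
  proof (rule Bochner_Integration.integral_norm_bound_integral)
    show "integrable lborel (\<lambda>\<sigma>::real. h\<^sup>2 * K * (1 / (1 + \<sigma>\<^sup>2)))"
      by (rule integrable_mult_right[OF integrable_inverse_one_plus_square])
  qed (use int DERIV_airy_moment_aux[where g = g, OF h b2] in \<open>auto simp: K_def simp del: power_numeral\<close>)
  also have "\<dots> = K * (LINT \<sigma>|lborel. 1 / (1 + (\<sigma>::real)\<^sup>2)) * h\<^sup>2"
    by (subst integral_mult_right_zero) (simp add: mult_ac del: power_numeral)
  finally have "2 * pi * norm (airy_moment g (t + h) - airy_moment g t - h *\<^sub>R (- airy_moment (\<lambda>\<sigma>. Complex 1 \<sigma> * g \<sigma>) t))
     \<le> K * (LINT \<sigma>|lborel. 1 / (1 + (\<sigma>::real)\<^sup>2)) * h\<^sup>2"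
    by (simp only: norm_mult norm_of_real norm_numeral) simp
  thus "norm (airy_moment g (t + h) - airy_moment g t - h *\<^sub>R (- airy_moment (\<lambda>\<sigma>. Complex 1 \<sigma> * g \<sigma>) t))
     \<le> K * (LINT \<sigma>|lborel. 1 / (1 + (\<sigma>::real)\<^sup>2)) / (2 * pi) * h\<^sup>2"
    by (simp add: field_simps)
qed

text \<open>For \<open>Re \<zeta> > 0\<close> the integral of \<open>exp (- u \<zeta>)\<close> over
  \<open>u \<ge> t\<close> is \<open>exp (- t \<zeta>) / \<zeta>\<close>. The weight
  \<open>1 / \<zeta>\<close> therefore gives the integral of Ai over
  \<open>[t, \<infinity>)\<close>, the weight 1 gives Ai, and \<open>- \<zeta>\<close> gives its
  derivative.\<close>

definition airy_tail :: "real \<Rightarrow> real" where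
  "airy_tail t = Re (airy_moment (\<lambda>\<sigma>. inverse (Complex 1 \<sigma>)) t)"

definition airy_fun :: "real \<Rightarrow> real" where
  "airy_fun t = Re (airy_moment (\<lambda>_. 1) t)"

definition airy_slope :: "real \<Rightarrow> real" where
  "airy_slope t = - Re (airy_moment (Complex 1) t)"

lemma norm_inverse_Complex_1: "norm (inverse (Complex 1 \<sigma>)) \<le> 1"
  unfolding norm_inverse using norm_Complex_1(2)[of \<sigma>] by (simp add: inverse_le_1_iff)

lemma Re_airy_moment_derivative:
  assumes "g \<in> borel_measurable borel" "\<And>\<sigma>. norm (g \<sigma>) \<le> norm (Complex 1 \<sigma>)"
  shows "((\<lambda>t. Re (airy_moment g t)) has_real_derivative - Re (airy_moment (\<lambda>\<sigma>. Complex 1 \<sigma> * g \<sigma>) t)) (at t)"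
  using bounded_linear.has_vector_derivative[OF bounded_linear_Re airy_moment_derivative[OF assms, of t]]
  by (simp add: has_real_derivative_iff_has_vector_derivative)

lemma DERIV_airy_tail: "(airy_tail has_real_derivative - airy_fun t) (at t)"
proof -
  have "norm (inverse (Complex 1 \<sigma>)) \<le> norm (Complex 1 \<sigma>)" for \<sigma>
    using norm_inverse_Complex_1[of \<sigma>] norm_Complex_1(2)[of \<sigma>] by linarith
  from Re_airy_moment_derivative[OF inverse_Complex_measurable this, of t] show ?thesis
    by (simp add: airy_tail_def[abs_def] airy_fun_def)
qed

lemma DERIV_airy_fun: "(airy_fun has_real_derivative airy_slope t) (at t)"
  using Re_airy_moment_derivative[of "\<lambda>_. 1" t] norm_Complex_1(2)
  by (simp add: airy_fun_def[abs_def] airy_slope_def)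

text \<open>Airy's equation. The \<open>\<sigma>\<close>-derivative of the kernel is
  \<open>i (\<zeta>^2 - t)\<close> times the kernel, and the kernel vanishes at both ends, so that
  derivative integrates to 0.\<close>

lemma airy_moment_recurrence: "airy_moment (\<lambda>\<sigma>. Complex 1 \<sigma> ^ 2) t = of_real t * airy_moment (\<lambda>_. 1) t"
proof -
  have i1: "integrable lborel (\<lambda>\<sigma>. Complex 1 \<sigma> ^ 2 * airy_kernel t \<sigma>)"
    by (rule airy_integrable) (auto simp: norm_power)
  have i2: "integrable lborel (\<lambda>\<sigma>. 1 * airy_kernel t \<sigma>)"
    using norm_Complex_1(1) by (intro airy_integrable) (auto simp del: mult_1)
  define f where "f = (\<lambda>\<sigma>. \<i> * (Complex 1 \<sigma> ^ 2 * airy_kernel t \<sigma> - of_real t * (1 * airy_kernel t \<sigma>)))"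
  have int: "integrable lborel f"
    unfolding f_def by (intro integrable_mult_right Bochner_Integration.integrable_diff i1 i2)
  have D: "(airy_kernel t has_vector_derivative f \<sigma>) (at \<sigma>)" for \<sigma>
  proof -
    have "((\<lambda>z. exp ((1 + \<i> * z) ^ 3 / 3 - of_real t * (1 + \<i> * z))) has_field_derivative f \<sigma>) (at (of_real \<sigma>))"
      unfolding f_def airy_kernel_def Complex_eq
      by (auto intro!: derivative_eq_intros simp: field_simps)
    from has_vector_derivative_real_field[OF this] show ?thesis
      unfolding airy_kernel_def[abs_def] Complex_eq by simp
  qed
  have cont: "isCont f \<sigma>" for \<sigma>
  proof -
    have "continuous_on UNIV f" unfolding f_def by (intro continuous_intros airy_kernel_continuous)
    thus ?thesis by (simp add: continuous_on_eq_continuous_at)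
  qed
  have lim: "(airy_kernel t \<longlongrightarrow> 0) F" if "filterlim (\<lambda>\<sigma>::real. \<sigma>\<^sup>2) at_top F" for F
  proof (rule tendsto_norm_zero_cancel)
    have "filterlim (\<lambda>\<sigma>::real. - \<sigma>\<^sup>2) at_bot F"
      using that by (simp add: filterlim_uminus_at_bot)
    from tendsto_mult_right[OF filterlim_compose[OF exp_at_bot this], of "exp (1 / 3 - t)"]
    show "((\<lambda>\<sigma>. norm (airy_kernel t \<sigma>)) \<longlongrightarrow> 0) F"
      unfolding norm_airy_kernel by (simp add: algebra_simps flip: exp_add)
  qed
  have "filterlim (\<lambda>\<sigma>::real. \<sigma>\<^sup>2) at_top at_top" "filterlim (\<lambda>\<sigma>::real. \<sigma>\<^sup>2) at_top at_bot"
    by (auto intro: filterlim_pow_at_top[OF _ filterlim_ident] filterlim_pow_at_bot_even[OF _ filterlim_ident])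
  hence L: "(airy_kernel t \<longlongrightarrow> 0) at_top" "(airy_kernel t \<longlongrightarrow> 0) at_bot" using lim by auto
  have "(LBINT \<sigma>=-\<infinity>..\<infinity>. f \<sigma>) = 0 - 0"
    by (rule interval_integral_FTC_integrable[where F = "airy_kernel t"])
       (use D cont int L in \<open>auto simp: ereal_tendsto_simps set_integrable_def\<close>)
  hence "(LINT \<sigma>|lborel. f \<sigma>) = 0"
    by (simp add: interval_lebesgue_integral_def set_lebesgue_integral_def)
  hence "(LINT \<sigma>|lborel. Complex 1 \<sigma> ^ 2 * airy_kernel t \<sigma>) = of_real t * (LINT \<sigma>|lborel. 1 * airy_kernel t \<sigma>)"
    using i1 i2 by (simp add: f_def)
  thus ?thesis by (simp add: airy_moment_def)
qed

lemma DERIV_airy_slope: "(airy_slope has_real_derivative t * airy_fun t) (at t)"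
proof -
  have [measurable]: "Complex 1 \<in> borel_measurable borel"
    using Complex_power_measurable[of 1] by simp
  have "((\<lambda>t. Re (airy_moment (Complex 1) t)) has_real_derivative - Re (airy_moment (\<lambda>\<sigma>. Complex 1 \<sigma> * Complex 1 \<sigma>) t)) (at t)"
    by (rule Re_airy_moment_derivative) auto
  also have "airy_moment (\<lambda>\<sigma>. Complex 1 \<sigma> * Complex 1 \<sigma>) t = of_real t * airy_moment (\<lambda>_. 1) t"
    using airy_moment_recurrence[of t] by (simp add: power2_eq_square)
  finally show ?thesis
    unfolding airy_slope_def[abs_def] by (rule DERIV_minus[THEN DERIV_cong]) (simp add: airy_fun_def)
qed

text \<open>On \<open>Re \<zeta> = 1\<close> the modulus of the kernel carries the factor
  \<open>exp (- t)\<close>.\<close>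

lemma airy_tail_at_top: "(airy_tail \<longlongrightarrow> 0) at_top"
proof -
  define K where "K = 3 * 192 ^ 4 * (LINT \<sigma>|lborel. 1 / (1 + (\<sigma>::real)\<^sup>2)) / (2 * pi)"
  have b: "norm (inverse (Complex 1 \<sigma>)) \<le> norm (Complex 1 \<sigma>) ^ 2" for \<sigma>
    using norm_inverse_Complex_1[of \<sigma>] norm_Complex_1(1)[of \<sigma>] zero_le_power2[of \<sigma>] by linarith
  have le: "norm (airy_tail t) \<le> exp (1 / 3 - t) * K" for t
  proof -
    have "norm (LINT \<sigma>|lborel. inverse (Complex 1 \<sigma>) * airy_kernel t \<sigma>)
      \<le> (LINT \<sigma>|lborel. exp (1 / 3 - t) * (3 * 192 ^ 4) * (1 / (1 + (\<sigma>::real)\<^sup>2)))"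
    proof (rule Bochner_Integration.integral_norm_bound_integral)
      show "integrable lborel (\<lambda>\<sigma>::real. exp (1 / 3 - t) * (3 * 192 ^ 4) * (1 / (1 + \<sigma>\<^sup>2)))"
        by (rule integrable_mult_right[OF integrable_inverse_one_plus_square])
    qed (use airy_integrable[where g = "\<lambda>\<sigma>. inverse (Complex 1 \<sigma>)", OF _ b] airy_weight_bound[where g = "\<lambda>\<sigma>. inverse (Complex 1 \<sigma>)", OF b] in \<open>auto simp del: power_numeral\<close>)
    also have "\<dots> = exp (1 / 3 - t) * (K * (2 * pi))"
      by (subst integral_mult_right_zero) (simp add: K_def mult_ac del: power_numeral)
    finally have "norm (airy_moment (\<lambda>\<sigma>. inverse (Complex 1 \<sigma>)) t) \<le> exp (1 / 3 - t) * K"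
      by (simp add: airy_moment_def norm_divide norm_mult field_simps)
    thus ?thesis unfolding airy_tail_def using abs_Re_le_cmod order_trans by fastforce
  qed
  from tendsto_mult_left[OF filterlim_compose[OF exp_at_bot filterlim_uminus_at_bot_at_top], of "exp (1 / 3) * K"]
  have "((\<lambda>t. exp (1 / 3 - t) * K) \<longlongrightarrow> 0) at_top"
    using exp_add[of "1 / 3" "- _ :: real"] by (simp add: mult_ac)
  thus ?thesis by (rule Lim_null_comparison[rotated]) (use le in auto)
qed

text \<open>Covers both contour moves below: to the imaginary axis with \<open>I = 0\<close>, and
  across the pole to \<open>Re = -1\<close> with \<open>I = 2 * pi * \<i>\<close>. The two
  horizontal sides are the only error.\<close>

lemma rectangle_shift:
  fixes f :: "complex \<Rightarrow> complex"
  assumes ab: "a < b" "0 < S"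
    and cont: "continuous_on (path_image (rectpath (Complex a (- S)) (Complex b S))) f"
    and I: "(f has_contour_integral I) (rectpath (Complex a (- S)) (Complex b S))"
    and B: "norm (contour_integral (linepath (Complex a (- S)) (Complex b (- S))) f) \<le> B"
      "norm (contour_integral (linepath (Complex a S) (Complex b S)) f) \<le> B"
  shows "norm (integral {-S..S} (\<lambda>\<sigma>. f (Complex b \<sigma>)) - integral {-S..S} (\<lambda>\<sigma>. f (Complex a \<sigma>)) - I / \<i>) \<le> 2 * B"
proof -
  let ?l1 = "linepath (Complex a (- S)) (Complex b (- S))"
  let ?l2 = "linepath (Complex b (- S)) (Complex b S)"
  let ?l3 = "linepath (Complex b S) (Complex a S)"
  let ?l4 = "linepath (Complex a S) (Complex a (- S))"
  have rp: "rectpath (Complex a (- S)) (Complex b S) = ?l1 +++ ?l2 +++ ?l3 +++ ?l4"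
    by (simp add: rectpath_def Let_def)
  have im: "path_image (rectpath (Complex a (- S)) (Complex b S)) =
     path_image ?l1 \<union> path_image ?l2 \<union> path_image ?l3 \<union> path_image ?l4"
    unfolding rp by (simp add: path_image_join Un_assoc)
  have c: "continuous_on (path_image l) f" if "l \<in> {?l1, ?l2, ?l3, ?l4}" for l
    using continuous_on_subset[OF cont] that unfolding im by blast
  have i: "f contour_integrable_on l" if "l \<in> {?l1, ?l2, ?l3, ?l4}" for l
    using c[OF that] that by (auto intro: contour_integrable_continuous_linepath)
  have "I = contour_integral ?l1 f + contour_integral ?l2 f + contour_integral ?l3 f + contour_integral ?l4 f"
    using contour_integral_unique[OF I] i unfolding rp by (simp add: add.assoc)
  moreover have "contour_integral ?l2 f = \<i> * integral {-S..S} (\<lambda>\<sigma>. f (Complex b \<sigma>))"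
    using ab by (intro contour_integral_linepath_same_Re) auto
  moreover have "contour_integral ?l4 f = - (\<i> * integral {-S..S} (\<lambda>\<sigma>. f (Complex a \<sigma>)))"
  proof -
    have "contour_integral ?l4 f = - contour_integral (linepath (Complex a (- S)) (Complex a S)) f"
      using c[of ?l4] by (intro contour_integral_reverse_linepath) auto
    also have "contour_integral (linepath (Complex a (- S)) (Complex a S)) f = \<i> * integral {-S..S} (\<lambda>\<sigma>. f (Complex a \<sigma>))"
      using ab by (intro contour_integral_linepath_same_Re) auto
    finally show ?thesis .
  qed
  moreover have "contour_integral ?l3 f = - contour_integral (linepath (Complex a S) (Complex b S)) f"
    using c[of ?l3] by (intro contour_integral_reverse_linepath) auto
  ultimately have "\<i> * (integral {-S..S} (\<lambda>\<sigma>. f (Complex b \<sigma>)) - integral {-S..S} (\<lambda>\<sigma>. f (Complex a \<sigma>)) - I / \<i>)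
     = contour_integral (linepath (Complex a S) (Complex b S)) f - contour_integral ?l1 f"
    by (simp add: algebra_simps)
  hence "norm (integral {-S..S} (\<lambda>\<sigma>. f (Complex b \<sigma>)) - integral {-S..S} (\<lambda>\<sigma>. f (Complex a \<sigma>)) - I / \<i>)
     = norm (contour_integral (linepath (Complex a S) (Complex b S)) f - contour_integral ?l1 f)"
    by (metis norm_mult norm_ii mult_1)
  also have "\<dots> \<le> 2 * B" using B by (intro order_trans[OF norm_triangle_ineq4]) auto
  finally show ?thesis .
qed

lemma integral_symmetric_tendsto:
  fixes g :: "real \<Rightarrow> complex"
  assumes g: "integrable lborel g"
  shows "((\<lambda>S. integral {-S..S} g) \<longlongrightarrow> (LINT \<sigma>|lborel. g \<sigma>)) at_top"
proof -
  have si: "set_integrable lborel {-S..S} g" for S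
    using g unfolding set_integrable_def by (rule integrable_mult_indicator[rotated]) auto
  have [measurable]: "g \<in> borel_measurable borel" using g by auto
  have "((\<lambda>S. LINT \<sigma>|lborel. indicator {-S..S} \<sigma> *\<^sub>R g \<sigma>) \<longlongrightarrow> (LINT \<sigma>|lborel. g \<sigma>)) at_top"
  proof (rule integral_dominated_convergence_at_top[where w = "\<lambda>\<sigma>. norm (g \<sigma>)"])
    show "AE \<sigma> in lborel. ((\<lambda>S. indicator {-S..S} \<sigma> *\<^sub>R g \<sigma>) \<longlongrightarrow> g \<sigma>) at_top"
    proof (rule AE_I2)
      fix \<sigma> :: real
      have "eventually (\<lambda>S. indicator {-S..S} \<sigma> *\<^sub>R g \<sigma> = g \<sigma>) at_top"
        using eventually_ge_at_top[of "\<bar>\<sigma>\<bar>"] by eventually_elim (auto simp: indicator_def)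
      thus "((\<lambda>S. indicator {-S..S} \<sigma> *\<^sub>R g \<sigma>) \<longlongrightarrow> g \<sigma>) at_top" by (rule tendsto_eventually)
    qed
  qed (use g in \<open>auto simp: indicator_def\<close>)
  thus ?thesis using set_borel_integral_eq_integral(2)[OF si] by (simp add: set_lebesgue_integral_def)
qed

lemma airy_moment_1_integrable: "integrable lborel (airy_kernel t)"
  using airy_integrable[of "\<lambda>_. 1" t] norm_Complex_1(1) by simp

lemma Re_airy_exponent:
  "Re (Complex y c ^ 3 / 3 - of_real t * Complex y c) = y ^ 3 / 3 - y * c\<^sup>2 - t * y"
  by (simp add: power3_eq_cube power2_eq_square field_simps)

lemma has_integral_exp_decay:
  fixes m :: real
  assumes "m \<noteq> 0" "a \<le> b"
  shows "((\<lambda>y. exp (- (m * y))) has_integral (exp (- (m * a)) - exp (- (m * b))) / m) {a..b}"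
proof -
  have "((\<lambda>y. exp (- (m * y))) has_integral (- exp (- (m * b)) / m - - exp (- (m * a)) / m)) {a..b}"
    by (rule fundamental_theorem_of_calculus)
       (use assms in \<open>auto intro!: derivative_eq_intros simp flip: has_real_derivative_iff_has_vector_derivative\<close>)
  thus ?thesis by (simp add: diff_divide_distrib)
qed

text \<open>Cauchy's theorem moves the line to the imaginary axis, where convergence is only
  conditional; hence truncated integrals are compared before the limit. On the axis the real part is
  the even cosine integrand, so the half-line integral carries \<open>1 / pi\<close> in place of
  \<open>1 / (2 * pi)\<close>.\<close>

lemma airy_Ai_eq: "airy_Ai t = airy_fun t"
proof -
  define f where "f = (\<lambda>z::complex. exp (z ^ 3 / 3 - of_real t * z))"
  have hol: "f holomorphic_on UNIV" unfolding f_def by (intro holomorphic_intros) auto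
  have contf: "continuous_on A f" for A
    using holomorphic_on_imp_continuous_on[OF hol] continuous_on_subset by blast
  define E where "E = exp (1 / 3 + \<bar>t\<bar>)"
  \<comment> \<open>At \<open>y = 0\<close> the integrand has modulus 1, so a supremum bound would
    not decay in \<open>c\<close>. Integrating \<open>exp (- (c\<^sup>2 * y))\<close> along the side
    yields \<open>1 / c\<^sup>2\<close>.\<close>
  have side: "norm (contour_integral (linepath (Complex 0 c) (Complex 1 c)) f) \<le> E / c\<^sup>2" if "c \<noteq> 0" for c
  proof -
    have lp: "linepath (Complex 0 c) (Complex 1 c) y = Complex y c" for y
      by (simp add: linepath_def complex_eq_iff algebra_simps)
    have "contour_integral (linepath (Complex 0 c) (Complex 1 c)) f = integral {0..1} (\<lambda>y. f (Complex y c))"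
    proof (rule contour_integral_unique)
      have "Complex 1 c - Complex 0 c = 1" by (simp add: complex_eq_iff)
      moreover have "((\<lambda>y. f (Complex y c)) has_integral integral {0..1} (\<lambda>y. f (Complex y c))) {0..1}"
        unfolding Complex_eq
        by (intro integrable_integral integrable_continuous_interval continuous_on_compose2[OF contf] continuous_intros) auto
      ultimately show "(f has_contour_integral integral {0..1} (\<lambda>y. f (Complex y c))) (linepath (Complex 0 c) (Complex 1 c))"
        by (simp add: has_contour_integral_linepath lp)
    qed
    also have "norm \<dots> \<le> integral {0..1} (\<lambda>y. E * exp (- (c\<^sup>2 * y)))"
    proof (rule integral_norm_bound_integral)
      show "(\<lambda>y. f (Complex y c)) integrable_on {0..1}"
        unfolding Complex_eq
        by (intro integrable_continuous_interval continuous_on_compose2[OF contf] continuous_intros) auto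
      show "(\<lambda>y. E * exp (- (c\<^sup>2 * y))) integrable_on {0..1}"
        by (intro integrable_continuous_interval continuous_intros)
      fix y :: real assume y: "y \<in> {0..1}"
      have "y ^ 3 \<le> 1" using y by (auto intro: power_le_one)
      moreover have "- (t * y) \<le> \<bar>t\<bar>"
      proof -
        have "\<bar>t * y\<bar> \<le> \<bar>t\<bar> * 1" using y unfolding abs_mult by (intro mult_left_mono) auto
        thus ?thesis by linarith
      qed
      ultimately have "y ^ 3 / 3 - y * c\<^sup>2 - t * y \<le> 1 / 3 + \<bar>t\<bar> + - (c\<^sup>2 * y)" by (simp add: mult.commute)
      thus "norm (f (Complex y c)) \<le> E * exp (- (c\<^sup>2 * y))"
        unfolding f_def norm_exp_eq_Re Re_airy_exponent E_def exp_add[symmetric] by simp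
    qed
    also have "\<dots> = E * (1 - exp (- c\<^sup>2)) / c\<^sup>2"
      using integral_unique[OF has_integral_mult_right[OF has_integral_exp_decay[of "c\<^sup>2" 0 1], of E]] that by simp
    also have "\<dots> \<le> E * 1 / c\<^sup>2"
      unfolding E_def by (intro divide_right_mono mult_left_mono) auto
    finally show ?thesis by simp
  qed
  have shift: "norm (integral {-S..S} (\<lambda>\<sigma>. f (Complex 0 \<sigma>)) - integral {-S..S} (airy_kernel t)) \<le> 2 * (E / S\<^sup>2)"
    if "S > 0" for S
  proof -
    have "(f has_contour_integral 0) (rectpath (Complex 0 (- S)) (Complex 1 S))"
      by (rule Cauchy_theorem_convex_simple[OF hol]) auto
    from rectangle_shift[OF _ that contf this side[of "- S", simplified] side[of S, simplified]] that
    have "norm (integral {-S..S} (\<lambda>\<sigma>. f (Complex 1 \<sigma>)) - integral {-S..S} (\<lambda>\<sigma>. f (Complex 0 \<sigma>))) \<le> 2 * (E / S\<^sup>2)"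
      by simp
    moreover have "(\<lambda>\<sigma>. f (Complex 1 \<sigma>)) = airy_kernel t"
      by (simp add: f_def airy_kernel_def fun_eq_iff)
    ultimately show ?thesis by (simp add: norm_minus_commute)
  qed
  have "((\<lambda>S. integral {-S..S} (\<lambda>\<sigma>. f (Complex 0 \<sigma>)) - integral {-S..S} (airy_kernel t)) \<longlongrightarrow> 0) at_top"
  proof (rule Lim_null_comparison)
    show "eventually (\<lambda>S. norm (integral {-S..S} (\<lambda>\<sigma>. f (Complex 0 \<sigma>)) - integral {-S..S} (airy_kernel t)) \<le> 2 * (E / S\<^sup>2)) at_top"
      using eventually_gt_at_top[of 0] by eventually_elim (rule shift)
    have "((\<lambda>S::real. E / S\<^sup>2) \<longlongrightarrow> 0) at_top"
      by (intro tendsto_divide_0[OF tendsto_const] filterlim_at_top_imp_at_infinity filterlim_pow_at_top filterlim_ident) auto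
    from tendsto_mult_left[OF this, of 2] show "((\<lambda>S. 2 * (E / S\<^sup>2)) \<longlongrightarrow> 0) at_top" by simp
  qed
  from tendsto_add[OF this integral_symmetric_tendsto[OF airy_moment_1_integrable[of t]]]
  have "((\<lambda>S. integral {-S..S} (\<lambda>\<sigma>. f (Complex 0 \<sigma>))) \<longlongrightarrow> (LINT \<sigma>|lborel. airy_kernel t \<sigma>)) at_top"
    by simp
  from tendsto_mult_left[OF tendsto_Re[OF this], of "1 / 2"]
  have "((\<lambda>S. 1 / 2 * Re (integral {-S..S} (\<lambda>\<sigma>. f (Complex 0 \<sigma>)))) \<longlongrightarrow> pi * airy_fun t) at_top"
    by (simp add: airy_fun_def airy_moment_def)
  moreover have "eventually (\<lambda>S. 1 / 2 * Re (integral {-S..S} (\<lambda>\<sigma>. f (Complex 0 \<sigma>))) =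
      integral {0..S} (\<lambda>s. cos (s ^ 3 / 3 + t * s))) at_top"
    using eventually_ge_at_top[of 0]
  proof eventually_elim
    case (elim S)
    define u where "u = (\<lambda>s::real. cos (s ^ 3 / 3 + t * s))"
    have cu: "u integrable_on {p..q}" for p q
      unfolding u_def by (intro integrable_continuous_interval continuous_intros) auto
    have Ref: "Re (f (Complex 0 \<sigma>)) = u \<sigma>" for \<sigma>
    proof -
      have eq: "Complex 0 \<sigma> ^ 3 / 3 - of_real t * Complex 0 \<sigma> = Complex 0 (- (\<sigma> ^ 3 / 3 + t * \<sigma>))"
        by (simp add: complex_eq_iff power3_eq_cube)
      show ?thesis unfolding f_def u_def Re_exp eq complex.sel cos_minus by simp
    qed
    have "(\<lambda>\<sigma>. f (Complex 0 \<sigma>)) integrable_on {-S..S}"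
      unfolding Complex_eq
      by (intro integrable_continuous_interval continuous_on_compose2[OF contf] continuous_intros) auto
    from integral_linear[OF this bounded_linear_Re]
    have "Re (integral {-S..S} (\<lambda>\<sigma>. f (Complex 0 \<sigma>))) = integral {-S..S} u"
      by (simp add: o_def Ref)
    also have "\<dots> = integral {-S..0} u + integral {0..S} u"
      using elim cu by (intro Henstock_Kurzweil_Integration.integral_combine[symmetric]) auto
    \<comment> \<open>Here \<open>u\<close> is even because cosine is; \<open>-0\<close> gives the
      interval the shape of the reflection rule.\<close>
    also have "integral {-S..0} u = integral {-S..-0} (\<lambda>s. u (- s))"
      unfolding u_def by (simp add: cos_minus[of "_ + _", symmetric] del: cos_minus)
    also have "\<dots> = integral {0..S} u"
      by (rule Henstock_Kurzweil_Integration.integral_reflect_real)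
    finally show ?case by (simp add: u_def)
  qed
  ultimately have "((\<lambda>S. integral {0..S} (\<lambda>s. cos (s ^ 3 / 3 + t * s))) \<longlongrightarrow> pi * airy_fun t) at_top"
    by (rule Lim_transform_eventually)
  hence "Lim at_top (\<lambda>S. integral {0..S} (\<lambda>s. cos (s ^ 3 / 3 + t * s))) = pi * airy_fun t"
    by (intro tendsto_Lim) auto
  thus ?thesis by (simp add: airy_Ai_def)
qed

text \<open>Majorant for the range \<open>|\<sigma>| \<ge> S\<close> in the next lemma, where
  \<open>\<sigma>\<^sup>2 - S\<^sup>2 \<ge> S * (|\<sigma>| - S)\<close>; the reflected copy serves
  negative \<open>\<sigma>\<close>.\<close>

lemma exp_tail_integral:
  assumes S: "S > 0"
  defines "u \<equiv> \<lambda>\<sigma>::real. indicator {S..} \<sigma> * exp (- S * (\<sigma> - S))"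
  shows "integrable lborel u" "integral\<^sup>L lborel u = 1 / S"
    "integrable lborel (\<lambda>\<sigma>. u (- \<sigma>))" "(LINT \<sigma>|lborel. u (- \<sigma>)) = 1 / S"
proof -
  have "((\<lambda>\<sigma>. exp (S * S) * exp (- S * \<sigma>)) has_integral exp (S * S) * (exp (- S * S) / S)) {S..}"
    by (rule has_integral_mult_right[OF has_integral_exp_minus_to_infinity[OF S]])
  hence "((\<lambda>\<sigma>. if \<sigma> \<in> {S..} then exp (S * S) * exp (- S * \<sigma>) else 0) has_integral exp (S * S) * (exp (- S * S) / S)) UNIV"
    by (simp only: has_integral_restrict_UNIV)
  also have "(\<lambda>\<sigma>. if \<sigma> \<in> {S..} then exp (S * S) * exp (- S * \<sigma>) else 0) = u"
    by (auto simp: u_def fun_eq_iff indicator_def algebra_simps simp flip: exp_add)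
  also have "exp (S * S) * (exp (- S * S) / S) = 1 / S"
    by (simp add: exp_minus)
  finally have hi: "(u has_integral 1 / S) UNIV" .
  have [measurable]: "u \<in> borel_measurable borel" unfolding u_def by measurable
  have nn: "0 \<le> u \<sigma>" for \<sigma> by (simp add: u_def)
  have "integral\<^sup>N lborel u = ennreal (1 / S)"
    by (rule nn_integral_has_integral_lborel[OF _ nn hi]) measurable
  hence hb: "has_bochner_integral lborel u (1 / S)"
    using S nn by (intro has_bochner_integral_nn_integral) auto
  thus "integrable lborel u" "integral\<^sup>L lborel u = 1 / S"
    by (auto simp: has_bochner_integral_iff)
  have hb': "has_bochner_integral lborel (\<lambda>\<sigma>. u (- \<sigma>)) (1 / S)"
    using lborel_has_bochner_integral_real_affine_iff[of "-1" u "1 / S" 0] hb by simp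
  thus "integrable lborel (\<lambda>\<sigma>. u (- \<sigma>))" "(LINT \<sigma>|lborel. u (- \<sigma>)) = 1 / S"
    by (auto simp: has_bochner_integral_iff)
qed

text \<open>On the line with real part 1 the exponential is small for large imaginary part only, on the
  line with real part -1 for small imaginary part only; the switch at the saddle points
  costs the residue at 0.\<close>

lemma airy_tail_near_one:
  assumes S: "S > 0"
  shows "\<bar>airy_tail (- S\<^sup>2) - 1\<bar> \<le> 14 / S"
proof -
  define f where "f = (\<lambda>z::complex. exp (z ^ 3 / 3 - of_real (- S\<^sup>2) * z) / (z - 0))"
  define g where "g = (\<lambda>\<sigma>. inverse (Complex 1 \<sigma>) * airy_kernel (- S\<^sup>2) \<sigma>)"
  have fg: "(\<lambda>\<sigma>. f (Complex 1 \<sigma>)) = g"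
    unfolding f_def g_def airy_kernel_def by (rule ext) (simp only: divide_inverse mult.commute diff_zero)
  have b: "norm (inverse (Complex 1 \<sigma>)) \<le> norm (Complex 1 \<sigma>) ^ 2" for \<sigma>
    using norm_inverse_Complex_1[of \<sigma>] norm_Complex_1(1)[of \<sigma>] zero_le_power2[of \<sigma>] by linarith
  have gi: "integrable lborel g"
    unfolding g_def by (rule airy_integrable[OF inverse_Complex_measurable b])
  have e2: "exp (1 / 3) \<le> (2::real)"
    using exp_bound[of "1 / 3"] by (simp add: power2_eq_square)
  have norm_f: "norm (f (Complex y c)) = exp (y ^ 3 / 3 - y * c\<^sup>2 + S\<^sup>2 * y) / norm (Complex y c)" for y c
    using Re_airy_exponent[of y c "- S\<^sup>2"] by (simp add: f_def norm_divide norm_exp_eq_Re)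
  \<comment> \<open>The corners lie at the heights of the saddle points \<open>+- i S\<close> of
    \<open>z^3 / 3 + S^2 z\<close>; the residue 1 at 0 contributes \<open>2 * pi\<close>.\<close>
  have rect: "norm (integral {-S..S} g - integral {-S..S} (\<lambda>\<sigma>. f (Complex (-1) \<sigma>)) - 2 * of_real pi) \<le> 2 * (4 / S)"
  proof -
    let ?R = "rectpath (Complex (-1) (- S)) (Complex 1 S)"
    have box: "0 \<in> box (Complex (-1) (- S)) (Complex 1 S)" using S by (simp add: in_box_complex_iff)
    hence off: "0 \<notin> path_image ?R" using S by (subst path_image_rectpath_cbox_minus_box) auto
    have "(f has_contour_integral (2 * pi * \<i> * winding_number ?R 0 * exp (0 ^ 3 / 3 - of_real (- S\<^sup>2) * 0))) ?R"
      unfolding f_def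
      by (rule Cauchy_integral_formula_convex_simple[where S = UNIV])
         (use off in \<open>auto intro!: holomorphic_intros\<close>)
    hence I: "(f has_contour_integral (of_real (2 * pi) * \<i>)) ?R"
      using winding_number_rectpath[OF box] by simp
    have cont: "continuous_on (path_image ?R) f"
      unfolding f_def using off by (intro continuous_intros) auto
    \<comment> \<open>At height \<open>\<bar>c\<bar> = S\<close> the terms
      \<open>- y * c\<^sup>2\<close> and \<open>S\<^sup>2 * y\<close> cancel, leaving
      \<open>exp (y ^ 3 / 3) \<le> 2\<close>. The side has length 2, hence
      \<open>4 / S\<close>.\<close>
    have side: "norm (contour_integral (linepath (Complex (-1) c) (Complex 1 c)) f) \<le> 4 / S" if "\<bar>c\<bar> = S" for c
    proof -
      have seg: "Im z = c \<and> -1 \<le> Re z \<and> Re z \<le> 1" if "z \<in> closed_segment (Complex (-1) c) (Complex 1 c)" for z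
        using that by (auto simp: closed_segment_same_Im closed_segment_eq_real_ivl)
      have nz: "z \<noteq> 0" if "z \<in> closed_segment (Complex (-1) c) (Complex 1 c)" for z
        using seg[OF that] S \<open>\<bar>c\<bar> = S\<close> by auto
      have "norm (contour_integral (linepath (Complex (-1) c) (Complex 1 c)) f) \<le> 2 / S * norm (Complex 1 c - Complex (-1) c)"
      proof (rule contour_integral_bound_linepath)
        show "f contour_integrable_on linepath (Complex (-1) c) (Complex 1 c)"
          unfolding f_def using nz by (intro contour_integrable_continuous_linepath continuous_intros) auto
        fix z assume z: "z \<in> closed_segment (Complex (-1) c) (Complex 1 c)"
        obtain y where y: "z = Complex y c" "y \<le> 1" using seg[OF z] by (metis complex_surj)
        have cS: "c\<^sup>2 = S\<^sup>2" using \<open>\<bar>c\<bar> = S\<close> by (metis power2_abs)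
        have "y ^ 3 \<le> 1" using power_mono_odd[of 3 y 1] y by simp
        hence "exp (y ^ 3 / 3 - y * c\<^sup>2 + S\<^sup>2 * y) \<le> exp (1 / 3)" unfolding cS by simp
        hence "exp (y ^ 3 / 3 - y * c\<^sup>2 + S\<^sup>2 * y) \<le> 2" using e2 by linarith
        moreover have "S \<le> norm (Complex y c)" using abs_Im_le_cmod[of "Complex y c"] \<open>\<bar>c\<bar> = S\<close> by simp
        ultimately show "norm (f z) \<le> 2 / S"
          unfolding y(1) norm_f using S by (intro frac_le) auto
      qed (use S in auto)
      also have "Complex 1 c - Complex (-1) c = 2" by (simp add: complex_eq_iff)
      finally show ?thesis by simp
    qed
    have pi: "of_real (2 * pi) * \<i> / \<i> = 2 * of_real pi" by simp
    show ?thesis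
      using rectangle_shift[OF _ S cont I side side] S unfolding fg pi by simp
  qed
  \<comment> \<open>Here the exponent is at most
    \<open>S * \<bar>\<sigma>\<bar> - S\<^sup>2\<close>; a sum of two exponentials replaces the
    absolute value and is integrated explicitly.\<close>
  have left: "norm (integral {-S..S} (\<lambda>\<sigma>. f (Complex (-1) \<sigma>))) \<le> 2 / S"
  proof -
    have "norm (integral {-S..S} (\<lambda>\<sigma>. f (Complex (-1) \<sigma>)))
       \<le> integral {-S..S} (\<lambda>\<sigma>. exp (- S\<^sup>2) * (exp (- (- S * \<sigma>)) + exp (- (S * \<sigma>))))"
    proof (rule integral_norm_bound_integral)
      show "(\<lambda>\<sigma>. f (Complex (-1) \<sigma>)) integrable_on {-S..S}"
        unfolding f_def Complex_eq
        by (intro integrable_continuous_interval continuous_intros) (auto simp: complex_eq_iff)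
      show "(\<lambda>\<sigma>. exp (- S\<^sup>2) * (exp (- (- S * \<sigma>)) + exp (- (S * \<sigma>)))) integrable_on {-S..S}"
        by (intro integrable_continuous_interval continuous_intros)
      fix \<sigma> assume \<sigma>: "\<sigma> \<in> {-S..S}"
      have "\<bar>\<sigma>\<bar> * \<bar>\<sigma>\<bar> \<le> S * \<bar>\<sigma>\<bar>" using \<sigma> by (intro mult_right_mono) auto
      hence "\<sigma>\<^sup>2 \<le> S * \<bar>\<sigma>\<bar>" by (simp add: power2_eq_square)
      have "norm (f (Complex (-1) \<sigma>)) \<le> exp ((-1) ^ 3 / 3 - (-1) * \<sigma>\<^sup>2 + S\<^sup>2 * (-1)) / 1"
        unfolding norm_f using abs_Re_le_cmod[of "Complex (-1) \<sigma>"] by (intro divide_left_mono) auto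
      also have "\<dots> \<le> exp (- S\<^sup>2) * exp (S * \<bar>\<sigma>\<bar>)"
        unfolding exp_add[symmetric] using \<open>\<sigma>\<^sup>2 \<le> S * \<bar>\<sigma>\<bar>\<close> by simp
      also have "\<dots> \<le> exp (- S\<^sup>2) * (exp (- (- S * \<sigma>)) + exp (- (S * \<sigma>)))"
        by (intro mult_left_mono) (auto simp: abs_if)
      finally show "norm (f (Complex (-1) \<sigma>)) \<le> exp (- S\<^sup>2) * (exp (- (- S * \<sigma>)) + exp (- (S * \<sigma>)))" .
    qed
    also have "\<dots> = exp (- S\<^sup>2) * ((exp (S * - S) - exp (S * S)) / (- S) + (exp (- (S * - S)) - exp (- (S * S))) / S)"
      using S by (intro integral_unique has_integral_mult_right has_integral_add)
        (use has_integral_exp_decay[of "- S" "- S" S] has_integral_exp_decay[of S "- S" S] in auto)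
    also have "\<dots> \<le> 2 / S"
    proof -
      define E1 where "E1 = exp (S * S)"
      define E2 where "E2 = exp (- (S * S))"
      have E: "E1 * E2 = 1" by (simp add: E1_def E2_def exp_minus)
      have "E2 * ((E2 - E1) / (- S) + (E1 - E2) / S) = 2 / S * (E1 * E2 - E2 * E2)"
        using S by (simp add: field_simps)
      also have "\<dots> \<le> 2 / S * 1"
        unfolding E using S by (intro mult_left_mono) auto
      finally show ?thesis by (simp add: E1_def E2_def power2_eq_square)
    qed
    finally show ?thesis .
  qed
  have tail: "norm ((LINT \<sigma>|lborel. g \<sigma>) - integral {-S..S} g) \<le> 4 / S"
  proof -
    have si: "set_integrable lborel {-S..S} g"
      using gi unfolding set_integrable_def by (rule integrable_mult_indicator[rotated]) auto
    define u where "u = (\<lambda>\<sigma>::real. indicator {S..} \<sigma> * exp (- S * (\<sigma> - S)))"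
    have u: "integrable lborel u" "integral\<^sup>L lborel u = 1 / S"
      "integrable lborel (\<lambda>\<sigma>. u (- \<sigma>))" "(LINT \<sigma>|lborel. u (- \<sigma>)) = 1 / S"
      unfolding u_def by (rule exp_tail_integral[OF S])+
    have "(LINT \<sigma>|lborel. g \<sigma>) - integral {-S..S} g = (LINT \<sigma>|lborel. g \<sigma> - indicator {-S..S} \<sigma> *\<^sub>R g \<sigma>)"
      using gi si set_borel_integral_eq_integral(2)[OF si]
      by (simp add: set_lebesgue_integral_def set_integrable_def)
    also have "norm \<dots> \<le> (LINT \<sigma>|lborel. 2 * (u \<sigma> + u (- \<sigma>)))"
    proof (rule Bochner_Integration.integral_norm_bound_integral)
      show "integrable lborel (\<lambda>\<sigma>. g \<sigma> - indicator {-S..S} \<sigma> *\<^sub>R g \<sigma>)"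
        using gi si by (simp add: set_integrable_def)
      show "integrable lborel (\<lambda>\<sigma>. 2 * (u \<sigma> + u (- \<sigma>)))"
        by (intro integrable_mult_right Bochner_Integration.integrable_add u)
      fix \<sigma> :: real
      have u0: "0 \<le> u \<sigma>" "0 \<le> u (- \<sigma>)" by (auto simp: u_def)
      show "norm (g \<sigma> - indicator {-S..S} \<sigma> *\<^sub>R g \<sigma>) \<le> 2 * (u \<sigma> + u (- \<sigma>))"
      proof (cases "\<sigma> \<in> {-S..S}")
        case False
        hence \<sigma>: "\<bar>\<sigma>\<bar> \<ge> S" by auto
        have "norm (g \<sigma>) \<le> 1 * exp (1 / 3 - \<sigma>\<^sup>2 + S\<^sup>2)"
          unfolding g_def norm_mult norm_airy_kernel using norm_inverse_Complex_1[of \<sigma>] by (intro mult_mono) auto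
        also have "\<dots> = exp (1 / 3) * exp (- (\<sigma>\<^sup>2 - S\<^sup>2))" by (simp flip: exp_add)
        also have "\<dots> \<le> 2 * exp (- S * (\<bar>\<sigma>\<bar> - S))"
        proof (intro mult_mono e2)
          have "S * (\<bar>\<sigma>\<bar> - S) \<le> (\<bar>\<sigma>\<bar> + S) * (\<bar>\<sigma>\<bar> - S)" using \<sigma> S by (intro mult_right_mono) auto
          also have "\<dots> = \<sigma>\<^sup>2 - S\<^sup>2" by (simp add: power2_eq_square algebra_simps)
          finally show "exp (- (\<sigma>\<^sup>2 - S\<^sup>2)) \<le> exp (- S * (\<bar>\<sigma>\<bar> - S))" by simp
        qed auto
        also have "exp (- S * (\<bar>\<sigma>\<bar> - S)) \<le> u \<sigma> + u (- \<sigma>)"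
          using \<sigma> S by (auto simp: u_def abs_if)
        finally show ?thesis using False by simp
      qed (use u0 in auto)
    qed
    also have "\<dots> = 2 * (1 / S + 1 / S)"
      by (simp only: integral_mult_right_zero Bochner_Integration.integral_add[OF u(1,3)] u(2,4))
    finally show ?thesis by simp
  qed
  define G where "G = (LINT \<sigma>|lborel. g \<sigma>)"
  have "norm (G - 2 * of_real pi) \<le> 4 / S + 8 / S + 2 / S"
  proof -
    have "G - 2 * of_real pi = (G - integral {-S..S} g)
       + (integral {-S..S} g - integral {-S..S} (\<lambda>\<sigma>. f (Complex (-1) \<sigma>)) - 2 * of_real pi)
       + integral {-S..S} (\<lambda>\<sigma>. f (Complex (-1) \<sigma>))" by simp
    also have "norm \<dots> \<le> 4 / S + 8 / S + 2 / S"
      using tail rect left unfolding G_def[symmetric] by (intro norm_triangle_mono) simp_all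
    finally show ?thesis .
  qed
  hence G: "norm (G - 2 * of_real pi) \<le> 14 / S" by simp
  have "airy_moment (\<lambda>\<sigma>. inverse (Complex 1 \<sigma>)) (- S\<^sup>2) = G / of_real (2 * pi)"
    by (simp add: airy_moment_def G_def g_def)
  hence "airy_tail (- S\<^sup>2) = Re G / (2 * pi)"
    unfolding airy_tail_def by (simp only: Re_divide_of_real)
  hence "airy_tail (- S\<^sup>2) - 1 = Re (G - 2 * of_real pi) / (2 * pi)"
    by (simp add: diff_divide_distrib)
  hence "\<bar>airy_tail (- S\<^sup>2) - 1\<bar> = \<bar>Re (G - 2 * of_real pi)\<bar> / (2 * pi)" by simp
  also have "\<dots> \<le> (14 / S) / 1"
    using abs_Re_le_cmod[of "G - 2 * of_real pi"] G pi_gt3 S by (intro frac_le) auto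
  finally show ?thesis by simp
qed

lemma airy_tail_at_bot: "(airy_tail \<longlongrightarrow> 1) at_bot"
proof -
  have "((\<lambda>t. airy_tail t - 1) \<longlongrightarrow> 0) at_bot"
  proof (rule Lim_null_comparison)
    show "eventually (\<lambda>t. norm (airy_tail t - 1) \<le> 14 / sqrt (- t)) at_bot"
      using eventually_le_at_bot[of "-1"]
    proof eventually_elim
      case (elim t)
      thus ?case using airy_tail_near_one[of "sqrt (- t)"] by simp
    qed
    have "filterlim (\<lambda>t::real. sqrt (- t)) at_top at_bot"
      by (rule filterlim_compose[OF sqrt_at_top filterlim_uminus_at_top_at_bot])
    thus "((\<lambda>t. 14 / sqrt (- t)) \<longlongrightarrow> 0) at_bot"
      by (intro tendsto_divide_0[OF tendsto_const] filterlim_at_top_imp_at_infinity)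
  qed
  thus ?thesis by (simp add: LIM_zero_iff)
qed


lemma fock_kernel_continuous:
  assumes "d > 0"
  shows "continuous_on A (\<lambda>\<sigma>. of_real d * fock_kernel n x (of_real d * Complex 1 \<sigma>))"
  unfolding fock_kernel_def
  using sinh_cosh_nonzero[of "of_real d * Complex 1 _"] assms
  by (intro continuous_intros) auto

text \<open>Outside the segment the Fock integrand is extended by 0, so the pointwise kernel bound
  can be integrated over the whole line. The \<open>+ 1\<close> in the constant secures
  \<open>C > 0\<close> from \<open>J \<ge> 0\<close>.\<close>

theorem fock_tail_airy_approx:
  assumes "M \<ge> 0"
  obtains C where "C > 0" "\<And>n d t. \<lbrakk>0 < d; d \<le> 1; real (2 * n + 1) * d ^ 3 = 1; 2 * M * d\<^sup>2 \<le> 1; \<bar>t\<bar> \<le> M\<rbrakk>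
     \<Longrightarrow> \<bar>fock_tail n (real (2 * n + 1) + t / d) - airy_tail t\<bar> \<le> C * d\<^sup>2"
proof -
  define J where "J = (LINT \<sigma>|lborel. 1 / (1 + (\<sigma>::real)\<^sup>2))"
  have J: "J \<ge> 0" unfolding J_def by (intro Bochner_Integration.integral_nonneg) auto
  define K where "K = (M + 8) * exp (1 / 3 + M) * (3 * 192 ^ 4)"
  have K: "K > 0" using assms by (simp add: K_def)
  show thesis
  proof (rule that[of "K * J / (2 * pi) + 1"])
    show "K * J / (2 * pi) + 1 > 0" using K J by (intro add_nonneg_pos divide_nonneg_pos mult_nonneg_nonneg) auto
    fix n :: nat and d t :: real
    assume a: "0 < d" "d \<le> 1" "real (2 * n + 1) * d ^ 3 = 1" "2 * M * d\<^sup>2 \<le> 1" "\<bar>t\<bar> \<le> M"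
    define x where "x = real (2 * n + 1) + t / d"
    let ?I = "{- (pi / (2 * d))..pi / (2 * d)}"
    define k where "k = (\<lambda>\<sigma>. of_real d * fock_kernel n x (of_real d * Complex 1 \<sigma>))"
    have si: "set_integrable lborel ?I k"
      unfolding k_def by (rule borel_integrable_atLeastAtMost'[OF fock_kernel_continuous[OF a(1)]])
    have kI: "(LINT \<sigma>|lborel. indicator ?I \<sigma> *\<^sub>R k \<sigma>) = 2 * of_real pi * of_real (fock_tail n x)"
      unfolding k_def
      by (rule trans[OF set_borel_integral_eq_integral(2)[OF si, unfolded set_lebesgue_integral_def k_def]
            integral_unique[OF fock_tail_contour[OF a(1)]]])
    have b: "norm (inverse (Complex 1 \<sigma>)) \<le> norm (Complex 1 \<sigma>) ^ 2" for \<sigma>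
      using norm_inverse_Complex_1[of \<sigma>] norm_Complex_1(1)[of \<sigma>] zero_le_power2[of \<sigma>] by linarith
    note ai = airy_integrable[OF inverse_Complex_measurable b, of t]
    have "2 * of_real pi * (of_real (fock_tail n x) - airy_moment (\<lambda>\<sigma>. inverse (Complex 1 \<sigma>)) t)
      = (LINT \<sigma>|lborel. indicator ?I \<sigma> *\<^sub>R k \<sigma>) - (LINT \<sigma>|lborel. inverse (Complex 1 \<sigma>) * airy_kernel t \<sigma>)"
      unfolding kI by (simp add: airy_moment_def field_simps)
    also have "\<dots> = (LINT \<sigma>|lborel. indicator ?I \<sigma> *\<^sub>R k \<sigma> - inverse (Complex 1 \<sigma>) * airy_kernel t \<sigma>)"
      using si ai by (simp add: set_integrable_def)
    also have "norm \<dots> \<le> (LINT \<sigma>|lborel. d\<^sup>2 * K * (1 / (1 + (\<sigma>::real)\<^sup>2)))"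
    proof (rule Bochner_Integration.integral_norm_bound_integral)
      show "integrable lborel (\<lambda>\<sigma>. indicator ?I \<sigma> *\<^sub>R k \<sigma> - inverse (Complex 1 \<sigma>) * airy_kernel t \<sigma>)"
        using si ai by (simp add: set_integrable_def)
      show "integrable lborel (\<lambda>\<sigma>::real. d\<^sup>2 * K * (1 / (1 + \<sigma>\<^sup>2)))"
        by (rule integrable_mult_right[OF integrable_inverse_one_plus_square])
      fix \<sigma> :: real
      have "norm (indicator ?I \<sigma> *\<^sub>R k \<sigma> - airy_kernel t \<sigma> / Complex 1 \<sigma>)
        \<le> d\<^sup>2 * (M + 8) * (1 + \<sigma>\<^sup>2) ^ 3 * exp (1 / 3 + M - \<sigma>\<^sup>2 / 48)"
        unfolding k_def by (rule kernel_difference_bound[OF a(1,2,3,5,4) x_def])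
      also have "\<dots> = d\<^sup>2 * (M + 8) * exp (1 / 3 + M) * ((1 + \<sigma>\<^sup>2) ^ 3 * exp (- \<sigma>\<^sup>2 / 48))"
      proof -
        have "exp (1 / 3 + M - \<sigma>\<^sup>2 / 48) = exp (1 / 3 + M) * exp (- \<sigma>\<^sup>2 / 48)"
          by (simp flip: exp_add)
        thus ?thesis by simp
      qed
      also have "\<dots> \<le> d\<^sup>2 * (M + 8) * exp (1 / 3 + M) * (3 * 192 ^ 4 / (1 + \<sigma>\<^sup>2))"
        using assms by (intro mult_left_mono gaussian_moment_bound) auto
      also have "\<dots> = d\<^sup>2 * K * (1 / (1 + \<sigma>\<^sup>2))" by (simp add: K_def del: power_numeral)
      also have "airy_kernel t \<sigma> / Complex 1 \<sigma> = inverse (Complex 1 \<sigma>) * airy_kernel t \<sigma>"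
        by (simp add: divide_inverse mult.commute)
      finally show "norm (indicator ?I \<sigma> *\<^sub>R k \<sigma> - inverse (Complex 1 \<sigma>) * airy_kernel t \<sigma>) \<le> d\<^sup>2 * K * (1 / (1 + \<sigma>\<^sup>2))" .
    qed
    also have "\<dots> = d\<^sup>2 * K * J" unfolding J_def by (rule integral_mult_right_zero)
    finally have "2 * pi * norm (of_real (fock_tail n x) - airy_moment (\<lambda>\<sigma>. inverse (Complex 1 \<sigma>)) t) \<le> d\<^sup>2 * K * J"
      by (simp add: norm_mult)
    hence "norm (of_real (fock_tail n x) - airy_moment (\<lambda>\<sigma>. inverse (Complex 1 \<sigma>)) t) \<le> K * J / (2 * pi) * d\<^sup>2"
      by (simp add: field_simps)
    moreover have "\<bar>fock_tail n x - airy_tail t\<bar> \<le> norm (of_real (fock_tail n x) - airy_moment (\<lambda>\<sigma>. inverse (Complex 1 \<sigma>)) t)"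
      using abs_Re_le_cmod[of "of_real (fock_tail n x) - airy_moment (\<lambda>\<sigma>. inverse (Complex 1 \<sigma>)) t"]
      by (simp add: airy_tail_def)
    ultimately show "\<bar>fock_tail n (real (2 * n + 1) + t / d) - airy_tail t\<bar> \<le> (K * J / (2 * pi) + 1) * d\<^sup>2"
      unfolding x_def[symmetric] distrib_right using zero_le_power2[of d] by linarith
  qed
qed

subsection \<open>The Airy function and its integral\<close>

text \<open>The total integral of Ai is 1, by the limit of \<open>airy_tail\<close> at minus
  infinity.\<close>

lemma airy_Ai_integral_eq: "airy_Ai_integral t = 1 - airy_tail t"
proof -
  have "airy_Ai = airy_fun" by (rule ext) (rule airy_Ai_eq)
  have int: "integral {a..t} airy_Ai = airy_tail a - airy_tail t" if "a \<le> t" for a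
  proof (rule integral_unique)
    have "(airy_fun has_integral (- airy_tail t - - airy_tail a)) {a..t}"
      using that
    proof (rule fundamental_theorem_of_calculus)
      fix x
      have "((\<lambda>t. - airy_tail t) has_real_derivative airy_fun x) (at x)"
        using DERIV_minus[OF DERIV_airy_tail[of x]] by simp
      thus "((\<lambda>t. - airy_tail t) has_vector_derivative airy_fun x) (at x within {a..t})"
        by (simp add: has_real_derivative_iff_has_vector_derivative has_vector_derivative_at_within)
    qed
    thus "(airy_Ai has_integral (airy_tail a - airy_tail t)) {a..t}"
      by (simp add: \<open>airy_Ai = airy_fun\<close>)
  qed
  have "((\<lambda>a. airy_tail a - airy_tail t) \<longlongrightarrow> 1 - airy_tail t) at_bot"
    by (intro tendsto_intros airy_tail_at_bot)
  moreover have "eventually (\<lambda>a. airy_tail a - airy_tail t = integral {a..t} airy_Ai) at_bot"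
    using eventually_le_at_bot[of t] by eventually_elim (simp add: int)
  ultimately have "((\<lambda>a. integral {a..t} airy_Ai) \<longlongrightarrow> 1 - airy_tail t) at_bot"
    by (rule Lim_transform_eventually)
  thus ?thesis unfolding airy_Ai_integral_def by (intro tendsto_Lim) auto
qed

lemma airy_continuous:
  "continuous_on S airy_tail" "continuous_on S airy_fun" "continuous_on S airy_slope"
  using DERIV_airy_tail DERIV_airy_fun DERIV_airy_slope
  by (auto intro!: continuous_at_imp_continuous_on intro: DERIV_isCont)

section \<open>Nondegeneracy and behaviour at minus infinity\<close>

lemma limit_at_bot_le:
  fixes f :: "real \<Rightarrow> real"
  assumes "\<And>x. x \<le> b \<Longrightarrow> (f has_real_derivative f' x) (at x)" "\<And>x. x \<le> b \<Longrightarrow> f' x \<ge> 0"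
    and "(f \<longlongrightarrow> L) at_bot"
  shows "L \<le> f b"
proof (rule tendsto_upperbound[OF assms(3)])
  show "eventually (\<lambda>x. f x \<le> f b) at_bot"
    using eventually_le_at_bot[of b]
  proof eventually_elim
    case (elim x)
    thus ?case by (rule DERIV_nonneg_imp_nondecreasing) (use assms in blast)
  qed
qed simp

text \<open>Gronwall argument for Airy's equation: \<open>q' = 2 * Ai * Ai' * (1 + t)\<close> is at
  most \<open>M * q\<close> in modulus between \<open>b\<close> and \<open>t\<close>, so a common
  zero at \<open>b\<close> makes \<open>q\<close> vanish everywhere. Then \<open>airy_tail\<close>
  would be constant, against its limits 1 and 0.\<close>

lemma airy_nondegenerate: "airy_fun b \<noteq> 0 \<or> airy_slope b \<noteq> 0"
proof (rule ccontr)
  assume "\<not> ?thesis"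
  hence b: "airy_fun b = 0" "airy_slope b = 0" by auto
  define q where "q = (\<lambda>t. airy_fun t ^ 2 + airy_slope t ^ 2)"
  define q' where "q' = (\<lambda>t. 2 * (airy_fun t * airy_slope t) * (1 + t))"
  have qd: "(q has_real_derivative q' t) (at t)" for t
    unfolding q_def q'_def
    by (auto intro!: derivative_eq_intros DERIV_airy_fun DERIV_airy_slope simp: algebra_simps)
  have q0: "q t \<ge> 0" "q b = 0" for t by (auto simp: q_def b)
  have zero: "airy_fun t = 0" for t
  proof -
    define M where "M = 1 + max \<bar>t\<bar> \<bar>b\<bar>"
    have bd: "\<bar>q' s\<bar> \<le> M * q s" if "min t b \<le> s" "s \<le> max t b" for s
    proof -
      have "\<bar>1 + s\<bar> \<le> M" using that by (auto simp: M_def abs_if max_def min_def split: if_splits)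
      moreover have "\<bar>2 * (airy_fun s * airy_slope s)\<bar> \<le> q s"
        using zero_le_power2[of "airy_fun s - airy_slope s"] zero_le_power2[of "airy_fun s + airy_slope s"]
        by (simp add: q_def power2_sum power2_diff abs_le_iff)
      ultimately have "\<bar>2 * (airy_fun s * airy_slope s)\<bar> * \<bar>1 + s\<bar> \<le> q s * M"
        using q0 by (intro mult_mono) auto
      thus ?thesis by (simp add: q'_def abs_mult mult.commute)
    qed
    have "q t \<le> 0"
    proof (cases "b \<le> t")
      case True
      have "q t * exp (- M * t) \<le> q b * exp (- M * b)"
      proof (rule DERIV_nonpos_imp_nonincreasing[OF True])
        fix s assume s: "b \<le> s" "s \<le> t"
        have "((\<lambda>t. q t * exp (- M * t)) has_real_derivative (q' s - M * q s) * exp (- M * s)) (at s)"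
          by (auto intro!: derivative_eq_intros qd simp: algebra_simps)
        moreover have "(q' s - M * q s) * exp (- M * s) \<le> 0"
          using bd[of s] s by (intro mult_nonpos_nonneg) auto
        ultimately show "\<exists>y. ((\<lambda>t. q t * exp (- M * t)) has_real_derivative y) (at s) \<and> y \<le> 0" by blast
      qed
      thus ?thesis by (simp add: q0 mult_le_0_iff)
    next
      case False
      hence tb: "t \<le> b" by simp
      have "q t * exp (M * t) \<le> q b * exp (M * b)"
      proof (rule DERIV_nonneg_imp_nondecreasing[OF tb])
        fix s assume s: "t \<le> s" "s \<le> b"
        have "((\<lambda>t. q t * exp (M * t)) has_real_derivative (q' s + M * q s) * exp (M * s)) (at s)"
          by (auto intro!: derivative_eq_intros qd simp: algebra_simps)
        moreover have "(q' s + M * q s) * exp (M * s) \<ge> 0"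
          using bd[of s] s by (intro mult_nonneg_nonneg) auto
        ultimately show "\<exists>y. ((\<lambda>t. q t * exp (M * t)) has_real_derivative y) (at s) \<and> 0 \<le> y" by blast
      qed
      thus ?thesis by (simp add: q0 mult_le_0_iff)
    qed
    hence "airy_fun t ^ 2 \<le> 0" unfolding q_def using zero_le_power2[of "airy_slope t"] by linarith
    thus ?thesis by simp
  qed
  have "airy_tail t = airy_tail 0" for t
    by (rule DERIV_isconst_all) (use DERIV_airy_tail zero in force)
  hence "airy_tail = (\<lambda>_. airy_tail 0)" by auto
  hence "((\<lambda>_. airy_tail 0) \<longlongrightarrow> 1) (at_bot :: real filter)" "((\<lambda>_. airy_tail 0) \<longlongrightarrow> 0) (at_top :: real filter)"
    using airy_tail_at_bot airy_tail_at_top by metis+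
  thus False by (simp add: tendsto_const_iff)
qed

text \<open>The energy \<open>E\<close> has derivative \<open>(Ai')^2 / t^2\<close>, since the mixed
  terms cancel by Airy's equation. For \<open>t \<le> -1\<close> both parts of \<open>E\<close> are
  nonnegative, hence bounded by \<open>E (-1)\<close>.\<close>

lemma airy_bounds_at_bot:
  obtains K where "K > 0" "\<And>t. t \<le> -1 \<Longrightarrow> \<bar>airy_fun t\<bar> \<le> K" "\<And>t. t \<le> -1 \<Longrightarrow> \<bar>airy_slope t / t\<bar> \<le> K / sqrt (- t)"
proof -
  define E where "E = (\<lambda>t. airy_fun t ^ 2 - airy_slope t ^ 2 / t)"
  define K where "K = sqrt (E (-1)) + 1"
  have le: "E t \<le> E (-1)" if "t \<le> -1" for t
  proof (rule DERIV_nonneg_imp_nondecreasing[OF that])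
    fix s :: real assume s: "t \<le> s" "s \<le> -1"
    have "(E has_real_derivative airy_slope s ^ 2 / s ^ 2) (at s)"
      unfolding E_def using s
      by (auto intro!: derivative_eq_intros DERIV_airy_fun DERIV_airy_slope simp: field_simps power2_eq_square)
    thus "\<exists>y. (E has_real_derivative y) (at s) \<and> 0 \<le> y" by force
  qed
  have E0: "0 \<le> E (-1)" by (simp add: E_def)
  have K: "K > 0" "E (-1) \<le> K\<^sup>2"
    using E0 by (auto simp: K_def power2_sum add_nonneg_pos)
  show thesis
  proof (rule that[of K])
    fix t :: real assume t: "t \<le> -1"
    have nn: "0 \<le> airy_slope t ^ 2 / (- t)" using t by (intro divide_nonneg_pos) auto
    have sum: "airy_fun t ^ 2 + airy_slope t ^ 2 / (- t) \<le> K\<^sup>2"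
      using le[OF t] K by (simp add: E_def)
    have "airy_fun t ^ 2 \<le> K\<^sup>2" using sum nn by linarith
    hence "\<bar>airy_fun t\<bar> \<le> \<bar>K\<bar>" by (simp only: abs_le_square_iff)
    thus "\<bar>airy_fun t\<bar> \<le> K" using K by linarith
    have "airy_slope t ^ 2 / (- t) \<le> K\<^sup>2" using sum zero_le_power2[of "airy_fun t"] by linarith
    hence "airy_slope t ^ 2 / (- t) / (- t) \<le> K\<^sup>2 / (- t)" using t by (intro divide_right_mono) auto
    hence "(airy_slope t / t) ^ 2 \<le> (K / sqrt (- t)) ^ 2"
      using t by (simp add: power_divide power2_eq_square)
    hence "\<bar>airy_slope t / t\<bar> \<le> \<bar>K / sqrt (- t)\<bar>" by (simp only: abs_le_square_iff)
    moreover have "0 \<le> K / sqrt (- t)" using K t by (intro divide_nonneg_nonneg) auto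
    ultimately show "\<bar>airy_slope t / t\<bar> \<le> K / sqrt (- t)" by linarith
  qed (use K in auto)
qed

text \<open>A functional that decreases along every solution of \<open>f''' = t f'\<close>.\<close>

definition airy_lyapunov :: "real \<Rightarrow> real" where
  "airy_lyapunov t = airy_slope t * (1 - airy_tail t) - (airy_fun t)\<^sup>2 / 2 - t * (1 - airy_tail t)\<^sup>2 / 2"

lemma DERIV_airy_lyapunov:
  "(airy_lyapunov has_real_derivative - (1 - airy_tail t)\<^sup>2 / 2) (at t)"
  unfolding airy_lyapunov_def
  by (auto intro!: derivative_eq_intros DERIV_airy_fun DERIV_airy_slope DERIV_airy_tail
      simp: field_simps power2_eq_square)

lemma airy_lyapunov_antimono: "s \<le> t \<Longrightarrow> airy_lyapunov t \<le> airy_lyapunov s"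
  by (rule DERIV_nonpos_imp_nonincreasing) (use DERIV_airy_lyapunov in force)+

text \<open>At minus infinity \<open>f = 1 - airy_tail\<close> is \<open>Ai' / t + r\<close> with
  \<open>r = O(1 / t^2)\<close>. Inserted into the functional, this leaves nonpositive terms and a
  multiple of \<open>t * r^2\<close>.\<close>

lemma airy_lyapunov_at_bot:
  obtains K where "\<And>t. t \<le> -1 \<Longrightarrow> airy_lyapunov t \<le> K / (- t)"
proof -
  obtain K where K: "K > 0" "\<And>t. t \<le> -1 \<Longrightarrow> \<bar>airy_fun t\<bar> \<le> K" "\<And>t. t \<le> -1 \<Longrightarrow> \<bar>airy_slope t / t\<bar> \<le> K / sqrt (- t)"
    using airy_bounds_at_bot by blast
  \<comment> \<open>Repeated integration by parts of \<open>Ai = Ai'' / t\<close> suggests the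
    subtracted terms; what remains has derivative \<open>2 * Ai / t^3\<close>.\<close>
  define \<rho> where "\<rho> = (\<lambda>t. 1 - airy_tail t - airy_slope t / t - airy_fun t / t\<^sup>2)"
  have \<rho>d: "(\<rho> has_real_derivative 2 * airy_fun t / t ^ 3) (at t)" if "t \<le> -1" for t
    unfolding \<rho>_def using that
    by (auto intro!: derivative_eq_intros DERIV_airy_fun DERIV_airy_slope DERIV_airy_tail
      simp: field_simps power2_eq_square power3_eq_cube)
  have kd: "((\<lambda>t. K / t\<^sup>2) has_real_derivative - 2 * K / t ^ 3) (at t)" if "t \<le> -1" for t
    using that by (auto intro!: derivative_eq_intros simp: field_simps power2_eq_square power3_eq_cube)
  have inv: "((\<lambda>t. c / t\<^sup>2) \<longlongrightarrow> 0) at_bot" for c :: real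
    by (intro tendsto_divide_0[OF tendsto_const] filterlim_at_top_imp_at_infinity filterlim_pow_at_bot_even filterlim_ident) auto
  have "(\<rho> \<longlongrightarrow> 1 - 1 - 0 - 0) at_bot"
    unfolding \<rho>_def
  proof (intro tendsto_diff tendsto_const airy_tail_at_bot)
    have "filterlim (\<lambda>t::real. sqrt (- t)) at_top at_bot"
      by (rule filterlim_compose[OF sqrt_at_top filterlim_uminus_at_top_at_bot])
    hence "((\<lambda>t. K / sqrt (- t)) \<longlongrightarrow> 0) at_bot"
      by (intro tendsto_divide_0[OF tendsto_const] filterlim_at_top_imp_at_infinity)
    thus "((\<lambda>t. airy_slope t / t) \<longlongrightarrow> 0) at_bot"
      by (rule Lim_null_comparison[OF eventually_mono[OF eventually_le_at_bot[of "-1"]], rotated])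
         (use K(3) in \<open>simp del: abs_divide\<close>)
    show "((\<lambda>t. airy_fun t / t\<^sup>2) \<longlongrightarrow> 0) at_bot"
    proof (rule Lim_null_comparison[OF _ inv[of K]])
      show "eventually (\<lambda>t. norm (airy_fun t / t\<^sup>2) \<le> K / t\<^sup>2) at_bot"
        using eventually_le_at_bot[of "-1"]
        by eventually_elim (use K(2) in \<open>auto intro!: divide_right_mono simp: abs_divide\<close>)
    qed
  qed
  hence \<rho>0: "(\<rho> \<longlongrightarrow> 0) at_bot" by simp
  \<comment> \<open>\<open>K / t\<^sup>2\<close> has derivative \<open>- 2 * K / t ^ 3\<close>,
    which dominates that of \<open>\<rho>\<close>; so \<open>K / t\<^sup>2 + \<rho> t\<close> and
    \<open>K / t\<^sup>2 - \<rho> t\<close> both increase from the limit 0.\<close>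
  have \<rho>le: "\<bar>\<rho> t\<bar> \<le> K / t\<^sup>2" if t: "t \<le> -1" for t
  proof -
    have s: "0 \<le> (- 2 * K + 2 * airy_fun x) / x ^ 3 \<and> 0 \<le> (- 2 * K - 2 * airy_fun x) / x ^ 3" if "x \<le> t" for x
    proof -
      have "x ^ 3 \<le> 0" using that t by (simp add: power_le_zero_eq)
      moreover have "\<bar>airy_fun x\<bar> \<le> K" using K(2) that t by simp
      ultimately show ?thesis by (intro conjI divide_nonpos_nonpos) auto
    qed
    have "0 \<le> K / t\<^sup>2 + \<rho> t"
    proof (rule limit_at_bot_le[where f = "\<lambda>t. K / t\<^sup>2 + \<rho> t"])
      show "((\<lambda>t. K / t\<^sup>2 + \<rho> t) has_real_derivative (- 2 * K + 2 * airy_fun x) / x ^ 3) (at x)" if "x \<le> t" for x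
        using DERIV_add[OF kd \<rho>d] that t by (simp add: add_divide_distrib diff_divide_distrib)
      show "((\<lambda>t. K / t\<^sup>2 + \<rho> t) \<longlongrightarrow> 0) at_bot" using tendsto_add[OF inv \<rho>0] by simp
    qed (use s in auto)
    moreover have "0 \<le> K / t\<^sup>2 - \<rho> t"
    proof (rule limit_at_bot_le[where f = "\<lambda>t. K / t\<^sup>2 - \<rho> t"])
      show "((\<lambda>t. K / t\<^sup>2 - \<rho> t) has_real_derivative (- 2 * K - 2 * airy_fun x) / x ^ 3) (at x)" if "x \<le> t" for x
        using DERIV_diff[OF kd \<rho>d] that t by (simp add: diff_divide_distrib)
      show "((\<lambda>t. K / t\<^sup>2 - \<rho> t) \<longlongrightarrow> 0) at_bot" using tendsto_diff[OF inv \<rho>0] by simp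
    qed (use s in auto)
    ultimately show ?thesis by (simp add: abs_le_iff)
  qed
  show thesis
  proof (rule that[of "2 * K\<^sup>2"])
    fix t :: real assume t: "t \<le> -1"
    define r where "r = 1 - airy_tail t - airy_slope t / t"
    have "\<bar>r\<bar> = \<bar>\<rho> t + airy_fun t / t\<^sup>2\<bar>" by (simp add: r_def \<rho>_def)
    also have "\<dots> \<le> K / t\<^sup>2 + K / t\<^sup>2"
    proof (rule order_trans[OF abs_triangle_ineq add_mono])
      show "\<bar>airy_fun t / t\<^sup>2\<bar> \<le> K / t\<^sup>2" using K(2)[OF t] by (simp add: abs_divide divide_right_mono)
    qed (rule \<rho>le[OF t])
    finally have "\<bar>r\<bar> \<le> 2 * K / t\<^sup>2" by simp
    hence "\<bar>r\<bar> ^ 2 \<le> (2 * K / t\<^sup>2) ^ 2" by (intro power_mono) auto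
    hence r2: "r\<^sup>2 \<le> 4 * K\<^sup>2 / t ^ 4" by (simp add: power_divide power_mult_distrib flip: power_mult)
    have I: "1 - airy_tail t = airy_slope t / t + r" by (simp add: r_def)
    \<comment> \<open>The mixed terms \<open>Ai' * r\<close> cancel: one comes from the product, the
      other from the square.\<close>
    have "airy_lyapunov t = (airy_slope t)\<^sup>2 / (2 * t) - (airy_fun t)\<^sup>2 / 2 + (- t) * r\<^sup>2 / 2"
      unfolding airy_lyapunov_def I using t by (simp add: field_simps power2_eq_square)
    also have "\<dots> \<le> (- t) * r\<^sup>2 / 2"
    proof -
      have "(airy_slope t)\<^sup>2 / (2 * t) \<le> 0" using t by (intro divide_nonneg_neg) auto
      moreover have "0 \<le> (airy_fun t)\<^sup>2 / 2" by simp
      ultimately show ?thesis by linarith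
    qed
    also have "\<dots> \<le> (- t) * (4 * K\<^sup>2 / t ^ 4) / 2"
      using t r2 by (intro divide_right_mono mult_left_mono) auto
    also have "\<dots> = 2 * K\<^sup>2 / (- t) * (1 / t\<^sup>2)"
      using t by (simp add: field_simps eval_nat_numeral)
    also have "\<dots> \<le> 2 * K\<^sup>2 / (- t) * 1"
    proof (rule mult_left_mono)
      have "1 \<le> t\<^sup>2" using power_mono[of 1 "- t" 2] t by simp
      thus "1 / t\<^sup>2 \<le> 1" using t by simp
      show "0 \<le> 2 * K\<^sup>2 / (- t)" using t by (intro divide_nonneg_pos) auto
    qed
    finally show "airy_lyapunov t \<le> 2 * K\<^sup>2 / (- t)" by simp
  qed
qed

lemma DERIV_zero_of_locally_const:
  fixes f :: "real \<Rightarrow> real"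
  assumes "(f has_real_derivative D) (at s)" "s < t" "\<And>x. x < t \<Longrightarrow> f x = c"
  shows "D = 0"
proof -
  have "((\<lambda>_. c) has_real_derivative D) (at s)"
    by (rule has_field_derivative_transform_within_open[OF assms(1), of "{..<t}"]) (use assms in auto)
  thus ?thesis using DERIV_const DERIV_unique by blast
qed

text \<open>At most 0 by monotonicity from minus infinity. If it were 0 at \<open>t\<close>, it
  would be 0 everywhere to the left of \<open>t\<close>; its derivative then forces
  \<open>1 - airy_tail\<close> to vanish there, and with it \<open>airy_fun\<close> and
  \<open>airy_slope\<close>, against nondegeneracy.\<close>

lemma airy_lyapunov_neg: "airy_lyapunov t < 0"
proof -
  obtain K where K: "\<And>t. t \<le> -1 \<Longrightarrow> airy_lyapunov t \<le> K / (- t)" using airy_lyapunov_at_bot by blast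
  have le: "airy_lyapunov s \<le> 0" for s
  proof (rule tendsto_lowerbound[of "\<lambda>t. K / (- t)" 0 at_bot])
    show "((\<lambda>t. K / (- t)) \<longlongrightarrow> 0) at_bot"
      by (intro tendsto_divide_0[OF tendsto_const] filterlim_at_top_imp_at_infinity filterlim_uminus_at_top_at_bot)
    show "eventually (\<lambda>t. airy_lyapunov s \<le> K / (- t)) at_bot"
      using eventually_le_at_bot[of "min s (-1)"]
    proof eventually_elim
      case (elim t)
      thus ?case using airy_lyapunov_antimono[of t s] K[of t] by simp
    qed
  qed simp
  show ?thesis
  proof (rule ccontr)
    assume "\<not> ?thesis"
    hence z: "airy_lyapunov s = 0" if "s < t" for s
      using le[of s] airy_lyapunov_antimono[of s t] that by simp
    have 1: "airy_tail s = 1" if "s < t" for s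
      using DERIV_zero_of_locally_const[OF DERIV_airy_lyapunov that z] by simp
    have 2: "airy_fun s = 0" if "s < t" for s
      using DERIV_zero_of_locally_const[OF DERIV_airy_tail that 1] by simp
    have 3: "airy_slope s = 0" if "s < t" for s
      using DERIV_zero_of_locally_const[OF DERIV_airy_fun that 2] by simp
    show False using airy_nondegenerate[of "t - 1"] 2[of "t - 1"] 3[of "t - 1"] by simp
  qed
qed

section \<open>The scaling limit and the sign of Ai on the positive axis\<close>

lemma Airy_scale:
  fixes n :: nat
  defines "d \<equiv> real (2 * n + 1) powr (- 1 / 3)"
  shows "0 < d" "d \<le> 1" "real (2 * n + 1) * d ^ 3 = 1"
proof -
  define N where "N = real (2 * n + 1)"
  have N: "N \<ge> 1" by (simp add: N_def)
  show "0 < d" using N by (simp add: d_def)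
  have "N powr (- 1 / 3) \<le> N powr 0" using N by (intro powr_mono) auto
  thus "d \<le> 1" using N unfolding d_def N_def[symmetric] by simp
  have "d ^ 3 = N powr (- 1)"
    unfolding d_def N_def[symmetric] using N by (simp add: powr_power)
  thus "real (2 * n + 1) * d ^ 3 = 1"
    unfolding N_def[symmetric] using N by (simp add: powr_minus_divide)
qed

lemma Airy_scale_tendsto: "(\<lambda>n. real (2 * n + 1) powr (- 1 / 3)) \<longlonglongrightarrow> 0"
proof (rule tendsto_neg_powr)
  show "filterlim (\<lambda>n. real (2 * n + 1)) at_top sequentially"
    by (rule filterlim_at_top_mono[OF filterlim_real_sequentially]) auto
qed simp

lemma Airy_scale_square_tendsto: "(\<lambda>n. (real (2 * n + 1) powr (- 1 / 3))\<^sup>2) \<longlonglongrightarrow> 0"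
  using tendsto_power[OF Airy_scale_tendsto, of 2] by simp

lemma fock_tail_tendsto_airy_tail:
  "(\<lambda>n. fock_tail n (real (2 * n + 1) + t / real (2 * n + 1) powr (- 1 / 3))) \<longlonglongrightarrow> airy_tail t"
proof -
  define d where "d = (\<lambda>n::nat. real (2 * n + 1) powr (- 1 / 3))"
  obtain C where "C > 0" and C: "\<And>n d t'. \<lbrakk>0 < d; d \<le> 1; real (2 * n + 1) * d ^ 3 = 1; 2 * \<bar>t\<bar> * d\<^sup>2 \<le> 1; \<bar>t'\<bar> \<le> \<bar>t\<bar>\<rbrakk>
     \<Longrightarrow> \<bar>fock_tail n (real (2 * n + 1) + t' / d) - airy_tail t'\<bar> \<le> C * d\<^sup>2"
  proof (rule fock_tail_airy_approx[OF abs_ge_zero[of t]])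
    fix C :: real
    assume "C > 0" and "\<And>n d t'. \<lbrakk>0 < d; d \<le> 1; real (2 * n + 1) * d ^ 3 = 1; 2 * \<bar>t\<bar> * d\<^sup>2 \<le> 1; \<bar>t'\<bar> \<le> \<bar>t\<bar>\<rbrakk>
     \<Longrightarrow> \<bar>fock_tail n (real (2 * n + 1) + t' / d) - airy_tail t'\<bar> \<le> C * d\<^sup>2"
    thus thesis by (rule that)
  qed
  have d2: "(\<lambda>n. c * (d n)\<^sup>2) \<longlonglongrightarrow> 0" for c
    using tendsto_mult_left[OF Airy_scale_square_tendsto, of c] by (simp add: d_def)
  have "(\<lambda>n. fock_tail n (real (2 * n + 1) + t / d n) - airy_tail t) \<longlonglongrightarrow> 0"
  proof (rule Lim_null_comparison[OF _ d2[of C]])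
    have "eventually (\<lambda>n. 2 * \<bar>t\<bar> * (d n)\<^sup>2 < 1) sequentially"
      using order_tendstoD(2)[OF d2[of "2 * \<bar>t\<bar>"], of 1] by simp
    thus "eventually (\<lambda>n. norm (fock_tail n (real (2 * n + 1) + t / d n) - airy_tail t) \<le> C * (d n)\<^sup>2) sequentially"
    proof eventually_elim
      case (elim n)
      show ?case unfolding real_norm_def d_def
        by (rule C[OF Airy_scale]) (use elim in \<open>auto simp: d_def\<close>)
    qed
  qed
  thus ?thesis by (simp add: LIM_zero_iff d_def)
qed

text \<open>The rescaled points lie beyond \<open>2n + 1\<close>, where \<open>fock_tail n\<close>
  decreases, and monotonicity survives the limit. Positivity of the Laguerre functions is thus
  transferred to Ai.\<close>

lemma airy_tail_antimono_nonneg: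
  assumes "0 \<le> s" "s \<le> t"
  shows "airy_tail t \<le> airy_tail s"
proof (rule LIMSEQ_le[OF fock_tail_tendsto_airy_tail fock_tail_tendsto_airy_tail])
  show "\<exists>N. \<forall>n\<ge>N. fock_tail n (real (2 * n + 1) + t / real (2 * n + 1) powr (- 1 / 3))
        \<le> fock_tail n (real (2 * n + 1) + s / real (2 * n + 1) powr (- 1 / 3))"
    using assms by (intro exI allI impI fock_tail_antimono) (auto intro: divide_right_mono)
qed

lemma airy_fun_nonneg: "t \<ge> 0 \<Longrightarrow> airy_fun t \<ge> 0"
proof (rule ccontr)
  assume t: "t \<ge> 0" and "\<not> airy_fun t \<ge> 0"
  hence "0 < - airy_fun t" by simp
  from DERIV_pos_inc_right[OF DERIV_airy_tail this] obtain e where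
    e: "e > 0" "\<And>h. 0 < h \<Longrightarrow> h < e \<Longrightarrow> airy_tail t < airy_tail (t + h)" by blast
  show False using e(2)[of "e / 2"] e(1) airy_tail_antimono_nonneg[of t "t + e / 2"] t by simp
qed

lemma airy_tail_nonneg_of_antimono:
  assumes "\<And>t. t \<ge> a \<Longrightarrow> airy_fun t \<ge> 0"
  shows "airy_tail a \<ge> 0"
proof (rule tendsto_upperbound[OF airy_tail_at_top])
  show "eventually (\<lambda>t. airy_tail t \<le> airy_tail a) at_top"
    using eventually_ge_at_top[of a]
  proof eventually_elim
    case (elim t)
    show ?case
      by (rule DERIV_nonpos_imp_nonincreasing[OF elim]) (use DERIV_airy_tail assms in force)
  qed
qed simp

text \<open>If \<open>airy_fun 0 = 0\<close>, nonnegativity to the right and nondegeneracy give a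
  slope \<open>c > 0\<close> at 0. As the slope does not decrease, \<open>airy_fun\<close> stays
  above \<open>c\<close> from 1 on, and the tail would turn negative.\<close>

lemma airy_fun_0_pos: "airy_fun 0 > 0"
proof (rule ccontr)
  assume "\<not> ?thesis"
  hence A0: "airy_fun 0 = 0" using airy_fun_nonneg[of 0] by simp
  have D0: "airy_slope 0 \<ge> 0"
  proof (rule ccontr)
    assume "\<not> ?thesis"
    hence "airy_slope 0 < 0" by simp
    from DERIV_neg_dec_right[OF DERIV_airy_fun this] obtain e where
      e: "e > 0" "\<And>h. 0 < h \<Longrightarrow> h < e \<Longrightarrow> airy_fun 0 > airy_fun (0 + h)" by blast
    show False using e(2)[of "e / 2"] e(1) A0 airy_fun_nonneg[of "e / 2"] by simp
  qed
  define c where "c = airy_slope 0"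
  have c: "c > 0" using D0 airy_nondegenerate[of 0] A0 by (simp add: c_def)
  have D: "airy_slope t \<ge> c" if "t \<ge> 0" for t
    unfolding c_def
    by (rule DERIV_nonneg_imp_nondecreasing[OF that]) (use DERIV_airy_slope airy_fun_nonneg in force)
  have A: "airy_fun t \<ge> c" if "t \<ge> 1" for t
  proof -
    have "airy_fun 0 - c * 0 \<le> airy_fun t - c * t"
    proof (rule DERIV_nonneg_imp_nondecreasing[where f = "\<lambda>t. airy_fun t - c * t"])
      fix x assume "0 \<le> x" "x \<le> t"
      thus "\<exists>y. ((\<lambda>t. airy_fun t - c * t) has_real_derivative y) (at x) \<and> 0 \<le> y"
        using D[of x] by (intro exI[of _ "airy_slope x - c"]) (auto intro!: derivative_eq_intros DERIV_airy_fun)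
    qed (use that in auto)
    moreover have "c * 1 \<le> c * t" using c that by (intro mult_left_mono) auto
    ultimately show ?thesis using A0 by simp
  qed
  have le: "airy_tail t + c * t \<le> airy_tail 1 + c * 1" if "t \<ge> 1" for t
  proof (rule DERIV_nonpos_imp_nonincreasing[where f = "\<lambda>t. airy_tail t + c * t", OF that])
    fix x assume "1 \<le> x" "x \<le> t"
    thus "\<exists>y. ((\<lambda>t. airy_tail t + c * t) has_real_derivative y) (at x) \<and> y \<le> 0"
      using A[of x] by (intro exI[of _ "- airy_fun x + c"]) (auto intro!: derivative_eq_intros DERIV_airy_tail)
  qed
  \<comment> \<open>At this point the linear bound reads
    \<open>airy_tail t \<le> - c\<close>.\<close>
  define t where "t = 2 + airy_tail 1 / c"
  have nn: "airy_tail s \<ge> 0" if "s \<ge> 0" for s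
    by (rule airy_tail_nonneg_of_antimono) (use airy_fun_nonneg that in auto)
  have t: "t \<ge> 1" using nn[of 1] c by (simp add: t_def)
  have "c * t = 2 * c + airy_tail 1" using c by (simp add: t_def field_simps)
  thus False using le[OF t] nn[of t] t c by simp
qed

section \<open>Existence and nature of the largest zero\<close>

lemma DERIV_sqrt_airy:
  assumes "1 - airy_tail t > 0"
  shows "((\<lambda>t. sqrt (1 - airy_tail t)) has_real_derivative inverse (sqrt (1 - airy_tail t)) / 2 * airy_fun t) (at t)"
proof -
  have "((\<lambda>t. 1 - airy_tail t) has_real_derivative airy_fun t) (at t)"
    using DERIV_diff[OF DERIV_const[of 1] DERIV_airy_tail[of t]] by simp
  thus ?thesis
    by (rule DERIV_chain2[where f = sqrt and g = "\<lambda>t. 1 - airy_tail t", OF DERIV_real_sqrt[OF assms]])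
qed

lemma airy_tail_eq_1_exists: "\<exists>t. airy_tail t = 1"
proof (rule ccontr)
  assume "\<not> ?thesis"
  hence ne: "airy_tail t \<noteq> 1" for t by blast
  have "eventually (\<lambda>t. airy_tail t < 1) at_top" using order_tendstoD(2)[OF airy_tail_at_top] by simp
  then obtain u where u: "airy_tail u < 1" by (auto simp: eventually_at_top_linorder)
  have pos: "1 - airy_tail t > 0" for t
  proof (rule ccontr)
    assume "\<not> ?thesis"
    hence gt: "airy_tail t > 1" using ne[of t] by simp
    have "\<exists>x. airy_tail x = 1"
    proof (cases "t \<le> u")
      case True
      have "\<exists>x\<ge>t. x \<le> u \<and> airy_tail x = 1"
        by (rule IVT2') (use u gt True in \<open>auto intro: airy_continuous\<close>)
      thus ?thesis by blast
    next
      case False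
      have "\<exists>x\<ge>u. x \<le> t \<and> airy_tail x = 1"
        by (rule IVT') (use u gt False in \<open>auto intro: airy_continuous\<close>)
      thus ?thesis by blast
    qed
    thus False using ne by blast
  qed
  \<comment> \<open>With \<open>f = 1 - airy_tail\<close>, \<open>w\<close> is twice the derivative
    of \<open>v = sqrt f\<close>. The numerator of \<open>w'\<close> is the functional plus
    \<open>t * f^2 / 2\<close>, hence negative for \<open>t \<le> 0\<close>.\<close>
  define v where "v = (\<lambda>t. sqrt (1 - airy_tail t))"
  define w where "w = (\<lambda>t. airy_fun t / v t)"
  have vp: "v t > 0" "v t * v t = 1 - airy_tail t" for t
    using pos[of t] by (simp_all only: v_def real_sqrt_gt_zero real_sqrt_mult_self abs_of_pos)
  have vd: "(v has_real_derivative w t / 2) (at t)" for t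
  proof -
    have "(v has_real_derivative inverse (v t) / 2 * airy_fun t) (at t)"
      unfolding v_def by (rule DERIV_sqrt_airy[OF pos])
    thus ?thesis by (rule DERIV_cong) (simp add: w_def inverse_eq_divide)
  qed
  have wd: "(w has_real_derivative (airy_slope t * (1 - airy_tail t) - (airy_fun t)\<^sup>2 / 2) / v t ^ 3) (at t)" for t
  proof -
    have v0: "v t \<noteq> 0" using vp(1)[of t] by simp
    have "((\<lambda>t. airy_fun t / v t) has_real_derivative (airy_slope t * v t - airy_fun t * (w t / 2)) / (v t * v t)) (at t)"
      by (rule DERIV_divide[OF DERIV_airy_fun vd v0])
    hence "(w has_real_derivative (airy_slope t * (v t * v t) - (airy_fun t)\<^sup>2 / 2) / v t ^ 3) (at t)"
      unfolding w_def[symmetric]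
    proof (rule DERIV_cong)
      show "(airy_slope t * v t - airy_fun t * (w t / 2)) / (v t * v t) =
        (airy_slope t * (v t * v t) - (airy_fun t)\<^sup>2 / 2) / v t ^ 3"
        using v0 by (simp add: w_def field_simps eval_nat_numeral)
    qed
    thus ?thesis unfolding vp .
  qed
  have wmono: "w t \<le> w s" if "s \<le> t" "t \<le> 0" for s t
  proof (rule DERIV_nonpos_imp_nonincreasing[OF that(1)])
    fix x assume x: "s \<le> x" "x \<le> t"
    have "x * (1 - airy_tail x)\<^sup>2 \<le> 0" using x that by (intro mult_nonpos_nonneg) auto
    hence "airy_slope x * (1 - airy_tail x) - (airy_fun x)\<^sup>2 / 2 \<le> 0"
      using airy_lyapunov_neg[of x] by (simp add: airy_lyapunov_def)
    hence "(airy_slope x * (1 - airy_tail x) - (airy_fun x)\<^sup>2 / 2) / v x ^ 3 \<le> 0"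
      using vp(1)[of x] by (intro divide_nonpos_pos) auto
    thus "\<exists>y. (w has_real_derivative y) (at x) \<and> y \<le> 0" using wd by blast
  qed
  show False
  \<comment> \<open>A positive slope at \<open>s\<close> and concavity put \<open>v\<close> below a
    line that reaches 0 at \<open>s - v s / c\<close>. Without such an \<open>s\<close>,
    \<open>airy_fun\<close> is nonpositive on the left half-line, so the tail increases from its
    limit 1 and \<open>airy_tail 0 \<ge> 1\<close>.\<close>
  proof (cases "\<exists>s\<le>0. w s > 0")
    case True
    then obtain s where s: "s \<le> 0" "w s > 0" by blast
    define c where "c = w s / 2"
    have c: "c > 0" using s by (simp add: c_def)
    have le: "v t - c * t \<le> v s - c * s" if "t \<le> s" for t
    proof (rule DERIV_nonneg_imp_nondecreasing[where f = "\<lambda>t. v t - c * t", OF that])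
      fix x assume "t \<le> x" "x \<le> s"
      thus "\<exists>y. ((\<lambda>t. v t - c * t) has_real_derivative y) (at x) \<and> 0 \<le> y"
        using wmono[of x s] s
        by (intro exI[of _ "w x / 2 - c"]) (auto intro!: derivative_eq_intros vd simp: c_def)
    qed
    define t where "t = s - v s / c"
    have "c * t = c * s - v s" using c by (simp add: t_def field_simps)
    moreover have "t \<le> s" using vp(1)[of s] c by (simp add: t_def)
    ultimately show False using le[of t] vp(1)[of t] by simp
  next
    case False
    hence "airy_fun t \<le> 0" if "t \<le> 0" for t
      using vp(1)[of t] that by (force simp: w_def not_less divide_le_0_iff)
    hence "1 \<le> airy_tail 0"
      by (intro limit_at_bot_le[OF DERIV_airy_tail _ airy_tail_at_bot]) auto
    thus False using pos[of 0] by simp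
  qed
qed

theorem airy_tail_largest_zero:
  obtains t0 where "airy_tail t0 = 1" "\<And>t. t > t0 \<Longrightarrow> airy_tail t < 1" "airy_fun t0 > 0"
    "\<And>t. t \<ge> t0 \<Longrightarrow> airy_fun t \<ge> 0" "\<And>t. t \<ge> t0 \<Longrightarrow> airy_tail t > 0"
proof -
  define Z where "Z = {t. airy_tail t = 1}"
  define t0 where "t0 = Sup Z"
  have ne: "Z \<noteq> {}" using airy_tail_eq_1_exists by (auto simp: Z_def)
  have "closed Z" unfolding Z_def
    by (intro closed_Collect_eq airy_continuous continuous_on_const)
  have "eventually (\<lambda>t. airy_tail t < 1) at_top" using order_tendstoD(2)[OF airy_tail_at_top] by simp
  then obtain u where u: "\<And>t. t \<ge> u \<Longrightarrow> airy_tail t < 1" by (auto simp: eventually_at_top_linorder)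
  have bdd: "bdd_above Z"
  proof (rule bdd_aboveI[of _ u])
    fix t assume "t \<in> Z"
    thus "t \<le> u" using u[of t] by (force simp: Z_def)
  qed
  have "t0 \<in> Z" unfolding t0_def by (rule closed_contains_Sup[OF ne bdd \<open>closed Z\<close>])
  hence zero: "airy_tail t0 = 1" by (simp add: Z_def)
  have lt: "airy_tail t < 1" if t: "t > t0" for t
  proof (rule ccontr)
    assume "\<not> ?thesis"
    hence "\<exists>x\<ge>t. x \<le> max t u \<and> airy_tail x = 1"
      using u[of "max t u"] by (intro IVT2' airy_continuous) auto
    then obtain x where "t \<le> x" "airy_tail x = 1" by blast
    hence "x \<le> t0" unfolding t0_def by (intro cSup_upper bdd) (auto simp: Z_def)
    thus False using \<open>t \<le> x\<close> t by simp
  qed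
  \<comment> \<open>At a zero of \<open>1 - airy_tail\<close> the functional reduces to
    \<open>- (airy_fun t0)\<^sup>2 / 2\<close>, so its strict sign makes the zero simple.\<close>
  have "airy_fun t0 \<noteq> 0" using airy_lyapunov_neg[of t0] by (auto simp: airy_lyapunov_def zero)
  moreover have "\<not> airy_fun t0 < 0"
  proof
    assume "airy_fun t0 < 0"
    hence "0 < - airy_fun t0" by simp
    from DERIV_pos_inc_right[OF DERIV_airy_tail this] obtain e where
      e: "e > 0" "\<And>h. 0 < h \<Longrightarrow> h < e \<Longrightarrow> airy_tail t0 < airy_tail (t0 + h)" by blast
    show False using e(2)[of "e / 2"] e(1) lt[of "t0 + e / 2"] zero by simp
  qed
  ultimately have pos: "airy_fun t0 > 0" by simp
  have nonneg: "airy_fun t \<ge> 0" if t: "t \<ge> t0" for t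
  proof (rule ccontr)
    assume neg: "\<not> airy_fun t \<ge> 0"
    hence t_neg: "t < 0" using airy_fun_nonneg[of t] by linarith
    define S where "S = {x \<in> {t..0}. airy_fun x = 0}"
    have "\<exists>x\<ge>t. x \<le> 0 \<and> airy_fun x = 0"
      using neg t_neg airy_fun_0_pos by (intro IVT' airy_continuous) auto
    hence Sne: "S \<noteq> {}" by (auto simp: S_def)
    have "S = {t..0} \<inter> {x. airy_fun x = 0}" by (auto simp: S_def)
    hence "closed S"
      by (auto intro!: closed_Int closed_Collect_eq airy_continuous)
    have Sb: "bdd_above S" by (rule bdd_aboveI[of _ 0]) (auto simp: S_def)
    \<comment> \<open>The last zero of \<open>airy_fun\<close> in \<open>[t, 0]\<close>. The
      functional makes it a strictly downward crossing, and \<open>airy_fun 0 > 0\<close> then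
      forces another zero to its right.\<close>
    define b where "b = Sup S"
    have "b \<in> S" unfolding b_def by (rule closed_contains_Sup[OF Sne Sb \<open>closed S\<close>])
    hence b: "t \<le> b" "b < 0" "airy_fun b = 0"
      using airy_fun_0_pos by (auto simp: S_def less_le)
    have bt0: "b > t0" using b t pos by (cases "b = t0") auto
    have "airy_slope b * (1 - airy_tail b) < b * (1 - airy_tail b)\<^sup>2 / 2"
      using airy_lyapunov_neg[of b] b by (simp add: airy_lyapunov_def)
    also have "\<dots> \<le> 0" using b(2) by (simp add: mult_nonpos_nonneg)
    finally have "airy_slope b < 0" using lt[OF bt0] by (simp add: mult_less_0_iff)
    from DERIV_neg_dec_right[OF DERIV_airy_fun this] obtain e where
      e: "e > 0" "\<And>h. 0 < h \<Longrightarrow> h < e \<Longrightarrow> airy_fun b > airy_fun (b + h)" by blast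
    define y where "y = b + min (e / 2) (- b / 2)"
    have y: "b < y" "y < 0" "airy_fun y < 0"
      using e(2)[of "min (e / 2) (- b / 2)"] e(1) b by (auto simp: y_def min_def)
    have "\<exists>x\<ge>y. x \<le> 0 \<and> airy_fun x = 0"
      using y airy_fun_0_pos by (intro IVT' airy_continuous) auto
    then obtain x where x: "y \<le> x" "x \<le> 0" "airy_fun x = 0" by blast
    have "x \<le> b" unfolding b_def using x y b by (intro cSup_upper Sb) (auto simp: S_def)
    thus False using x y by simp
  qed
  have anti: "airy_tail t \<le> airy_tail s" if "t0 \<le> s" "s \<le> t" for s t
    by (rule DERIV_nonpos_imp_nonincreasing[OF that(2)]) (use DERIV_airy_tail nonneg that in force)
  have nn: "airy_tail t \<ge> 0" if "t \<ge> t0" for t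
    by (rule airy_tail_nonneg_of_antimono) (use nonneg that in auto)
  \<comment> \<open>A nonnegative, nonincreasing tail that vanishes at \<open>t\<close> vanishes
    from \<open>t\<close> on, and with it \<open>airy_fun\<close> and
    \<open>airy_slope\<close>.\<close>
  have tail_pos: "airy_tail t > 0" if t: "t \<ge> t0" for t
  proof (rule ccontr)
    assume "\<not> ?thesis"
    hence "airy_tail x = 0" if "x \<ge> t" for x
      using anti[of t x] nn[of x] that t by simp
    hence A: "airy_fun x = 0" if "x > t" for x
    proof -
      have "((\<lambda>_. 0::real) has_real_derivative - airy_fun x) (at x)"
        by (rule has_field_derivative_transform_within_open[OF DERIV_airy_tail, of "{t<..}"])
           (use that \<open>\<And>x. t \<le> x \<Longrightarrow> airy_tail x = 0\<close> in auto)
      from DERIV_unique[OF this DERIV_const] show ?thesis by simp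
    qed
    have "airy_slope (t + 1) = 0"
    proof -
      have "((\<lambda>_. 0::real) has_real_derivative airy_slope (t + 1)) (at (t + 1))"
        by (rule has_field_derivative_transform_within_open[OF DERIV_airy_fun, of "{t<..}"])
           (use A in auto)
      from DERIV_unique[OF this DERIV_const] show ?thesis by simp
    qed
    thus False using airy_nondegenerate[of "t + 1"] A[of "t + 1"] by simp
  qed
  show thesis by (rule that[of t0]) (use zero lt pos nonneg tail_pos in auto)
qed

subsection \<open>Shell weights\<close>

text \<open>The push-forward of planar Lebesgue measure under the squared norm has constant density
  \<open>\<pi>\<close>; the sign is flipped because \<open>measure_eqI_lessThan\<close> needs upper half-lines of finite measure.\<close>

lemma distr_minus_norm_squared:
  "distr lborel borel (\<lambda>r :: real ^ 2. - (norm r)\<^sup>2) = density lborel (\<lambda>\<xi>. ennreal (pi * indicator {..0} \<xi>))"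
proof (rule measure_eqI_lessThan)
  have eq: "emeasure (distr lborel borel (\<lambda>r :: real ^ 2. - (norm r)\<^sup>2)) {x<..} = ennreal (pi * max 0 (- x))" for x
  proof -
    have "emeasure (distr lborel borel (\<lambda>r :: real ^ 2. - (norm r)\<^sup>2)) {x<..} =
        emeasure lborel ((\<lambda>r :: real ^ 2. - (norm r)\<^sup>2) -` {x<..})"
      by (subst emeasure_distr) auto
    also have "(\<lambda>r :: real ^ 2. - (norm r)\<^sup>2) -` {x<..} = ball 0 (sqrt (max 0 (- x)))"
    proof -
      have "x < - (norm r)\<^sup>2 \<longleftrightarrow> norm r < sqrt (max 0 (- x))" for r :: "real ^ 2"
      proof -
        have "norm r < sqrt (max 0 (- x)) \<longleftrightarrow> (norm r)\<^sup>2 < max 0 (- x)"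
          by (metis norm_ge_zero real_sqrt_less_iff real_sqrt_pow2_iff real_sqrt_power real_sqrt_unique)
        moreover have "x < - q \<longleftrightarrow> q < max 0 (- x)" if "q \<ge> 0" for q
          using that by (auto simp: max_def)
        ultimately show ?thesis by simp
      qed
      thus ?thesis by auto
    qed
    also have "emeasure lborel \<dots> = ennreal (pi * max 0 (- x))"
      by (subst emeasure_ball) (auto simp: eval_unit_ball_vol)
    finally show ?thesis .
  qed
  show "emeasure (distr lborel borel (\<lambda>r :: real ^ 2. - (norm r)\<^sup>2)) {x<..} < \<infinity>" for x
    unfolding eq by simp
  show "emeasure (distr lborel borel (\<lambda>r :: real ^ 2. - (norm r)\<^sup>2)) {x<..}
     = emeasure (density lborel (\<lambda>\<xi>. ennreal (pi * indicator {..0} \<xi>))) {x<..}" for x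
  proof -
    have "emeasure (density lborel (\<lambda>\<xi>. ennreal (pi * indicator {..0} \<xi>))) {x<..} =
       (\<integral>\<^sup>+\<xi>. ennreal (pi * indicator {..0} \<xi>) * indicator {x<..} \<xi> \<partial>lborel)"
      by (subst emeasure_density) auto
    also have "\<dots> = (\<integral>\<^sup>+\<xi>. ennreal pi * indicator {x<..0} \<xi> \<partial>lborel)"
      by (intro nn_integral_cong) (auto simp: indicator_def)
    also have "\<dots> = ennreal pi * emeasure lborel {x<..0}"
      by (rule nn_integral_cmult_indicator) simp
    also have "\<dots> = ennreal (pi * max 0 (- x))"
      by (cases "x \<le> 0") (auto simp: max_def simp flip: ennreal_mult'')
    finally show ?thesis unfolding eq ..
  qed
qed auto

lemma integral_radial:
  fixes h :: "real \<Rightarrow> real"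
  assumes [measurable]: "h \<in> borel_measurable borel"
  shows "(LINT r|lborel. h ((norm (r :: real ^ 2))\<^sup>2)) = pi * (LINT \<xi>|lborel. indicator {0..} \<xi> * h \<xi>)"
proof -
  have "(LINT r|lborel. h ((norm (r :: real ^ 2))\<^sup>2)) =
     (LINT \<xi>|distr lborel borel (\<lambda>r :: real ^ 2. - (norm r)\<^sup>2). h (- \<xi>))"
    by (subst integral_distr) auto
  also have "\<dots> = (LINT \<xi>|lborel. pi * indicator {..0} \<xi> * h (- \<xi>))"
    unfolding distr_minus_norm_squared by (subst integral_real_density) auto
  also have "\<dots> = \<bar>-1\<bar> *\<^sub>R (LINT \<xi>|lborel. pi * indicator {..0} (0 + -1 * \<xi>) * h (- (0 + -1 * \<xi>)))"
    by (rule lborel_integral_real_affine) simp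
  also have "\<dots> = (LINT \<xi>|lborel. pi * (indicator {0..} \<xi> * h \<xi>))"
    unfolding abs_minus_cancel abs_one scaleR_one
    by (intro Bochner_Integration.integral_cong) (auto simp: indicator_def)
  also have "\<dots> = pi * (LINT \<xi>|lborel. indicator {0..} \<xi> * h \<xi>)"
    by (rule integral_mult_right_zero)
  finally show ?thesis .
qed

text \<open>The density \<open>pi\<close> of the push-forward cancels the factor
  \<open>1 / pi\<close> of the Wigner function; closing the half-open interval only adds a null
  set.\<close>

lemma shell_weight_eq:
  assumes k: "k \<ge> 1" and \<Delta>: "\<Delta> > 0"
  shows "shell_weight n k \<Delta> = fock_tail n ((real k - 1) * \<Delta>) - fock_tail n (real k * \<Delta>)"
proof -
  define a where "a = (real k - 1) * \<Delta>"
  define b where "b = real k * \<Delta>"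
  have ab: "0 \<le> a" "a \<le> b" using k \<Delta> by (auto simp: a_def b_def algebra_simps)
  have [measurable]: "fock_radial n \<in> borel_measurable borel"
    by (intro borel_measurable_continuous_onI fock_radial_continuous)
  define h where "h = (\<lambda>\<xi>. indicator {a..<b} \<xi> * (fock_radial n \<xi> / pi))"
  have [measurable]: "h \<in> borel_measurable borel" unfolding h_def by measurable
  have "shell_weight n k \<Delta> = (LINT r|lborel. h ((norm (r :: real ^ 2))\<^sup>2))"
    unfolding shell_weight_def set_lebesgue_integral_def
    by (intro Bochner_Integration.integral_cong)
       (auto simp: h_def fock_wigner_def fock_radial_def indicator_def a_def b_def)
  also have "\<dots> = pi * (LINT \<xi>|lborel. indicator {0..} \<xi> * h \<xi>)"
    by (rule integral_radial) measurable
  also have "\<dots> = (LINT \<xi>|lborel. indicator {a..<b} \<xi> *\<^sub>R fock_radial n \<xi>)"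
    unfolding integral_mult_right_zero[symmetric] using ab
    by (intro Bochner_Integration.integral_cong) (auto simp: h_def indicator_def)
  also have "\<dots> = (LINT \<xi>|lborel. indicator {a..b} \<xi> *\<^sub>R fock_radial n \<xi>)"
  proof (rule integral_cong_AE)
    show "AE \<xi> in lborel. indicator {a..<b} \<xi> *\<^sub>R fock_radial n \<xi> = indicator {a..b} \<xi> *\<^sub>R fock_radial n \<xi>"
      using AE_lborel_singleton[of b] by eventually_elim (auto simp: indicator_def)
  qed auto
  also have "\<dots> = integral {a..b} (fock_radial n)"
    using set_borel_integral_eq_integral(2)[OF borel_integrable_atLeastAtMost'[OF fock_radial_continuous[of "{a..b}" n]]]
    by (simp add: set_lebesgue_integral_def)
  also have "\<dots> = fock_tail n a - fock_tail n b"
    by (rule integral_unique[OF has_integral_fock_radial[OF ab(2)]])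
  finally show ?thesis by (simp add: a_def b_def)
qed

theorem mainTheorem7:
  shows "\<exists>t0. is_largest_zero airy_Ai_integral t0 \<and>
    (\<lambda>n. radial_negativity_scale n
          - ((2 * real n + 1) + 2 powr (- 1 / 3) * t0 * (4 * real n + 2) powr (1 / 3)))
      \<in> O(\<lambda>n. real n powr (- 1 / 3))"
proof -
  obtain t0 where t0: "airy_tail t0 = 1" "\<And>t. t > t0 \<Longrightarrow> airy_tail t < 1" "airy_fun t0 > 0"
    "\<And>t. t \<ge> t0 \<Longrightarrow> airy_fun t \<ge> 0" "\<And>t. t \<ge> t0 \<Longrightarrow> airy_tail t > 0"
    using airy_tail_largest_zero by blast
  have largest: "is_largest_zero airy_Ai_integral t0"
    unfolding is_largest_zero_def airy_Ai_integral_eq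
  proof (intro conjI allI impI)
    fix t assume "1 - airy_tail t = 0"
    thus "t \<le> t0" using t0(2)[of t] by (cases "t \<le> t0") auto
  qed (simp add: t0(1))
  have anti: "airy_tail t \<le> airy_tail s" if "t0 \<le> s" "s \<le> t" for s t
    by (rule DERIV_nonpos_imp_nonincreasing[OF that(2)]) (use DERIV_airy_tail t0(4) that in force)
  define \<alpha> where "\<alpha> = airy_fun t0"
  have \<alpha>: "\<alpha> > 0" using t0 by (simp add: \<alpha>_def)
  \<comment> \<open>Linearisation with relative error one half: within \<open>\<delta>\<close> of
    \<open>t0\<close>, \<open>1 - airy_tail\<close> has the sign of \<open>h\<close> and modulus at
    least \<open>\<alpha> / 2 * \<bar>h\<bar>\<close>.\<close>
  obtain \<delta> where \<delta>: "\<delta> > 0" "\<And>h. \<bar>h\<bar> \<le> \<delta> \<Longrightarrow> \<bar>1 - airy_tail (t0 + h) - \<alpha> * h\<bar> \<le> \<alpha> / 2 * \<bar>h\<bar>"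
  proof -
    have "((\<lambda>t. 1 - airy_tail t) has_derivative (\<lambda>h. \<alpha> * h)) (at t0)"
      using DERIV_diff[OF DERIV_const[of 1] DERIV_airy_tail[of t0]] by (simp add: has_field_derivative_def \<alpha>_def)
    then obtain e where e: "e > 0" "\<And>y. norm (y - t0) < e \<Longrightarrow>
        norm (1 - airy_tail y - (1 - airy_tail t0) - \<alpha> * (y - t0)) \<le> \<alpha> / 2 * norm (y - t0)"
      unfolding has_derivative_at_alt using \<alpha> half_gt_zero by blast
    show thesis
    proof (rule that[of "e / 2"])
      fix h assume "\<bar>h\<bar> \<le> e / 2"
      thus "\<bar>1 - airy_tail (t0 + h) - \<alpha> * h\<bar> \<le> \<alpha> / 2 * \<bar>h\<bar>"
        using e(2)[of "t0 + h"] e(1) t0(1) by simp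
    qed (use e in auto)
  qed
  \<comment> \<open>Lower bound of the tail between \<open>t0\<close> and 0, for use in the second
    shell; the maximum makes it meaningful for either sign of \<open>t0\<close>.\<close>
  define m where "m = airy_tail (max t0 0)"
  have m: "m > 0" unfolding m_def by (rule t0(5)) simp
  \<comment> \<open>Half-width of the window for \<open>t\<close>. With an approximation error below
    \<open>m / 4\<close>, the last condition keeps \<open>fock_tail n\<close> below
    \<open>m / 2\<close> beyond the window.\<close>
  obtain M where M: "M \<ge> \<bar>t0\<bar> + 1" "M \<ge> t0 + \<delta>" "airy_tail M < m / 4"
  proof -
    have "eventually (\<lambda>t. airy_tail t < m / 4 \<and> t \<ge> \<bar>t0\<bar> + 1 \<and> t \<ge> t0 + \<delta>) at_top"
      using m order_tendstoD(2)[OF airy_tail_at_top, of "m / 4"]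
      by (intro eventually_conj eventually_ge_at_top) auto
    thus thesis using that by (auto simp: eventually_at_top_linorder)
  qed
  \<comment> \<open>Gap of \<open>1 - airy_tail\<close> to the right of
    \<open>t0 + \<delta>\<close>, where the linearisation is no longer available.\<close>
  define m' where "m' = 1 - airy_tail (t0 + \<delta>)"
  have m': "m' > 0" using t0(2)[of "t0 + \<delta>"] \<delta>(1) by (simp add: m'_def)
  have M0: "M \<ge> 0" using M(1) by linarith
  obtain C where C: "C > 0" "\<And>n d t. \<lbrakk>0 < d; d \<le> 1; real (2 * n + 1) * d ^ 3 = 1; 2 * M * d\<^sup>2 \<le> 1; \<bar>t\<bar> \<le> M\<rbrakk>
     \<Longrightarrow> \<bar>fock_tail n (real (2 * n + 1) + t / d) - airy_tail t\<bar> \<le> C * d\<^sup>2"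
  proof (rule fock_tail_airy_approx[OF M0])
    fix C :: real
    assume "C > 0" "\<And>n d t. \<lbrakk>0 < d; d \<le> 1; real (2 * n + 1) * d ^ 3 = 1; 2 * M * d\<^sup>2 \<le> 1; \<bar>t\<bar> \<le> M\<rbrakk>
     \<Longrightarrow> \<bar>fock_tail n (real (2 * n + 1) + t / d) - airy_tail t\<bar> \<le> C * d\<^sup>2"
    thus thesis by (rule that)
  qed
  \<comment> \<open>At distance \<open>K * e\<^sup>2\<close> from \<open>t0\<close> half the slope
    gains \<open>(C + 1) * e\<^sup>2\<close>, which strictly beats the approximation error
    \<open>C * e\<^sup>2\<close>.\<close>
  define K where "K = 2 * (C + 1) / \<alpha>"
  have K: "K > 0" using C(1) \<alpha> by (simp add: K_def)
  have \<alpha>K: "\<alpha> / 2 * K = C + 1" using \<alpha> by (simp add: K_def)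
  define d where "d = (\<lambda>n::nat. real (2 * n + 1) powr (- 1 / 3))"
  have bound: "\<bar>radial_negativity_scale n - (real (2 * n + 1) + t0 / d n)\<bar> \<le> K * d n"
    if small: "3 * M * (d n)\<^sup>2 < 1" "C * (d n)\<^sup>2 < m / 4" "C * (d n)\<^sup>2 < m'" "K * (d n)\<^sup>2 < \<delta>" "K * (d n)\<^sup>2 < 1" for n
  proof -
    define e where "e = d n"
    define N where "N = real (2 * n + 1)"
    have e: "0 < e" "e \<le> 1" "N * e ^ 3 = 1" using Airy_scale[of n] by (auto simp: e_def d_def N_def)
    note sm = small[folded e_def]
    have e2: "e\<^sup>2 > 0" using e by simp
    have Me: "M * e\<^sup>2 \<ge> 0" using M0 by simp
    have approx: "\<bar>fock_tail n (N + t / e) - airy_tail t\<bar> \<le> C * e\<^sup>2" if "\<bar>t\<bar> \<le> M" for t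
      unfolding N_def using e sm(1) Me that by (intro C(2)) (auto simp: N_def)
    have inv: "1 / e = N * e\<^sup>2" using e by (simp add: field_simps power2_eq_square power3_eq_cube)
    \<comment> \<open>This makes \<open>2 * \<Delta>\<close> reach \<open>N + M / e\<close> for
      every \<open>t \<ge> - M\<close>.\<close>
    have small_N: "3 * (M / e) \<le> N"
    proof -
      have "3 * (M / e) = 3 * M * e\<^sup>2 * N" using inv by (metis mult.assoc mult.commute times_divide_eq_right mult_1_right)
      also have "\<dots> \<le> 1 * N" using sm(1) by (intro mult_right_mono) (auto simp: N_def)
      finally show ?thesis by simp
    qed
    \<comment> \<open>In the original variable the displacement \<open>K * e\<^sup>2\<close> of
      \<open>t\<close> becomes \<open>K * e\<close>, the claimed error.\<close>
    define x1 where "x1 = N + (t0 - K * e\<^sup>2) / e"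
    define x2 where "x2 = N + (t0 + K * e\<^sup>2) / e"
    have x1: "x1 \<in> negative_scales n"
    proof -
      define t1 where "t1 = t0 - K * e\<^sup>2"
      have h: "0 < K * e\<^sup>2" using K e2 by simp
      have t1: "\<bar>t1\<bar> \<le> M" using sm(5) h M(1) by (auto simp: t1_def)
      have "\<bar>1 - airy_tail (t0 + - (K * e\<^sup>2)) - \<alpha> * - (K * e\<^sup>2)\<bar> \<le> \<alpha> / 2 * \<bar>- (K * e\<^sup>2)\<bar>"
        using sm(4) h by (intro \<delta>(2)) simp
      hence "1 - airy_tail (t0 + - (K * e\<^sup>2)) - \<alpha> * - (K * e\<^sup>2) \<le> \<alpha> / 2 * \<bar>- (K * e\<^sup>2)\<bar>"
        by (rule abs_le_D1)
      moreover have "\<bar>- (K * e\<^sup>2)\<bar> = K * e\<^sup>2" using h by simp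
      ultimately have "1 - airy_tail t1 \<le> - (\<alpha> * (K * e\<^sup>2)) + \<alpha> / 2 * (K * e\<^sup>2)"
        by (simp only: t1_def diff_conv_add_uminus mult_minus_right minus_minus)
      also have "\<dots> = - (\<alpha> / 2 * K * e\<^sup>2)" by simp
      also have "\<dots> = - (C * e\<^sup>2) - e\<^sup>2" unfolding \<alpha>K by (simp add: algebra_simps)
      finally have "1 - airy_tail t1 \<le> - (C * e\<^sup>2) - e\<^sup>2" .
      moreover have "airy_tail t1 - fock_tail n x1 \<le> C * e\<^sup>2"
        using approx[OF t1] unfolding x1_def t1_def[symmetric] by (simp add: abs_le_iff)
      ultimately have "1 - fock_tail n x1 < 0" using e2 by linarith
      moreover have pos: "x1 > 0"
      proof -
        have "\<bar>t1 / e\<bar> \<le> M / e" using t1 e by (simp add: abs_divide divide_right_mono)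
        moreover have "0 \<le> M / e" using M0 e by simp
        moreover have "N > 0" by (simp add: N_def)
        ultimately show ?thesis using small_N unfolding x1_def t1_def[symmetric] by linarith
      qed
      ultimately have "shell_weight n 1 x1 < 0" by (simp add: shell_weight_eq fock_tail_0)
      thus ?thesis using pos unfolding negative_scales_def by blast
    qed
    have x2: "\<Delta> \<le> x2" if \<Delta>: "\<Delta> \<in> negative_scales n" for \<Delta>
    proof (rule ccontr)
      assume "\<not> \<Delta> \<le> x2"
      hence gt: "x2 < \<Delta>" by simp
      obtain k where k: "k \<ge> 1" "shell_weight n k \<Delta> < 0" and pos: "\<Delta> > 0"
        using \<Delta> by (auto simp: negative_scales_def)
      hence w: "fock_tail n ((real k - 1) * \<Delta>) < fock_tail n (real k * \<Delta>)" by (simp add: shell_weight_eq)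
      define t where "t = (\<Delta> - N) * e"
      have \<Delta>t: "\<Delta> = N + t / e" using e by (simp add: t_def)
      have h: "0 < K * e\<^sup>2" using K e2 by simp
      have t_gt: "t > t0 + K * e\<^sup>2"
        using gt e unfolding x2_def \<Delta>t by (simp add: divide_less_cancel)
      have tailM: "fock_tail n (N + M / e) < m / 2"
        using approx[of M] M0 M(3) sm(2) by (simp add: abs_le_iff)
      have far: "fock_tail n y < m / 2" if "y \<ge> N + M / e" for y
        using fock_tail_antimono[of n "N + M / e" y] that tailM M0 e by (simp add: N_def)
      have "m \<le> 1" unfolding m_def using anti[of t0 "max t0 0"] t0(1) by simp
      \<comment> \<open>The first shell: the linear range, the gap \<open>m'\<close> to its right
        and the far range beyond \<open>M\<close> are treated separately.\<close>
      have first: "fock_tail n \<Delta> \<le> 1"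
      proof (cases "t \<le> M")
        case True
        hence tM: "\<bar>t\<bar> \<le> M" using t_gt h M(1) by (auto simp: abs_le_iff)
        have "C * e\<^sup>2 \<le> 1 - airy_tail t"
        proof (cases "t \<le> t0 + \<delta>")
          case True
          have "\<alpha> / 2 * (K * e\<^sup>2) \<le> \<alpha> / 2 * (t - t0)" using t_gt \<alpha> by (intro mult_left_mono) auto
          also have "\<dots> \<le> 1 - airy_tail t"
          proof -
            have "\<bar>1 - airy_tail (t0 + (t - t0)) - \<alpha> * (t - t0)\<bar> \<le> \<alpha> / 2 * \<bar>t - t0\<bar>"
              using True t_gt h by (intro \<delta>(2)) simp
            from abs_le_D2[OF this] have "\<alpha> * (t - t0) - (1 - airy_tail t) \<le> \<alpha> / 2 * \<bar>t - t0\<bar>"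
              by simp
            moreover have "\<bar>t - t0\<bar> = t - t0" using t_gt h by simp
            ultimately show ?thesis by simp
          qed
          finally have "(\<alpha> / 2 * K) * e\<^sup>2 \<le> 1 - airy_tail t" by simp
          hence "C * e\<^sup>2 + e\<^sup>2 \<le> 1 - airy_tail t" unfolding \<alpha>K by (simp add: algebra_simps)
          thus ?thesis using e2 by linarith
        next
          case False
          hence "m' \<le> 1 - airy_tail t" unfolding m'_def using anti[of "t0 + \<delta>" t] \<delta>(1) by simp
          thus ?thesis using sm(3) by simp
        qed
        thus ?thesis using approx[OF tM] unfolding \<Delta>t by (simp add: abs_le_iff)
      next
        case False
        hence "\<Delta> \<ge> N + M / e" using e unfolding \<Delta>t by (simp add: divide_right_mono)
        thus ?thesis using far[of \<Delta>] m \<open>m \<le> 1\<close> by simp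
      qed
      have k2: "k \<ge> 2"
      proof (rule ccontr)
        assume "\<not> ?thesis"
        hence "k = 1" using k by simp
        thus False using w first by (simp add: fock_tail_0)
      qed
      \<comment> \<open>Beyond \<open>N\<close> the tail decreases, so a negative shell has to start
        before \<open>N\<close>.\<close>
      have small_step: "(real k - 1) * \<Delta> < N"
      proof (rule ccontr)
        assume "\<not> ?thesis"
        moreover have "(real k - 1) * \<Delta> \<le> real k * \<Delta>" using pos by (intro mult_right_mono) auto
        ultimately show False using w fock_tail_antimono[of n "(real k - 1) * \<Delta>" "real k * \<Delta>"]
          by (simp add: N_def)
      qed
      have "t \<ge> - M" using t_gt h M(1) by linarith
      hence "- M / e \<le> t / e" using e(1) by (intro divide_right_mono) auto
      hence "- (M / e) \<le> t / e" by simp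
      hence "N + M / e \<le> N + (3 * (M / e) + 2 * (t / e))" by linarith
      also have "\<dots> \<le> N + (N + 2 * (t / e))" using small_N by simp
      finally have dbl: "2 * \<Delta> \<ge> N + M / e" unfolding \<Delta>t by simp
      \<comment> \<open>A shell with \<open>k \<ge> 3\<close> starts at or beyond
        \<open>2 * \<Delta>\<close>, already past \<open>N\<close>. Only the second shell with
        \<open>\<Delta> < N\<close> is left, and there the tail drops from above
        \<open>3 * m / 4\<close> to below \<open>m / 2\<close>.\<close>
      have kk: "k = 2"
      proof (rule ccontr)
        assume "k \<noteq> 2"
        hence "2 * \<Delta> \<le> (real k - 1) * \<Delta>" using k2 pos by (intro mult_right_mono) auto
        moreover have "0 \<le> M / e" using M0 e by simp
        ultimately show False using dbl small_step by linarith
      qed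
      hence "\<Delta> < N" using small_step by simp
      hence t_neg: "t < 0" using e by (simp add: t_def mult_neg_pos)
      have "m \<le> airy_tail t" unfolding m_def using t_gt h t_neg by (intro anti) auto
      moreover have "\<bar>t\<bar> \<le> M" using t_neg \<open>t \<ge> - M\<close> by simp
      ultimately have "m - m / 4 < fock_tail n \<Delta>"
        using approx[of t] sm(2) unfolding \<Delta>t by (simp add: abs_le_iff)
      thus False using w far[OF dbl] m unfolding kk by simp
    qed
    have ne: "negative_scales n \<noteq> {}" using x1 by blast
    have "x1 \<le> Sup (negative_scales n)" by (rule cSup_upper[OF x1 bdd_aboveI[of _ x2]]) (rule x2)
    moreover have "Sup (negative_scales n) \<le> x2" by (rule cSup_least[OF ne x2])
    moreover have "x1 = N + t0 / e - K * e" "x2 = N + t0 / e + K * e"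
      using e by (simp_all add: x1_def x2_def field_simps power2_eq_square)
    ultimately show ?thesis
      using ne unfolding radial_negativity_scale_def N_def[symmetric] e_def[symmetric] by (simp add: abs_le_iff)
  qed
  \<comment> \<open>The factor \<open>2 powr (- 1 / 3)\<close> cancels the 2 in
    \<open>4 * n + 2 = 2 * N\<close>, leaving \<open>N powr (1 / 3) = 1 / d n\<close>.\<close>
  have target: "(2 * real n + 1) + 2 powr (- 1 / 3) * t0 * (4 * real n + 2) powr (1 / 3)
      = real (2 * n + 1) + t0 / d n" for n
  proof -
    have "(4 * real n + 2) powr (1 / 3) = (2 * real (2 * n + 1)) powr (1 / 3)" by (simp add: add.commute)
    also have "\<dots> = 2 powr (1 / 3) * real (2 * n + 1) powr (1 / 3)" by (rule powr_mult)
    finally have "2 powr (- 1 / 3) * (4 * real n + 2) powr (1 / 3) = (2 powr (- 1 / 3) * 2 powr (1 / 3)) * real (2 * n + 1) powr (1 / 3)"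
      by simp
    also have "2 powr (- 1 / 3) * 2 powr (1 / 3) = (1 :: real)" by (simp flip: powr_add)
    also have "1 * real (2 * n + 1) powr (1 / 3) = 1 / d n"
      unfolding d_def by (simp add: powr_minus_divide)
    finally have "t0 * (2 powr (- 1 / 3) * (4 * real n + 2) powr (1 / 3)) = t0 * (1 / d n)" by simp
    thus ?thesis by (simp add: mult_ac)
  qed
  have d2: "(\<lambda>n. c * (d n)\<^sup>2) \<longlonglongrightarrow> 0" for c
    using tendsto_mult_left[OF Airy_scale_square_tendsto, of c] by (simp add: d_def)
  have ev: "eventually (\<lambda>n. c * (d n)\<^sup>2 < r) sequentially" if "r > 0" for c r
    using order_tendstoD(2)[OF d2 that] .
  have "(\<lambda>n. radial_negativity_scale n
          - ((2 * real n + 1) + 2 powr (- 1 / 3) * t0 * (4 * real n + 2) powr (1 / 3)))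
      \<in> O(\<lambda>n. real n powr (- 1 / 3))"
  proof (rule bigoI[of _ K])
    have "eventually (\<lambda>n. 3 * M * (d n)\<^sup>2 < 1 \<and> C * (d n)\<^sup>2 < m / 4 \<and> C * (d n)\<^sup>2 < m' \<and>
        K * (d n)\<^sup>2 < \<delta> \<and> K * (d n)\<^sup>2 < 1 \<and> n > 0) sequentially"
      using m m' \<delta>(1) by (intro eventually_conj ev eventually_gt_at_top) auto
    thus "eventually (\<lambda>n. norm (radial_negativity_scale n
          - ((2 * real n + 1) + 2 powr (- 1 / 3) * t0 * (4 * real n + 2) powr (1 / 3)))
        \<le> K * norm (real n powr (- 1 / 3))) sequentially"
    proof eventually_elim
      case (elim n)
      have "d n \<le> real n powr (- 1 / 3)" unfolding d_def using elim by (intro powr_mono2') auto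
      hence "K * d n \<le> K * real n powr (- 1 / 3)" using K by (intro mult_left_mono) auto
      thus ?case unfolding target using bound[of n] elim by simp
    qed
  qed
  with largest show ?thesis by blast
qed

end
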